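(* Let $h:(0,1)\to\mathbb R^d$ be a continuous vector-function with $\int_0^1h(s)h^*(s)\,ds=I_d$, and suppose that the matrix $$\mathbf N(t)=\int_t^1h(s)h^*(s)\,ds$$ is nondegenerate for every $t\in[0,1)$. Let $w(s)$, $0\le s\le1$, be a Wiener process and $$U(t)=w(t)-\Bigl\langle\int_0^1h(s)\,dw(s),\int_0^th(s)\,ds\Bigr\rangle,\qquad 0\le t\le1 .$$ Then the process $$L_2[U](t)=U(t)+\int_0^t\int_0^sh^*(v)\,\mathbf N(s)^{-1}\,h(s)\,dU(v)\,ds,\qquad t\in[0,1),$$ is a Wiener process.
   Context: $^*$ denotes transposition, $\langle\cdot,\cdot\rangle$ the scalar product in $\mathbb R^d$, $I_d$ the $d\times d$ identity matrix. Integrals with respect to $U$ are understood via $dU(v)=dw(v)-\langle\zeta_*,h(v)\rangle\,dv$ with $\zeta_*=\int_0^1h(s)\,dw(s)$ (the integral with respect to $w$ being a Wiener integral). *)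

theory Defs
  imports "HOL-Probability.Probability"
begin

text \<open>
  A standard one-dimensional Wiener process with index set \<open>T\<close> (below \<open>{0..1}\<close> or \<open>{0..<1}\<close>),
  on a probability space \<open>M\<close> that need not be complete; start and path continuity are almost sure.
\<close>

definition wiener_process :: "'a measure \<Rightarrow> real set \<Rightarrow> (real \<Rightarrow> 'a \<Rightarrow> real) \<Rightarrow> bool" where
  "wiener_process M T W \<longleftrightarrow>
     prob_space M \<and>
     (\<forall>t\<in>T. W t \<in> borel_measurable M) \<and>
     (AE \<omega> in M. W 0 \<omega> = 0) \<and>
     (\<forall>s\<in>T. \<forall>t\<in>T. s < t \<longrightarrow>
        distributed M lborel (\<lambda>\<omega>. W t \<omega> - W s \<omega>) (normal_density 0 (sqrt (t - s)))) \<and>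
     (\<forall>n (t :: nat \<Rightarrow> real). strict_mono_on {..n} t \<and> t ` {..n} \<subseteq> T \<longrightarrow>
        prob_space.indep_vars M (\<lambda>_. borel) (\<lambda>i \<omega>. W (t (Suc i)) \<omega> - W (t i) \<omega>) {..<n}) \<and>
     (AE \<omega> in M. continuous_on T (\<lambda>t. W t \<omega>))"

text \<open>
  A list of triples \<open>(c, p, q)\<close> encodes the step function that sums \<open>c\<close> times the indicator of
  \<open>{p<..q}\<close>; overlapping intervals are harmless since the integral is additive in the entries.
\<close>

definition step_function :: "(real \<times> real \<times> real) list \<Rightarrow> real \<Rightarrow> real" where
  "step_function S x = (\<Sum>(c, p, q)\<leftarrow>S. c * indicator {p<..q} x)"

definition step_integral ::
  "(real \<Rightarrow> 'a \<Rightarrow> real) \<Rightarrow> (real \<times> real \<times> real) list \<Rightarrow> 'a \<Rightarrow> real" where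
  "step_integral w S \<omega> = (\<Sum>(c, p, q)\<leftarrow>S. c * (w q \<omega> - w p \<omega>))"

text \<open>
  The random variable \<open>X\<close> is a version of the Wiener integral of \<open>f\<close> over \<open>(a, b)\<close>: the limit in
  mean square of the integrals of step functions that converge to \<open>f\<close> in \<open>L\<^sup>2(a, b)\<close>.  The integral
  is determined only up to almost sure equality, hence a relation.  The nonnegative integrals
  make a missing square integrability show up as the value \<open>\<infinity>\<close>.
\<close>

definition has_wiener_integral ::
  "'a measure \<Rightarrow> (real \<Rightarrow> 'a \<Rightarrow> real) \<Rightarrow> real \<Rightarrow> real \<Rightarrow> (real \<Rightarrow> real) \<Rightarrow> ('a \<Rightarrow> real) \<Rightarrow> bool" where
  "has_wiener_integral M w a b f X \<longleftrightarrow>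
     set_borel_measurable borel {a<..<b} f \<and>
     X \<in> borel_measurable M \<and>
     (\<exists>S :: nat \<Rightarrow> (real \<times> real \<times> real) list.
        (\<forall>n. \<forall>(c, p, q)\<in>set (S n). a \<le> p \<and> p \<le> q \<and> q \<le> b) \<and>
        (\<lambda>n. \<integral>\<^sup>+x\<in>{a<..<b}. ennreal ((f x - step_function (S n) x)\<^sup>2) \<partial>lborel) \<longlonglongrightarrow> 0 \<and>
        (\<lambda>n. \<integral>\<^sup>+\<omega>. ennreal ((X \<omega> - step_integral w (S n) \<omega>)\<^sup>2) \<partial>M) \<longlonglongrightarrow> 0)"

definition has_vec_wiener_integral ::
  "'a measure \<Rightarrow> (real \<Rightarrow> 'a \<Rightarrow> real) \<Rightarrow> real \<Rightarrow> real \<Rightarrow> (real \<Rightarrow> real ^ 'd) \<Rightarrow> ('a \<Rightarrow> real ^ 'd) \<Rightarrow> bool"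
  where
  "has_vec_wiener_integral M w a b f X \<longleftrightarrow>
     (\<forall>i. has_wiener_integral M w a b (\<lambda>s. f s $ i) (\<lambda>\<omega>. X \<omega> $ i))"

text \<open>
  The function \<open>h\<close> lives on the open interval \<open>(0, 1)\<close>; all integrals are over open intervals, so
  the values of \<open>h\<close> elsewhere are irrelevant.
\<close>

definition outer :: "real ^ 'd \<Rightarrow> real ^ 'd ^ 'd" where
  "outer v = (\<chi> i j. v $ i * v $ j)"

definition N_mat :: "(real \<Rightarrow> real ^ 'd) \<Rightarrow> real \<Rightarrow> real ^ 'd ^ 'd" where
  "N_mat h t = (LINT s:{t<..<1}|lborel. outer (h s))"

text \<open>In the following, \<open>\<zeta>\<close> stands for a version of the Wiener integral of \<open>h\<close> over \<open>(0, 1)\<close>.\<close>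

definition U_process ::
  "(real \<Rightarrow> real ^ 'd) \<Rightarrow> (real \<Rightarrow> 'a \<Rightarrow> real) \<Rightarrow> ('a \<Rightarrow> real ^ 'd) \<Rightarrow> real \<Rightarrow> 'a \<Rightarrow> real" where
  "U_process h w \<zeta> t \<omega> = w t \<omega> - \<zeta> \<omega> \<bullet> (LINT s:{0<..<t}|lborel. h s)"

text \<open>\<open>X\<close> is a version of \<open>\<integral>\<^sub>a\<^sup>b f(v) dU(v)\<close>, with \<open>dU(v) = dw(v) - \<langle>\<zeta>, h(v)\<rangle> dv\<close>.\<close>

definition has_U_integral ::
  "'a measure \<Rightarrow> (real \<Rightarrow> real ^ 'd) \<Rightarrow> (real \<Rightarrow> 'a \<Rightarrow> real) \<Rightarrow> ('a \<Rightarrow> real ^ 'd) \<Rightarrow>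
     real \<Rightarrow> real \<Rightarrow> (real \<Rightarrow> real) \<Rightarrow> ('a \<Rightarrow> real) \<Rightarrow> bool" where
  "has_U_integral M h w \<zeta> a b f X \<longleftrightarrow>
     (\<exists>Y. has_wiener_integral M w a b f Y \<and>
        (\<forall>\<omega>\<in>space M. X \<omega> = Y \<omega> - (LINT v:{a<..<b}|lborel. f v * (\<zeta> \<omega> \<bullet> h v))))"

text \<open>
  \<open>L\<close> is the process \<open>L\<^sub>2[U]\<close>.  The inner integrals \<open>J s\<close> are fixed only up to a null set depending
  on \<open>s\<close>; to integrate in \<open>s\<close> along paths, one takes a version that is jointly measurable in
  \<open>(s, \<omega>)\<close>.  By Fubini, two such versions give almost surely the same outer integrals.
\<close>

definition is_L2_transform ::
  "'a measure \<Rightarrow> (real \<Rightarrow> real ^ 'd) \<Rightarrow> (real \<Rightarrow> 'a \<Rightarrow> real) \<Rightarrow> ('a \<Rightarrow> real ^ 'd) \<Rightarrow>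
     (real \<Rightarrow> 'a \<Rightarrow> real) \<Rightarrow> bool" where
  "is_L2_transform M h w \<zeta> L \<longleftrightarrow>
     (\<exists>J :: real \<Rightarrow> 'a \<Rightarrow> real.
        (\<lambda>(s, \<omega>). J s \<omega>) \<in> borel_measurable (restrict_space borel {0<..<1} \<Otimes>\<^sub>M M) \<and>
        (\<forall>s\<in>{0<..<1}.
           has_U_integral M h w \<zeta> 0 s (\<lambda>v. h v \<bullet> (matrix_inv (N_mat h s) *v h s)) (J s)) \<and>
        (AE \<omega> in M. \<forall>t\<in>{0..<1}. set_integrable lborel {0<..<t} (\<lambda>s. J s \<omega>)) \<and>
        (\<forall>t\<in>{0..<1}. \<forall>\<omega>\<in>space M.
           L t \<omega> = U_process h w \<zeta> t \<omega> + (LINT s:{0<..<t}|lborel. J s \<omega>)))"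

end

theory Submission
  imports Defs
begin

text \<open>
  With \<open>g s = N(s)\<^sup>-\<^sup>1 h(s)\<close>, the integrand of the correction term is \<open>\<langle>\<zeta>, h(s)\<rangle>\<close> minus the Wiener
  integral of \<open>v \<mapsto> \<langle>h(v), g s\<rangle>\<close> over \<open>(s, 1)\<close>: the terms of \<open>U\<close> containing \<open>\<zeta>\<close> cancel, and by a
  stochastic Fubini theorem \<open>L t\<close> is the Wiener integral of the function
  \<open>k t v = 1\<^bsub>v \<le> t\<^esub> - \<langle>h(v), \<integral>\<^bsub>(0, min t v)\<^esub> g(s) ds\<rangle>\<close>.
  Put \<open>f s v = - 1\<^bsub>v > s\<^esub> \<langle>h(v), g s\<rangle>\<close>.  Since \<open>N(s) g s = h(s)\<close>, the inner product of \<open>f s\<close> and \<open>f u\<close>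
  in \<open>L\<^sup>2(0, 1)\<close> equals \<open>- (f s u + f u s)\<close>, and integrating over \<open>s < r\<close>, \<open>u < t\<close> shows
  that \<open>k r\<close> and \<open>k t\<close> have inner product \<open>min r t\<close>.  So \<open>L\<close> is centred Gaussian with the
  covariance of a Wiener process.
\<close>

section \<open>Square integrable functions\<close>

text \<open>Since \<zeta> depends on the whole path of \<open>w\<close>, the correction term is
  anticipating; the argument therefore uses only the L2 isometry, no filtration. The terms with
  \<zeta> cancel because the matrices \<open>outer (h v)\<close> integrate over
  \<open>(0, s)\<close> to \<open>mat 1 - N_mat h s\<close>, which maps \<open>g s\<close> to
  \<open>g s - h s\<close>. The drift inside the inner integral is thus
  \<open>\<zeta> \<bullet> g s - \<zeta> \<bullet> h s\<close>: the second part undoes the drift of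
  \<open>U\<close>, the first is itself a Wiener integral over all of \<open>(0, 1)\<close>. In the
  inner product of \<open>k r\<close> and \<open>k t\<close>, the mixed terms between indicator and
  integral part are compensated by the product of the integral parts. Two obstacles shape the proof.
  \<open>N_mat h s\<close> degenerates as \<open>s\<close> tends to 1, so all kernels are cut off at
  some \<open>t < 1\<close>. And a Wiener integral is determined only up to a null set that depends
  on \<open>s\<close>, so a jointly measurable version must be built before integrating in
  \<open>s\<close>.\<close>

definition sq_integrable :: "'a measure \<Rightarrow> ('a \<Rightarrow> real) \<Rightarrow> bool" where
  "sq_integrable M f \<longleftrightarrow> f \<in> borel_measurable M \<and> integrable M (\<lambda>x. (f x)\<^sup>2)"

lemma sq_integrable_measurable [measurable_dest]: "sq_integrable M f \<Longrightarrow> f \<in> borel_measurable M"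
  by (simp add: sq_integrable_def)

lemma sq_integrable_integrable_square: "sq_integrable M f \<Longrightarrow> integrable M (\<lambda>x. (f x)\<^sup>2)"
  by (simp add: sq_integrable_def)

lemma sq_integrable_iff_nn_integral:
  "sq_integrable M f \<longleftrightarrow> f \<in> borel_measurable M \<and> (\<integral>\<^sup>+x. ennreal ((f x)\<^sup>2) \<partial>M) < \<infinity>"
  unfolding sq_integrable_def by (auto simp: integrable_iff_bounded)

lemma sq_integrable_bound:
  assumes "integrable M g" "f \<in> borel_measurable M" "AE x in M. (f x)\<^sup>2 \<le> g x"
  shows "sq_integrable M f"
  unfolding sq_integrable_def
proof (intro conjI)
  show "integrable M (\<lambda>x. (f x)\<^sup>2)"
    by (rule Bochner_Integration.integrable_bound[OF assms(1)]) (use assms(2,3) in auto)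
qed (use assms in auto)

lemma abs_mult_le_squares: "\<bar>x * y\<bar> \<le> x\<^sup>2 + y\<^sup>2" for x y :: real
proof -
  have "0 \<le> (\<bar>x\<bar> - \<bar>y\<bar>)\<^sup>2" by simp
  then have "2 * \<bar>x * y\<bar> \<le> x\<^sup>2 + y\<^sup>2" by (simp add: power2_diff abs_mult)
  moreover have "0 \<le> \<bar>x * y\<bar>" by simp
  ultimately show ?thesis by linarith
qed

lemma square_add_le: "(x + y)\<^sup>2 \<le> 2 * x\<^sup>2 + 2 * y\<^sup>2" for x y :: real
proof -
  have "0 \<le> (x - y)\<^sup>2" by simp
  then show ?thesis by (simp add: power2_diff power2_sum)
qed

lemma integrable_sq_mult:
  assumes [measurable]: "sq_integrable M f" "sq_integrable M g"
  shows "integrable M (\<lambda>x. f x * g x)"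
proof (rule Bochner_Integration.integrable_bound)
  show "integrable M (\<lambda>x. (f x)\<^sup>2 + (g x)\<^sup>2)"
    using assms by (simp add: sq_integrable_def)
  show "AE x in M. norm (f x * g x) \<le> norm ((f x)\<^sup>2 + (g x)\<^sup>2)"
    using abs_mult_le_squares by (auto simp: abs_mult)
qed measurable

lemma sq_integrable_add:
  assumes [measurable]: "sq_integrable M f" "sq_integrable M g"
  shows "sq_integrable M (\<lambda>x. f x + g x)"
proof (rule sq_integrable_bound)
  show "integrable M (\<lambda>x. 2 * (f x)\<^sup>2 + 2 * (g x)\<^sup>2)"
    using assms by (simp add: sq_integrable_def)
  show "AE x in M. (f x + g x)\<^sup>2 \<le> 2 * (f x)\<^sup>2 + 2 * (g x)\<^sup>2"
    using square_add_le by auto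
qed measurable

lemma sq_integrable_cmult:
  "sq_integrable M f \<Longrightarrow> sq_integrable M (\<lambda>x. c * f x)"
  by (auto simp: sq_integrable_def power_mult_distrib)

lemma sq_integrable_zero: "sq_integrable M (\<lambda>x. 0)"
  by (simp add: sq_integrable_def)

lemma sq_integrable_diff:
  "sq_integrable M f \<Longrightarrow> sq_integrable M g \<Longrightarrow> sq_integrable M (\<lambda>x. f x - g x)"
  using sq_integrable_add[of M f "\<lambda>x. (-1) * g x"] sq_integrable_cmult[of M g "-1"] by simp

lemma sq_integrable_sum:
  "(\<And>i. i \<in> I \<Longrightarrow> sq_integrable M (f i)) \<Longrightarrow> sq_integrable M (\<lambda>x. \<Sum>i\<in>I. f i x)"
  by (induction I rule: infinite_finite_induct) (auto simp: sq_integrable_zero intro!: sq_integrable_add)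

lemma (in finite_measure) sq_integrable_bounded:
  assumes "f \<in> borel_measurable M" "\<And>x. x \<in> space M \<Longrightarrow> \<bar>f x\<bar> \<le> C"
  shows "sq_integrable M f"
proof (rule sq_integrable_bound)
  show "integrable M (\<lambda>x. C\<^sup>2)" by simp
  show "AE x in M. (f x)\<^sup>2 \<le> C\<^sup>2"
    using assms(2) by (intro AE_I2) (metis abs_ge_zero power2_abs power_mono)
qed (fact assms(1))

lemma (in finite_measure) sq_integrable_imp_integrable:
  assumes "sq_integrable M f"
  shows "integrable M f"
proof -
  have "sq_integrable M (\<lambda>_. 1)" by (rule sq_integrable_bounded[where C=1]) auto
  from integrable_sq_mult[OF assms this] show ?thesis by simp
qed

text \<open>Nonnegativity of the variance. It bounds the squared time average of a kernel by the
  time average of its square.\<close>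

lemma (in prob_space) square_expectation_le:
  assumes "sq_integrable M f"
  shows "(\<integral>x. f x \<partial>M)\<^sup>2 \<le> (\<integral>x. (f x)\<^sup>2 \<partial>M)"
proof -
  let ?m = "\<integral>x. f x \<partial>M"
  have i: "integrable M f" "integrable M (\<lambda>x. (f x)\<^sup>2)"
    using sq_integrable_imp_integrable[OF assms] sq_integrable_integrable_square[OF assms] by blast+
  have "0 \<le> (\<integral>x. (f x - ?m)\<^sup>2 \<partial>M)" by simp
  also have "\<dots> = (\<integral>x. (f x)\<^sup>2 - 2 * ?m * f x + ?m\<^sup>2 \<partial>M)"
    by (intro Bochner_Integration.integral_cong refl) (simp add: power2_diff)
  also have "\<dots> = (\<integral>x. (f x)\<^sup>2 \<partial>M) - 2 * ?m * ?m + ?m\<^sup>2"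
    using i by (simp add: prob_space)
  also have "\<dots> = (\<integral>x. (f x)\<^sup>2 \<partial>M) - ?m\<^sup>2"
    by (simp add: power2_eq_square)
  finally show ?thesis by simp
qed

section \<open>Independence from the joint characteristic function\<close>

text \<open>
  If \<open>Z\<close> and the exponentials of \<open>X\<close> are uncorrelated, then tilting the measure by \<open>2 + Z\<close>
  does not change the characteristic function of \<open>X\<close>, hence not its law.
\<close>

lemma (in prob_space) uncorrelated_indicator_real:
  fixes Z X :: "'a \<Rightarrow> real"
  assumes [measurable]: "Z \<in> borel_measurable M" "X \<in> borel_measurable M" "A \<in> sets borel"
    and Z: "\<And>\<omega>. \<bar>Z \<omega>\<bar> \<le> 1"
    and uc: "\<And>u. (\<integral>\<omega>. Z \<omega> * iexp (u * X \<omega>) \<partial>M) = (\<integral>\<omega>. Z \<omega> \<partial>M) * (\<integral>\<omega>. iexp (u * X \<omega>) \<partial>M)"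
  shows "(\<integral>\<omega>. Z \<omega> * indicator A (X \<omega>) \<partial>M) = (\<integral>\<omega>. Z \<omega> \<partial>M) * prob (X -` A \<inter> space M)"
proof -
  let ?e = "2 + (\<integral>\<omega>. Z \<omega> \<partial>M)"
  have iZ: "integrable M Z"
    by (rule integrable_const_bound[where B=1]) (use Z in auto)
  \<comment> \<open>The shift must exceed 1: with \<open>1 + Z\<close> the total mass would vanish
    for \<open>Z\<close> constantly -1.\<close>
  have Zge: "1 \<le> 2 + Z \<omega>" for \<omega> using Z[of \<omega>] by linarith
  have e: "?e = (\<integral>\<omega>. 2 + Z \<omega> \<partial>M)"
    using iZ by (simp add: prob_space)
  have "1 \<le> (\<integral>\<omega>. 2 + Z \<omega> \<partial>M)"
    using integral_mono[of M "\<lambda>_. 1" "\<lambda>\<omega>. 2 + Z \<omega>"] iZ Zge by (simp add: prob_space)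
  then have epos: "?e > 0" unfolding e by linarith
  define D where "D \<omega> = (2 + Z \<omega>) / ?e" for \<omega>
  have [measurable]: "D \<in> borel_measurable M" unfolding D_def by measurable
  have Dpos: "0 \<le> D \<omega>" for \<omega> using Zge[of \<omega>] epos unfolding D_def by (intro divide_nonneg_pos) auto
  have iD: "integrable M D" unfolding D_def using iZ by simp
  have ID: "(\<integral>\<omega>. D \<omega> \<partial>M) = 1" unfolding D_def using iZ epos by (simp add: prob_space)
  let ?P = "density M (\<lambda>\<omega>. ennreal (D \<omega>))"
  have "emeasure ?P (space ?P) = 1"
    using iD ID Dpos by (simp add: emeasure_density nn_integral_eq_integral cong: nn_integral_cong)
  then interpret P: prob_space ?P by (rule prob_spaceI)
  have rv: "X \<in> borel_measurable ?P" by simp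
  have rd1: "real_distribution (distr ?P borel X)" by (intro P.real_distribution_distr rv)
  have rd2: "real_distribution (distr M borel X)" by (intro real_distribution_distr) simp
  have ii: "integrable M (\<lambda>\<omega>. iexp (u * X \<omega>))" for u
    by (rule integrable_const_bound[where B=1]) auto
  have iiZ: "integrable M (\<lambda>\<omega>. Z \<omega> * iexp (u * X \<omega>))" for u
    by (rule integrable_const_bound[where B=1]) (use Z in \<open>auto simp: norm_mult\<close>)
  have "char (distr ?P borel X) = char (distr M borel X)"
  proof
    fix u
    have "char (distr ?P borel X) u = (\<integral>\<omega>. D \<omega> *\<^sub>R iexp (u * X \<omega>) \<partial>M)"
      unfolding char_def using Dpos by (subst integral_distr) (auto simp: integral_density)
    also have "\<dots> = (\<integral>\<omega>. (2 * iexp (u * X \<omega>) + Z \<omega> * iexp (u * X \<omega>)) / ?e \<partial>M)"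
      by (intro Bochner_Integration.integral_cong)
        (simp_all add: D_def scaleR_conv_of_real divide_simps distrib_right)
    also have "\<dots> = (2 * (\<integral>\<omega>. iexp (u * X \<omega>) \<partial>M) + (\<integral>\<omega>. Z \<omega> * iexp (u * X \<omega>) \<partial>M)) / ?e"
      using ii iiZ by simp
    also have "\<dots> = (?e * (\<integral>\<omega>. iexp (u * X \<omega>) \<partial>M)) / ?e"
      unfolding uc by (simp add: distrib_right)
    also have "\<dots> = (\<integral>\<omega>. iexp (u * X \<omega>) \<partial>M)"
      using epos by (metis nonzero_mult_div_cancel_left of_real_eq_0_iff less_irrefl)
    also have "\<dots> = char (distr M borel X) u"
      unfolding char_def by (subst integral_distr) auto
    finally show "char (distr ?P borel X) u = char (distr M borel X) u" .
  qed
  then have law: "distr ?P borel X = distr M borel X" by (intro Levy_uniqueness rd1 rd2)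
  have "(\<integral>\<omega>. D \<omega> * indicator A (X \<omega>) \<partial>M) = (\<integral>x. indicator A x \<partial>distr ?P borel X)"
    using Dpos by (subst integral_distr) (auto simp: integral_density)
  also have "\<dots> = prob (X -` A \<inter> space M)"
    unfolding law by (simp add: measure_distr)
  finally have *: "(\<integral>\<omega>. D \<omega> * indicator A (X \<omega>) \<partial>M) = prob (X -` A \<inter> space M)" .
  have iZA: "integrable M (\<lambda>\<omega>. Z \<omega> * indicator A (X \<omega>))"
    by (rule integrable_const_bound[where B=1]) (use Z in \<open>auto simp: abs_mult indicator_def\<close>)
  have iA: "integrable M (\<lambda>\<omega>. indicator A (X \<omega>) :: real)"
    by (rule integrable_const_bound[where B=1]) (auto simp: indicator_def)
  have "(\<integral>\<omega>. indicator A (X \<omega>) \<partial>M) = (\<integral>x. (indicator A x :: real) \<partial>distr M borel X)"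
    by (subst integral_distr) auto
  then have pA: "(\<integral>\<omega>. indicator A (X \<omega>) \<partial>M) = prob (X -` A \<inter> space M)"
    by (simp add: measure_distr)
  have "(\<integral>\<omega>. D \<omega> * indicator A (X \<omega>) \<partial>M) = (\<integral>\<omega>. (2 * indicator A (X \<omega>) + Z \<omega> * indicator A (X \<omega>)) / ?e \<partial>M)"
    by (intro Bochner_Integration.integral_cong) (simp_all add: D_def divide_simps distrib_right)
  also have "\<dots> = (2 * prob (X -` A \<inter> space M) + (\<integral>\<omega>. Z \<omega> * indicator A (X \<omega>) \<partial>M)) / ?e"
    using iZA iA by (simp add: pA)
  finally show ?thesis using * epos by (simp add: field_simps)
qed

text \<open>Reduces to the real case for \<open>Re\<close> and \<open>Im\<close> of
  \<open>Z\<close>. As the hypothesis holds for all \<open>u\<close>, conjugating it with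
  \<open>- u\<close> in place of \<open>u\<close> gives it for the conjugate of \<open>Z\<close>,
  hence for both parts.\<close>

lemma (in prob_space) uncorrelated_indicator_complex:
  fixes Z :: "'a \<Rightarrow> complex" and X :: "'a \<Rightarrow> real"
  assumes [measurable]: "Z \<in> borel_measurable M" "X \<in> borel_measurable M" "A \<in> sets borel"
    and Z: "\<And>\<omega>. norm (Z \<omega>) \<le> 1"
    and uc: "\<And>u. (\<integral>\<omega>. Z \<omega> * iexp (u * X \<omega>) \<partial>M) = (\<integral>\<omega>. Z \<omega> \<partial>M) * (\<integral>\<omega>. iexp (u * X \<omega>) \<partial>M)"
  shows "(\<integral>\<omega>. Z \<omega> * indicator A (X \<omega>) \<partial>M) = (\<integral>\<omega>. Z \<omega> \<partial>M) * prob (X -` A \<inter> space M)"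
proof -
  have iZ: "integrable M Z"
    by (rule integrable_const_bound[where B=1]) (use Z in auto)
  have iZe: "integrable M (\<lambda>\<omega>. Z \<omega> * iexp (u * X \<omega>))" for u
    by (rule integrable_const_bound[where B=1]) (use Z in \<open>auto simp: norm_mult\<close>)
  have iZA: "integrable M (\<lambda>\<omega>. Z \<omega> * indicator A (X \<omega>))"
    by (rule integrable_const_bound[where B=1]) (use Z in \<open>auto simp: norm_mult indicator_def\<close>)
  have [measurable]: "(\<lambda>\<omega>. cnj (Z \<omega>)) \<in> borel_measurable M"
    by (rule measurable_compose[OF _ borel_measurable_continuous_onI]) (auto intro: continuous_intros)
  have iC: "integrable M (\<lambda>\<omega>. cnj (Z \<omega>) * iexp (u * X \<omega>))" for u
    by (rule integrable_const_bound[where B=1]) (use Z in \<open>auto simp: norm_mult\<close>)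
  have cc: "cnj (iexp (u * x)) = iexp (- u * x)" for u x :: real
    by (simp add: exp_cnj)
  have ucn: "(\<integral>\<omega>. cnj (Z \<omega>) * iexp (u * X \<omega>) \<partial>M) = cnj (\<integral>\<omega>. Z \<omega> \<partial>M) * (\<integral>\<omega>. iexp (u * X \<omega>) \<partial>M)" for u
  proof -
    have "(\<integral>\<omega>. cnj (Z \<omega>) * iexp (u * X \<omega>) \<partial>M) = (\<integral>\<omega>. cnj (Z \<omega> * iexp (- u * X \<omega>)) \<partial>M)"
      by (simp only: complex_cnj_mult cc) simp
    also have "\<dots> = cnj (\<integral>\<omega>. Z \<omega> * iexp (- u * X \<omega>) \<partial>M)" by (rule Bochner_Integration.integral_cnj)
    also have "\<dots> = cnj (\<integral>\<omega>. Z \<omega> \<partial>M) * cnj (\<integral>\<omega>. iexp (- u * X \<omega>) \<partial>M)"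
      by (subst uc) (rule complex_cnj_mult)
    also have "cnj (\<integral>\<omega>. iexp (- u * X \<omega>) \<partial>M) = (\<integral>\<omega>. cnj (iexp (- u * X \<omega>)) \<partial>M)"
      by (rule Bochner_Integration.integral_cnj[symmetric])
    finally show ?thesis by (simp only: cc) simp
  qed
  have re: "(\<integral>\<omega>. Re (Z \<omega>) * indicator A (X \<omega>) \<partial>M) = (\<integral>\<omega>. Re (Z \<omega>) \<partial>M) * prob (X -` A \<inter> space M)"
  proof (rule uncorrelated_indicator_real)
    show "\<bar>Re (Z \<omega>)\<bar> \<le> 1" for \<omega> using Z[of \<omega>] abs_Re_le_cmod[of "Z \<omega>"] by linarith
    fix u
    have "(\<integral>\<omega>. of_real (Re (Z \<omega>)) * iexp (u * X \<omega>) \<partial>M)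
        = (\<integral>\<omega>. (Z \<omega> * iexp (u * X \<omega>) + cnj (Z \<omega>) * iexp (u * X \<omega>)) / 2 \<partial>M)"
      by (intro Bochner_Integration.integral_cong refl)
        (simp add: complex_add_cnj flip: distrib_right)
    also have "\<dots> = ((\<integral>\<omega>. Z \<omega> \<partial>M) + cnj (\<integral>\<omega>. Z \<omega> \<partial>M)) / 2 * (\<integral>\<omega>. iexp (u * X \<omega>) \<partial>M)"
      using iZe iC by (simp only: Bochner_Integration.integral_add integral_divide_zero uc ucn) (simp add: algebra_simps add_divide_distrib)
    also have "((\<integral>\<omega>. Z \<omega> \<partial>M) + cnj (\<integral>\<omega>. Z \<omega> \<partial>M)) / 2 = of_real (\<integral>\<omega>. Re (Z \<omega>) \<partial>M)"
      using iZ by (simp add: complex_add_cnj)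
    finally show "(\<integral>\<omega>. of_real (Re (Z \<omega>)) * iexp (u * X \<omega>) \<partial>M) = of_real (\<integral>\<omega>. Re (Z \<omega>) \<partial>M) * (\<integral>\<omega>. iexp (u * X \<omega>) \<partial>M)" .
  qed measurable
  have aux: "complex_of_real (Im z) = (z - cnj z) / (2 * \<i>)" for z
    by (simp add: complex_eq_iff)
  have im: "(\<integral>\<omega>. Im (Z \<omega>) * indicator A (X \<omega>) \<partial>M) = (\<integral>\<omega>. Im (Z \<omega>) \<partial>M) * prob (X -` A \<inter> space M)"
  proof (rule uncorrelated_indicator_real)
    show "\<bar>Im (Z \<omega>)\<bar> \<le> 1" for \<omega> using Z[of \<omega>] abs_Im_le_cmod[of "Z \<omega>"] by linarith
    fix u
    have "(\<integral>\<omega>. of_real (Im (Z \<omega>)) * iexp (u * X \<omega>) \<partial>M)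
        = (\<integral>\<omega>. (Z \<omega> * iexp (u * X \<omega>) - cnj (Z \<omega>) * iexp (u * X \<omega>)) / (2 * \<i>) \<partial>M)"
      by (intro Bochner_Integration.integral_cong refl)
        (simp only: aux left_diff_distrib diff_divide_distrib times_divide_eq_left)
    also have "\<dots> = ((\<integral>\<omega>. Z \<omega> \<partial>M) - cnj (\<integral>\<omega>. Z \<omega> \<partial>M)) / (2 * \<i>) * (\<integral>\<omega>. iexp (u * X \<omega>) \<partial>M)"
      using iZe iC by (simp only: Bochner_Integration.integral_diff integral_divide_zero uc ucn)
        (simp only: left_diff_distrib diff_divide_distrib times_divide_eq_left)
    also have "((\<integral>\<omega>. Z \<omega> \<partial>M) - cnj (\<integral>\<omega>. Z \<omega> \<partial>M)) / (2 * \<i>) = of_real (\<integral>\<omega>. Im (Z \<omega>) \<partial>M)"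
      using iZ by (simp only: aux[symmetric] integral_Im)
    finally show "(\<integral>\<omega>. of_real (Im (Z \<omega>)) * iexp (u * X \<omega>) \<partial>M) = of_real (\<integral>\<omega>. Im (Z \<omega>) \<partial>M) * (\<integral>\<omega>. iexp (u * X \<omega>) \<partial>M)" .
  qed measurable
  have ind: "indicator A x = (of_real (indicator A x) :: complex)" for x :: real
    by (simp add: indicator_def)
  show ?thesis
  proof (rule complex_eqI)
    show "Re (\<integral>\<omega>. Z \<omega> * indicator A (X \<omega>) \<partial>M) = Re ((\<integral>\<omega>. Z \<omega> \<partial>M) * prob (X -` A \<inter> space M))"
      using re iZ iZA by (simp add: ind flip: integral_Re)
    show "Im (\<integral>\<omega>. Z \<omega> * indicator A (X \<omega>) \<partial>M) = Im ((\<integral>\<omega>. Z \<omega> \<partial>M) * prob (X -` A \<inter> space M))"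
      using im iZ iZA by (simp add: ind flip: integral_Im)
  qed
qed

text \<open>By induction on \<open>k\<close> the exponentials are replaced by indicators one
  variable at a time, the other coefficients staying arbitrary; for \<open>k = n\<close> this is the
  product rule for probabilities. Each replacement is an instance of the tilting argument, so
  uniqueness of characteristic functions is used only on the real line.\<close>

theorem (in prob_space) indep_vars_if_char_eq_prod:
  fixes X :: "nat \<Rightarrow> 'a \<Rightarrow> real"
  assumes X: "\<And>i. i < n \<Longrightarrow> X i \<in> borel_measurable M"
    and char: "\<And>c :: nat \<Rightarrow> real. (\<integral>\<omega>. iexp (\<Sum>i<n. c i * X i \<omega>) \<partial>M) = (\<Prod>i<n. \<integral>\<omega>. iexp (c i * X i \<omega>) \<partial>M)"
  shows "indep_vars (\<lambda>_. borel) X {..<n}"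
proof -
  have main: "(\<integral>\<omega>. (\<Prod>i<k. indicator (A i) (X i \<omega>)) * iexp (\<Sum>i\<in>{k..<n}. c i * X i \<omega>) \<partial>M)
      = (\<Prod>i<k. of_real (prob (X i -` A i \<inter> space M))) * (\<Prod>i\<in>{k..<n}. \<integral>\<omega>. iexp (c i * X i \<omega>) \<partial>M)"
    if "k \<le> n" "\<And>i. A i \<in> sets borel" for k and A :: "nat \<Rightarrow> real set" and c
    using that
  proof (induction k arbitrary: c)
    case 0
    then show ?case using char[of c] by (simp add: atLeast0LessThan)
  next
    case (Suc k)
    have [measurable]: "X i \<in> borel_measurable M" if "i \<le> k" for i using X Suc.prems that by auto
    have [measurable]: "A i \<in> sets borel" for i using Suc.prems by auto
    have [measurable]: "(\<lambda>\<omega>. \<Sum>i = Suc k..<n. c i * X i \<omega>) \<in> borel_measurable M"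
      using X by (intro borel_measurable_sum) auto
    have [measurable]: "(\<lambda>\<omega>. (\<Prod>i<k. indicator (A i) (X i \<omega>)) :: complex) \<in> borel_measurable M"
    proof (intro borel_measurable_prod)
      fix i assume "i \<in> {..<k}"
      then have [measurable]: "X i \<in> borel_measurable M" using X Suc.prems by auto
      show "(\<lambda>\<omega>. indicator (A i) (X i \<omega>) :: complex) \<in> borel_measurable M" by measurable
    qed
    define Z where "Z \<omega> = (\<Prod>i<k. indicator (A i) (X i \<omega>)) * iexp (\<Sum>i\<in>{Suc k..<n}. c i * X i \<omega>)" for \<omega>
    let ?Q = "(\<Prod>i<k. of_real (prob (X i -` A i \<inter> space M))) * (\<Prod>i\<in>{Suc k..<n}. \<integral>\<omega>. iexp (c i * X i \<omega>) \<partial>M)"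
    have kn: "{k..<n} = insert k {Suc k..<n}" using Suc.prems by auto
    \<comment> \<open>The induction hypothesis holds for every \<open>c\<close>, so the
      \<open>k\<close>-th coefficient may be overwritten by \<open>u\<close>. This makes
      \<open>Z\<close> uncorrelated with all exponentials of \<open>X k\<close>, and
      \<open>u = 0\<close> yields the mean of \<open>Z\<close>.\<close>
    have *: "(\<integral>\<omega>. Z \<omega> * iexp (u * X k \<omega>) \<partial>M) = ?Q * (\<integral>\<omega>. iexp (u * X k \<omega>) \<partial>M)" for u
    proof -
      have "(\<Sum>i = Suc k..<n. (c(k := u)) i * X i \<omega>) = (\<Sum>i = Suc k..<n. c i * X i \<omega>)" for \<omega>
        by (intro sum.cong) auto
      then have "(\<integral>\<omega>. Z \<omega> * iexp (u * X k \<omega>) \<partial>M) =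
        (\<integral>\<omega>. (\<Prod>i<k. indicator (A i) (X i \<omega>)) * iexp (\<Sum>i\<in>{k..<n}. (c(k := u)) i * X i \<omega>) \<partial>M)"
        by (intro Bochner_Integration.integral_cong refl) (simp add: Z_def kn exp_add distrib_left mult.commute mult.left_commute)
      also have "\<dots> = (\<Prod>i<k. of_real (prob (X i -` A i \<inter> space M))) * (\<Prod>i\<in>{k..<n}. \<integral>\<omega>. iexp ((c(k := u)) i * X i \<omega>) \<partial>M)"
        by (rule Suc.IH) (use Suc.prems in auto)
      also have "(\<Prod>i\<in>{k..<n}. \<integral>\<omega>. iexp ((c(k := u)) i * X i \<omega>) \<partial>M) = (\<integral>\<omega>. iexp (u * X k \<omega>) \<partial>M) * (\<Prod>i\<in>{Suc k..<n}. \<integral>\<omega>. iexp (c i * X i \<omega>) \<partial>M)"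
        by (simp add: kn)
      finally show ?thesis by simp
    qed
    have EZ: "(\<integral>\<omega>. Z \<omega> \<partial>M) = ?Q" using *[of 0] by (simp add: prob_space)
    have "(\<integral>\<omega>. Z \<omega> * indicator (A k) (X k \<omega>) \<partial>M) = (\<integral>\<omega>. Z \<omega> \<partial>M) * prob (X k -` A k \<inter> space M)"
    proof (rule uncorrelated_indicator_complex)
      show "norm (Z \<omega>) \<le> 1" for \<omega>
        unfolding Z_def by (auto simp: norm_mult indicator_def simp flip: prod_norm intro!: prod_le_1)
      show "(\<integral>\<omega>. Z \<omega> * iexp (u * X k \<omega>) \<partial>M) = (\<integral>\<omega>. Z \<omega> \<partial>M) * (\<integral>\<omega>. iexp (u * X k \<omega>) \<partial>M)" for u
        unfolding EZ by (rule *)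
      show "Z \<in> borel_measurable M" unfolding Z_def by measurable
    qed measurable
    then show ?case unfolding EZ unfolding Z_def by (simp add: mult_ac)
  qed
  show ?thesis
  proof (cases "n = 0")
    case True
    then show ?thesis by (simp add: indep_vars_def2 indep_sets_def)
  next
    case False
    have "indep_sets (\<lambda>i. {X i -` A \<inter> space M |A. A \<in> sets borel}) {..<n}"
    proof (subst indep_sets_finite, goal_cases)
      case (3 i) then show ?case using X by (auto intro!: measurable_sets)
    next
      case (4 i) show ?case by (intro CollectI exI[of _ UNIV]) auto
    next
      case 5
      show ?case
      proof
        fix E assume "E \<in> Pi {..<n} (\<lambda>i. {X i -` A \<inter> space M |A. A \<in> sets borel})"
        then have "\<forall>i\<in>{..<n}. \<exists>A. A \<in> sets borel \<and> E i = X i -` A \<inter> space M" by blast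
        then obtain A' where A': "\<And>i. i < n \<Longrightarrow> A' i \<in> sets borel \<and> E i = X i -` A' i \<inter> space M"
          by (metis lessThan_iff)
        \<comment> \<open>\<open>main\<close> asks for Borel sets at all indices, hence the padding
          by \<open>UNIV\<close>.\<close>
        define A where "A i = (if i < n then A' i else UNIV)" for i
        have A: "A i \<in> sets borel" "i < n \<Longrightarrow> E i = X i -` A i \<inter> space M" for i
          using A' by (auto simp: A_def)
        have "(\<integral>\<omega>. (\<Prod>i<n. indicator (A i) (X i \<omega>) :: complex) \<partial>M) = (\<Prod>i<n. of_real (prob (X i -` A i \<inter> space M)))"
          using main[of n A "\<lambda>_. 0"] A by simp
        also have "(\<integral>\<omega>. (\<Prod>i<n. indicator (A i) (X i \<omega>) :: complex) \<partial>M) = (\<integral>\<omega>. of_real (indicator (\<Inter>i<n. E i) \<omega>) \<partial>M)"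
        proof (intro Bochner_Integration.integral_cong refl)
          fix \<omega> assume "\<omega> \<in> space M"
          then show "(\<Prod>i<n. indicator (A i) (X i \<omega>) :: complex) = of_real (indicator (\<Inter>i<n. E i) \<omega>)"
            using A False by (cases "\<forall>i<n. X i \<omega> \<in> A i") (auto simp: indicator_def intro!: prod_zero)
        qed
        also have "\<dots> = of_real (prob (\<Inter>i<n. E i))"
        proof -
          have "(\<Inter>i<n. E i) \<inter> space M = (\<Inter>i<n. E i)" using A False by auto
          then show ?thesis by (simp)
        qed
        finally have "complex_of_real (prob (\<Inter>i<n. E i)) = of_real (\<Prod>i<n. prob (X i -` A i \<inter> space M))"
          by simp
        then have "prob (\<Inter>i<n. E i) = (\<Prod>i<n. prob (X i -` A i \<inter> space M))"
          by (simp only: of_real_eq_iff)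
        also have "\<dots> = (\<Prod>i<n. prob (E i))" using A by (intro prod.cong) auto
        finally show "prob (\<Inter>i<n. E i) = (\<Prod>i<n. prob (E i))" .
      qed
    qed (use False in auto)
    then show ?thesis using X by (auto simp: indep_vars_def2)
  qed
qed

section \<open>Mean-square limits\<close>

text \<open>Nonnegative integrals give exactly the form of the limits in
  \<open>has_wiener_integral\<close>; a difference without finite second moment counts as infinitely
  far away.\<close>

definition L2_tendsto :: "'a measure \<Rightarrow> (nat \<Rightarrow> 'a \<Rightarrow> real) \<Rightarrow> ('a \<Rightarrow> real) \<Rightarrow> bool" where
  "L2_tendsto M F f \<longleftrightarrow> (\<lambda>n. \<integral>\<^sup>+x. ennreal ((f x - F n x)\<^sup>2) \<partial>M) \<longlonglongrightarrow> 0"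

lemma tendsto_0_ennreal_le:
  fixes f g :: "nat \<Rightarrow> ennreal"
  assumes "g \<longlonglongrightarrow> 0" "\<And>n. f n \<le> g n"
  shows "f \<longlonglongrightarrow> 0"
  by (rule tendsto_sandwich[OF _ _ tendsto_const assms(1)]) (use assms(2) in auto)

lemma tendsto_0_ennreal_cmult:
  fixes f :: "nat \<Rightarrow> ennreal"
  assumes "f \<longlonglongrightarrow> 0"
  shows "(\<lambda>n. ennreal c * f n) \<longlonglongrightarrow> 0"
  using ennreal_tendsto_cmult[OF _ assms, of "ennreal c"] by (simp add: ennreal_less_top)

lemma nn_integral_square_add_le:
  assumes [measurable]: "f \<in> borel_measurable M" "g \<in> borel_measurable M"
  shows "(\<integral>\<^sup>+x. ennreal ((f x + g x)\<^sup>2) \<partial>M)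
    \<le> ennreal 2 * (\<integral>\<^sup>+x. ennreal ((f x)\<^sup>2) \<partial>M) + ennreal 2 * (\<integral>\<^sup>+x. ennreal ((g x)\<^sup>2) \<partial>M)"
proof -
  have "(\<integral>\<^sup>+x. ennreal ((f x + g x)\<^sup>2) \<partial>M)
    \<le> (\<integral>\<^sup>+x. ennreal 2 * ennreal ((f x)\<^sup>2) + ennreal 2 * ennreal ((g x)\<^sup>2) \<partial>M)"
  proof (intro nn_integral_mono)
    fix x
    have "ennreal ((f x + g x)\<^sup>2) \<le> ennreal (2 * (f x)\<^sup>2 + 2 * (g x)\<^sup>2)"
      by (intro ennreal_leI square_add_le)
    also have "\<dots> = ennreal 2 * ennreal ((f x)\<^sup>2) + ennreal 2 * ennreal ((g x)\<^sup>2)"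
      by (simp add: ennreal_mult)
    finally show "ennreal ((f x + g x)\<^sup>2) \<le> ennreal 2 * ennreal ((f x)\<^sup>2) + ennreal 2 * ennreal ((g x)\<^sup>2)" .
  qed
  also have "\<dots> = ennreal 2 * (\<integral>\<^sup>+x. ennreal ((f x)\<^sup>2) \<partial>M) + ennreal 2 * (\<integral>\<^sup>+x. ennreal ((g x)\<^sup>2) \<partial>M)"
    by (subst nn_integral_add) (auto simp: nn_integral_cmult)
  finally show ?thesis .
qed

lemma L2_tendsto_add:
  assumes [measurable]: "f \<in> borel_measurable M" "g \<in> borel_measurable M"
    "\<And>n. F n \<in> borel_measurable M" "\<And>n. G n \<in> borel_measurable M"
    and "L2_tendsto M F f" "L2_tendsto M G g"
  shows "L2_tendsto M (\<lambda>n x. F n x + G n x) (\<lambda>x. f x + g x)"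
  unfolding L2_tendsto_def
proof (rule tendsto_0_ennreal_le)
  show "(\<lambda>n. ennreal 2 * (\<integral>\<^sup>+x. ennreal ((f x - F n x)\<^sup>2) \<partial>M)
      + ennreal 2 * (\<integral>\<^sup>+x. ennreal ((g x - G n x)\<^sup>2) \<partial>M)) \<longlonglongrightarrow> 0"
    using tendsto_add[OF tendsto_0_ennreal_cmult[of _ 2] tendsto_0_ennreal_cmult[of _ 2]] assms(5,6)
    unfolding L2_tendsto_def by fastforce
  have eq: "(f x + g x - (F n x + G n x))\<^sup>2 = ((f x - F n x) + (g x - G n x))\<^sup>2" for n x
    by (simp add: algebra_simps)
  show "(\<integral>\<^sup>+x. ennreal ((f x + g x - (F n x + G n x))\<^sup>2) \<partial>M)
      \<le> ennreal 2 * (\<integral>\<^sup>+x. ennreal ((f x - F n x)\<^sup>2) \<partial>M)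
      + ennreal 2 * (\<integral>\<^sup>+x. ennreal ((g x - G n x)\<^sup>2) \<partial>M)" for n
    unfolding eq by (intro nn_integral_square_add_le) measurable
qed

lemma L2_tendsto_cmult:
  assumes [measurable]: "f \<in> borel_measurable M" "\<And>n. F n \<in> borel_measurable M"
    and "L2_tendsto M F f"
  shows "L2_tendsto M (\<lambda>n x. c * F n x) (\<lambda>x. c * f x)"
proof -
  have "(c * f x - c * F n x)\<^sup>2 = c\<^sup>2 * (f x - F n x)\<^sup>2" for n x
    by (simp add: right_diff_distrib[symmetric] power_mult_distrib)
  then have "(\<integral>\<^sup>+x. ennreal ((c * f x - c * F n x)\<^sup>2) \<partial>M) = ennreal (c\<^sup>2) * (\<integral>\<^sup>+x. ennreal ((f x - F n x)\<^sup>2) \<partial>M)" for n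
    by (simp add: ennreal_mult nn_integral_cmult)
  then show ?thesis
    using tendsto_0_ennreal_cmult[of _ "c\<^sup>2"] assms(3) by (simp add: L2_tendsto_def)
qed

lemma integral_Cauchy_Schwarz:
  assumes f: "sq_integrable M f" and g: "sq_integrable M g"
  shows "(\<integral>x. f x * g x \<partial>M)\<^sup>2 \<le> (\<integral>x. (f x)\<^sup>2 \<partial>M) * (\<integral>x. (g x)\<^sup>2 \<partial>M)"
proof -
  define a b c where "a = (\<integral>x. (f x)\<^sup>2 \<partial>M)" and "b = (\<integral>x. f x * g x \<partial>M)" and "c = (\<integral>x. (g x)\<^sup>2 \<partial>M)"
  have i: "integrable M (\<lambda>x. (f x)\<^sup>2)" "integrable M (\<lambda>x. (g x)\<^sup>2)" "integrable M (\<lambda>x. f x * g x)"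
    using f g sq_integrable_integrable_square integrable_sq_mult by blast+
  have q: "0 \<le> s\<^sup>2 * a + 2 * s * t * b + t\<^sup>2 * c" for s t
  proof -
    have "0 \<le> (\<integral>x. (s * f x + t * g x)\<^sup>2 \<partial>M)" by simp
    also have "\<dots> = (\<integral>x. s\<^sup>2 * (f x)\<^sup>2 + 2 * s * t * (f x * g x) + t\<^sup>2 * (g x)\<^sup>2 \<partial>M)"
      by (intro Bochner_Integration.integral_cong refl) (simp add: power2_sum power_mult_distrib algebra_simps)
    also have "\<dots> = s\<^sup>2 * a + 2 * s * t * b + t\<^sup>2 * c"
      using i by (simp add: a_def b_def c_def)
    finally show ?thesis .
  qed
  have "c \<ge> 0" unfolding c_def by simp
  show ?thesis
  proof (cases "c = 0")
    case True
    have "b = 0"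
    proof (rule ccontr)
      assume "b \<noteq> 0"
      \<comment> \<open>With \<open>c = 0\<close> this choice makes the quadratic form equal to
        -1.\<close>
      then show False using q[of 1 "- (a + 1) / (2 * b)"] True by (simp add: field_simps)
    qed
    then show ?thesis using True by (simp add: a_def b_def c_def)
  next
    case False
    then have "c > 0" using \<open>c \<ge> 0\<close> by simp
    \<comment> \<open>The minimising direction: for fixed \<open>s\<close> and \<open>c > 0\<close>
      the form is least at \<open>t = - s * b / c\<close>.\<close>
    have "0 \<le> c * (a * c - b\<^sup>2)" using q[of c "- b"] by (simp add: power2_eq_square algebra_simps)
    then have "0 \<le> a * c - b\<^sup>2" using \<open>c > 0\<close> by (simp add: zero_le_mult_iff)
    then show ?thesis by (simp add: a_def b_def c_def)
  qed
qed

lemma L2_tendsto_sq_integrable: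
  assumes [measurable]: "f \<in> borel_measurable M" and F: "\<And>n. sq_integrable M (F n)"
    and lim: "L2_tendsto M F f"
  shows "sq_integrable M f"
proof -
  have [measurable]: "F n \<in> borel_measurable M" for n using F by (rule sq_integrable_measurable)
  have "eventually (\<lambda>n. (\<integral>\<^sup>+x. ennreal ((f x - F n x)\<^sup>2) \<partial>M) < 1) sequentially"
    using lim unfolding L2_tendsto_def by (rule order_tendstoD) simp
  then obtain n where "(\<integral>\<^sup>+x. ennreal ((f x - F n x)\<^sup>2) \<partial>M) < 1"
    by (auto simp: eventually_sequentially)
  then have "sq_integrable M (\<lambda>x. f x - F n x)"
    unfolding sq_integrable_iff_nn_integral by (auto intro: less_trans)
  from sq_integrable_add[OF this F[of n]] show ?thesis by simp
qed

text \<open>Expand the square of \<open>F n = f - (f - F n)\<close>; the mixed term is controlled by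
  Cauchy-Schwarz.\<close>

lemma L2_tendsto_integral_square:
  assumes f: "f \<in> borel_measurable M" and F: "\<And>n. sq_integrable M (F n)"
    and lim: "L2_tendsto M F f"
  shows "(\<lambda>n. \<integral>x. (F n x)\<^sup>2 \<partial>M) \<longlonglongrightarrow> (\<integral>x. (f x)\<^sup>2 \<partial>M)"
proof -
  have sf: "sq_integrable M f" by (rule L2_tendsto_sq_integrable[OF f F lim])
  have d: "sq_integrable M (\<lambda>x. f x - F n x)" for n by (rule sq_integrable_diff[OF sf F])
  define e where "e n = (\<integral>x. (f x - F n x)\<^sup>2 \<partial>M)" for n
  have e0: "0 \<le> e n" for n by (simp add: e_def)
  have "(\<lambda>n. ennreal (e n)) \<longlonglongrightarrow> ennreal 0"
    using lim unfolding L2_tendsto_def e_def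
    using d[THEN sq_integrable_integrable_square] by (simp add: nn_integral_eq_integral)
  then have elim: "e \<longlonglongrightarrow> 0" by (subst (asm) tendsto_ennreal_iff) (auto simp: e0)
  let ?b = "\<lambda>n. \<integral>x. f x * (f x - F n x) \<partial>M"
  have "\<bar>?b n\<bar> \<le> sqrt ((\<integral>x. (f x)\<^sup>2 \<partial>M) * e n)" for n
    using integral_Cauchy_Schwarz[OF sf d[of n]] unfolding e_def by (metis real_le_rsqrt power2_abs)
  moreover have "(\<lambda>n. sqrt ((\<integral>x. (f x)\<^sup>2 \<partial>M) * e n)) \<longlonglongrightarrow> sqrt ((\<integral>x. (f x)\<^sup>2 \<partial>M) * 0)"
    by (intro tendsto_intros elim)
  ultimately have blim: "?b \<longlonglongrightarrow> 0"
    by (intro Lim_null_comparison[where f="?b" and g="\<lambda>n. sqrt ((\<integral>x. (f x)\<^sup>2 \<partial>M) * e n)"]) auto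
  have "(\<integral>x. (F n x)\<^sup>2 \<partial>M) = (\<integral>x. (f x)\<^sup>2 \<partial>M) - 2 * ?b n + e n" for n
  proof -
    have "(\<integral>x. (F n x)\<^sup>2 \<partial>M) = (\<integral>x. (f x)\<^sup>2 - 2 * (f x * (f x - F n x)) + (f x - F n x)\<^sup>2 \<partial>M)"
      by (intro Bochner_Integration.integral_cong refl) (simp add: power2_eq_square algebra_simps)
    then show ?thesis
      using sf d[of n] integrable_sq_mult[OF sf d[of n]] by (simp add: e_def sq_integrable_def)
  qed
  moreover have "(\<lambda>n. (\<integral>x. (f x)\<^sup>2 \<partial>M) - 2 * ?b n + e n) \<longlonglongrightarrow> (\<integral>x. (f x)\<^sup>2 \<partial>M) - 2 * 0 + 0"
    by (intro tendsto_intros blim elim)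
  ultimately show ?thesis by simp
qed

lemma (in prob_space) nn_integral_abs_le:
  assumes [measurable]: "f \<in> borel_measurable M"
  shows "(\<integral>\<^sup>+x. ennreal \<bar>f x\<bar> \<partial>M)\<^sup>2 \<le> (\<integral>\<^sup>+x. ennreal ((f x)\<^sup>2) \<partial>M)"
  using Cauchy_Schwarz_nn_integral[of "\<lambda>x. ennreal \<bar>f x\<bar>" M "\<lambda>_. 1"]
  by (simp add: emeasure_space_1 ennreal_power)

lemma norm_iexp_diff_le: "norm (iexp x - iexp y) \<le> \<bar>x - y\<bar>" for x y :: real
proof -
  have "iexp x - iexp y = iexp y * (iexp (x - y) - 1)"
    by (simp add: algebra_simps flip: exp_add)
  then have "norm (iexp x - iexp y) = norm (iexp (x - y) - 1)" by (simp add: norm_mult)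
  also have "\<dots> \<le> \<bar>x - y\<bar>" using iexp_approx1[of "x - y" 0] by simp
  finally show ?thesis .
qed

text \<open>The map \<open>iexp\<close> is 1-Lipschitz, and on a probability space the L1 distance
  is at most the L2 distance. This is how Gaussian laws survive mean-square limits.\<close>

lemma (in prob_space) L2_tendsto_char:
  assumes [measurable]: "X \<in> borel_measurable M" "\<And>n. Y n \<in> borel_measurable M"
    and lim: "L2_tendsto M Y X"
  shows "(\<lambda>n. \<integral>\<omega>. iexp (u * Y n \<omega>) \<partial>M) \<longlonglongrightarrow> (\<integral>\<omega>. iexp (u * X \<omega>) \<partial>M)"
proof -
  have i: "integrable M (\<lambda>\<omega>. iexp (u * X \<omega>))" "integrable M (\<lambda>\<omega>. iexp (u * Y n \<omega>))" for n
    by (rule integrable_const_bound[where B=1]; simp)+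
  define D where "D n = (\<integral>\<omega>. iexp (u * X \<omega>) \<partial>M) - (\<integral>\<omega>. iexp (u * Y n \<omega>) \<partial>M)" for n
  let ?d = "\<lambda>n. \<integral>\<^sup>+x. ennreal ((X x - Y n x)\<^sup>2) \<partial>M"
  have "ennreal ((norm (D n))\<^sup>2) \<le> ennreal (u\<^sup>2) * ?d n" for n
  proof -
    have "D n = (\<integral>\<omega>. iexp (u * X \<omega>) - iexp (u * Y n \<omega>) \<partial>M)"
      unfolding D_def by (rule Bochner_Integration.integral_diff[OF i, symmetric])
    then have "ennreal (norm (D n)) \<le> (\<integral>\<^sup>+\<omega>. ennreal (norm (iexp (u * X \<omega>) - iexp (u * Y n \<omega>))) \<partial>M)"
      using integral_norm_bound_ennreal[OF Bochner_Integration.integrable_diff[OF i]] by simp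
    also have "\<dots> \<le> (\<integral>\<^sup>+\<omega>. ennreal \<bar>u * (X \<omega> - Y n \<omega>)\<bar> \<partial>M)"
      using norm_iexp_diff_le[of "u * X _" "u * Y n _"]
      by (intro nn_integral_mono ennreal_leI) (simp add: right_diff_distrib)
    finally have "(ennreal (norm (D n)))\<^sup>2 \<le> (\<integral>\<^sup>+\<omega>. ennreal \<bar>u * (X \<omega> - Y n \<omega>)\<bar> \<partial>M)\<^sup>2"
      by (intro power_mono) auto
    also have "\<dots> \<le> (\<integral>\<^sup>+\<omega>. ennreal ((u * (X \<omega> - Y n \<omega>))\<^sup>2) \<partial>M)"
      by (rule nn_integral_abs_le) measurable
    also have "\<dots> = ennreal (u\<^sup>2) * ?d n"
      by (simp add: power_mult_distrib ennreal_mult nn_integral_cmult)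
    finally show ?thesis by (simp add: ennreal_power)
  qed
  from tendsto_0_ennreal_le[OF tendsto_0_ennreal_cmult this] lim
  have "(\<lambda>n. ennreal ((norm (D n))\<^sup>2)) \<longlonglongrightarrow> ennreal 0" by (simp add: L2_tendsto_def)
  then have "(\<lambda>n. (norm (D n))\<^sup>2) \<longlonglongrightarrow> 0" by (subst (asm) tendsto_ennreal_iff) auto
  then have "(\<lambda>n. sqrt ((norm (D n))\<^sup>2)) \<longlonglongrightarrow> sqrt 0" by (intro tendsto_real_sqrt)
  then have "D \<longlonglongrightarrow> 0" by (simp add: tendsto_norm_zero_iff)
  then have "(\<lambda>n. (\<integral>\<omega>. iexp (u * X \<omega>) \<partial>M) - D n) \<longlonglongrightarrow> (\<integral>\<omega>. iexp (u * X \<omega>) \<partial>M) - 0"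
    by (intro tendsto_intros)
  then show ?thesis by (simp add: D_def)
qed

section \<open>Fubini's theorem for square integrable kernels\<close>

context pair_prob_space
begin

lemma sq_integrable_snd_mult:
  assumes "sq_integrable M2 A"
  shows "sq_integrable (M1 \<Otimes>\<^sub>M M2) (\<lambda>(s, x). A x)"
proof -
  have [measurable]: "A \<in> borel_measurable M2" using assms by (rule sq_integrable_measurable)
  have "(\<integral>\<^sup>+p. ennreal ((case p of (s, x) \<Rightarrow> A x)\<^sup>2) \<partial>(M1 \<Otimes>\<^sub>M M2)) = (\<integral>\<^sup>+s. \<integral>\<^sup>+x. ennreal ((A x)\<^sup>2) \<partial>M2 \<partial>M1)"
    by (subst M2.nn_integral_fst[symmetric]) auto
  also have "\<dots> < \<infinity>"
    using assms by (simp add: sq_integrable_iff_nn_integral M1.emeasure_space_1)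
  finally show ?thesis by (auto simp: sq_integrable_iff_nn_integral)
qed

lemma integrable_kernel_mult:
  assumes "sq_integrable (M1 \<Otimes>\<^sub>M M2) (\<lambda>(s, x). J s x)" "sq_integrable M2 A"
  shows "integrable (M1 \<Otimes>\<^sub>M M2) (\<lambda>(s, x). J s x * A x)"
  using integrable_sq_mult[OF assms(1) sq_integrable_snd_mult[OF assms(2)]] by (simp add: case_prod_unfold)

lemma
  assumes J: "sq_integrable (M1 \<Otimes>\<^sub>M M2) (\<lambda>(s, x). J s x)"
  shows AE_sq_integrable_kernel: "AE x in M2. sq_integrable M1 (\<lambda>s. J s x)"
    and sq_integrable_integral_kernel: "sq_integrable M2 (\<lambda>x. \<integral>s. J s x \<partial>M1)"
proof -
  have i: "integrable (M1 \<Otimes>\<^sub>M M2) (\<lambda>(s, x). (J s x)\<^sup>2)"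
    using sq_integrable_integrable_square[OF J] by (simp add: case_prod_unfold)
  have J': "integrable (M1 \<Otimes>\<^sub>M M2) (\<lambda>(s, x). J s x)" by (rule P.sq_integrable_imp_integrable[OF J])
  have [measurable]: "(\<lambda>(s, x). J s x) \<in> borel_measurable (M1 \<Otimes>\<^sub>M M2)"
    using J by (rule sq_integrable_measurable)
  show AE: "AE x in M2. sq_integrable M1 (\<lambda>s. J s x)"
    using AE_integrable_snd[OF i] AE_space
  proof eventually_elim
    case (elim x)
    then have "(\<lambda>s. case (s, x) of (s, x) \<Rightarrow> J s x) \<in> borel_measurable M1"
      by (intro measurable_Pair1) auto
    with elim show ?case by (simp add: sq_integrable_def)
  qed
  show "sq_integrable M2 (\<lambda>x. \<integral>s. J s x \<partial>M1)"
  proof (rule sq_integrable_bound)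
    show "integrable M2 (\<lambda>x. \<integral>s. (J s x)\<^sup>2 \<partial>M1)" by (rule integrable_snd[OF i])
    show "(\<lambda>x. \<integral>s. J s x \<partial>M1) \<in> borel_measurable M2"
      using integrable_snd[OF J'] by (rule borel_measurable_integrable)
    show "AE x in M2. (\<integral>s. J s x \<partial>M1)\<^sup>2 \<le> (\<integral>s. (J s x)\<^sup>2 \<partial>M1)"
      using AE by eventually_elim (rule M1.square_expectation_le)
  qed
qed

text \<open>Used with the sample space as second factor, for random kernels, and with the unit
  interval, for their integrands. Comparing the two uses proves the stochastic Fubini
  theorem.\<close>

lemma
  assumes J: "sq_integrable (M1 \<Otimes>\<^sub>M M2) (\<lambda>(s, x). J s x)" and A: "sq_integrable M2 A"
  shows integral_kernel_mult: "(\<integral>x. (\<integral>s. J s x \<partial>M1) * A x \<partial>M2) = (\<integral>s. (\<integral>x. J s x * A x \<partial>M2) \<partial>M1)"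
    and integrable_integral_kernel_mult: "integrable M1 (\<lambda>s. \<integral>x. J s x * A x \<partial>M2)"
proof -
  note i = integrable_kernel_mult[OF assms]
  have "(\<integral>x. (\<integral>s. J s x \<partial>M1) * A x \<partial>M2) = (\<integral>x. (\<integral>s. J s x * A x \<partial>M1) \<partial>M2)"
    by simp
  also have "\<dots> = (\<integral>s. (\<integral>x. J s x * A x \<partial>M2) \<partial>M1)"
    using Fubini_integral[OF i] by simp
  finally show "(\<integral>x. (\<integral>s. J s x \<partial>M1) * A x \<partial>M2) = (\<integral>s. (\<integral>x. J s x * A x \<partial>M2) \<partial>M1)" .
  show "integrable M1 (\<lambda>s. \<integral>x. J s x * A x \<partial>M2)"
    using integrable_fst'[OF i] by simp
qed

end

section \<open>Gaussian laws\<close>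

lemma (in prob_space) char_normal:
  assumes X: "distributed M lborel X (normal_density 0 \<sigma>)" and \<sigma>: "0 < \<sigma>"
  shows "(\<integral>\<omega>. iexp (a * X \<omega>) \<partial>M) = of_real (exp (- (a\<^sup>2 * \<sigma>\<^sup>2) / 2))"
proof -
  have std: "distributed M lborel (\<lambda>\<omega>. X \<omega> / \<sigma>) std_normal_density"
    using X normal_standard_normal_convert[OF \<sigma>, of X 0] by simp
  have [measurable]: "X \<in> borel_measurable M" using distributed_measurable[OF X] by simp
  have "(\<integral>\<omega>. iexp (a * X \<omega>) \<partial>M) = (\<integral>\<omega>. iexp ((a * \<sigma>) * (X \<omega> / \<sigma>)) \<partial>M)"
    using \<sigma> by simp
  also have "\<dots> = char (distr M lborel (\<lambda>\<omega>. X \<omega> / \<sigma>)) (a * \<sigma>)"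
    unfolding char_def by (subst integral_distr) auto
  also have "\<dots> = of_real (exp (- ((a * \<sigma>)\<^sup>2) / 2))"
    using std by (simp add: distributed_distr_eq_density char_std_normal_distribution)
  finally show ?thesis by (simp add: power_mult_distrib)
qed

text \<open>Levy uniqueness identifies the law as the image of the standard normal law under
  multiplication by \<open>sqrt v\<close>. This includes the degenerate case \<open>v = 0\<close>;
  only the density requires \<open>v > 0\<close>.\<close>

lemma (in prob_space)
  assumes [measurable]: "X \<in> borel_measurable M" and v: "0 \<le> v"
    and char: "\<And>u. (\<integral>\<omega>. iexp (u * X \<omega>) \<partial>M) = of_real (exp (- (u\<^sup>2 * v) / 2))"
  shows gaussian_sq_integrable: "sq_integrable M X"
    and gaussian_second_moment: "(\<integral>\<omega>. (X \<omega>)\<^sup>2 \<partial>M) = v"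
    and gaussian_distributed: "v > 0 \<Longrightarrow> distributed M lborel X (normal_density 0 (sqrt v))"
proof -
  interpret N: real_distribution std_normal_distribution by (rule real_dist_normal_dist)
  let ?N = "distr std_normal_distribution borel (\<lambda>z. sqrt v * z)"
  have law: "distr M borel X = ?N"
  proof (rule Levy_uniqueness)
    show "real_distribution (distr M borel X)" by (intro real_distribution_distr) simp
    show "real_distribution ?N" by (intro N.real_distribution_distr) simp
    show "char (distr M borel X) = char ?N"
    proof
      fix u
      have "char ?N u = char std_normal_distribution (u * sqrt v)"
        unfolding char_def by (subst integral_distr) (auto simp: mult.assoc)
      also have "\<dots> = of_real (exp (- (u\<^sup>2 * v) / 2))"
        using v by (simp add: char_std_normal_distribution power_mult_distrib)
      also have "\<dots> = char (distr M borel X) u"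
        unfolding char[symmetric] char_def by (subst integral_distr) auto
      finally show "char (distr M borel X) u = char ?N u" ..
    qed
  qed
  have i: "integrable ?N (\<lambda>x. x\<^sup>2)"
    using integrable_std_normal_distribution_moment[of 2]
    by (subst integrable_distr_eq) (auto simp: power_mult_distrib)
  have "integrable M (\<lambda>\<omega>. (X \<omega>)\<^sup>2)"
    using i unfolding law[symmetric] by (subst (asm) integrable_distr_eq) auto
  then show "sq_integrable M X" by (simp add: sq_integrable_def)
  have "(\<integral>\<omega>. (X \<omega>)\<^sup>2 \<partial>M) = (\<integral>x. x\<^sup>2 \<partial>?N)"
    unfolding law[symmetric] by (subst integral_distr) auto
  also have "\<dots> = v * (\<integral>z. z\<^sup>2 \<partial>std_normal_distribution)"
    using v by (subst integral_distr) (auto simp: power_mult_distrib)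
  also have "(\<integral>z. z\<^sup>2 \<partial>std_normal_distribution) = 1"
    using std_normal_distribution_even_moments(1)[of 1] by simp
  finally show "(\<integral>\<omega>. (X \<omega>)\<^sup>2 \<partial>M) = v" by simp
  show "distributed M lborel X (normal_density 0 (sqrt v))" if "v > 0"
  proof -
    have s: "0 < sqrt v" using that by simp
    have "distr M lborel (\<lambda>\<omega>. X \<omega> / sqrt v) = distr (distr M borel X) lborel (\<lambda>x. x / sqrt v)"
      by (subst distr_distr) (auto simp: comp_def)
    also have "\<dots> = distr std_normal_distribution lborel (\<lambda>z. z)"
      unfolding law using s by (subst distr_distr) (auto simp: comp_def)
    also have "\<dots> = density lborel std_normal_density"
      by (rule distr_id2) simp
    finally have "distributed M lborel (\<lambda>\<omega>. X \<omega> / sqrt v) std_normal_density"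
      unfolding distributed_def by simp
    then show ?thesis using normal_standard_normal_convert[OF s, of X 0] by simp
  qed
qed

section \<open>The Wiener integral\<close>

text \<open>Time as a probability space, so that the results on products of probability spaces apply
  both to time with time and to time with the sample space.\<close>

definition unit_lborel :: "real measure" where
  "unit_lborel = restrict_space lborel {0<..<1}"

lemma space_unit_lborel [simp]: "space unit_lborel = {0<..<1}"
  by (simp add: unit_lborel_def space_restrict_space)

lemma sets_unit_lborel [measurable_cong]: "sets unit_lborel = sets (restrict_space borel {0<..<1})"
  by (simp add: unit_lborel_def sets_restrict_space)

lemma borel_measurable_unit_lborel [measurable (raw)]: "f \<in> borel_measurable borel \<Longrightarrow> f \<in> borel_measurable unit_lborel"
  unfolding unit_lborel_def by (intro measurable_restrict_space1) simp

lemma nn_integral_unit_lborel: "(\<integral>\<^sup>+x. f x \<partial>unit_lborel) = (\<integral>\<^sup>+x\<in>{0<..<1}. f x \<partial>lborel)"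
  unfolding unit_lborel_def by (rule nn_integral_restrict_space) simp

lemma integral_unit_lborel:
  fixes f :: "real \<Rightarrow> 'b :: {banach, second_countable_topology}"
  shows "(\<integral>x. f x \<partial>unit_lborel) = (LINT x:{0<..<1}|lborel. f x)"
  unfolding unit_lborel_def set_lebesgue_integral_def by (rule integral_restrict_space) simp

lemma integrable_unit_lborel:
  fixes f :: "real \<Rightarrow> 'b :: {banach, second_countable_topology}"
  shows "integrable unit_lborel f \<longleftrightarrow> set_integrable lborel {0<..<1} f"
  unfolding unit_lborel_def set_integrable_def by (rule integrable_restrict_space) simp

lemma AE_unit_lborel: "(AE x in unit_lborel. P x) \<longleftrightarrow> (AE x in lborel. x \<in> {0<..<1} \<longrightarrow> P x)"
  unfolding unit_lborel_def by (rule AE_restrict_space_iff) simp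

lemma AE_unit_lborel_neq: "AE x in unit_lborel. x \<noteq> (c :: real)"
  unfolding AE_unit_lborel using AE_lborel_singleton[of c] by eventually_elim simp

interpretation unit_lborel: prob_space unit_lborel
proof (rule prob_spaceI)
  show "emeasure unit_lborel (space unit_lborel) = 1"
    unfolding space_unit_lborel unit_lborel_def by (subst emeasure_restrict_space) auto
qed

lemma integral_unit_lborel_indicator:
  assumes "0 \<le> p" "p \<le> q" "q \<le> 1"
  shows "(\<integral>x. indicator {p<..q} x \<partial>unit_lborel) = q - p"
    and "(\<integral>x. indicator {p<..<q} x \<partial>unit_lborel) = q - p"
proof -
  have *: "(\<integral>x. indicator {p<..<q} x \<partial>lborel) = q - p" using assms by simp
  have "(\<integral>x. indicator {p<..<q} x \<partial>unit_lborel) = (\<integral>x. indicator {p<..<q} x \<partial>lborel :: real)"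
    unfolding integral_unit_lborel set_lebesgue_integral_def
    by (intro Bochner_Integration.integral_cong refl) (use assms in \<open>auto simp: indicator_def\<close>)
  then show 2: "(\<integral>x. indicator {p<..<q} x \<partial>unit_lborel) = q - p" using * by simp
  have "(\<integral>x. indicator {p<..q} x \<partial>unit_lborel) = (\<integral>x. indicator {p<..<q} x \<partial>unit_lborel :: real)"
  proof (intro integral_cong_AE)
    show "AE x in unit_lborel. indicator {p<..q} x = (indicator {p<..<q} x :: real)"
      using AE_unit_lborel_neq[of q] by eventually_elim (auto simp: indicator_def)
  qed measurable
  then show "(\<integral>x. indicator {p<..q} x \<partial>unit_lborel) = q - p" using 2 by simp
qed

section \<open>Step functions and their refinement to a common grid\<close>

definition valid_step :: "(real \<times> real \<times> real) list \<Rightarrow> bool" where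
  "valid_step S \<longleftrightarrow> (\<forall>(c, p, q)\<in>set S. 0 \<le> p \<and> p \<le> q \<and> q \<le> 1)"

lemma step_function_measurable [measurable]: "step_function S \<in> borel_measurable borel"
  unfolding step_function_def
  by (induction S) (auto simp: case_prod_beta)

lemma step_function_bounded: "\<exists>C. \<forall>x. \<bar>step_function S x\<bar> \<le> C"
proof (induction S)
  case Nil
  then show ?case by (auto simp: step_function_def)
next
  case (Cons a S)
  obtain c p q where a: "a = (c, p, q)" by (cases a) auto
  from Cons obtain C where C: "\<bar>step_function S x\<bar> \<le> C" for x by auto
  have "\<bar>step_function (a # S) x\<bar> \<le> \<bar>c\<bar> + C" for x
    using C[of x] unfolding a step_function_def by (auto simp: indicator_def)
  then show ?case by blast
qed

lemma sq_integrable_step_function: "sq_integrable unit_lborel (step_function S)"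
  using step_function_bounded[of S] by (auto intro: unit_lborel.sq_integrable_bounded)

text \<open>Abstracts the common shape of two expressions: with a path of \<open>w\<close> for
  \<open>F\<close> it is the step integral, with \<open>\<lambda>t. of_bool (x \<le> t)\<close> it
  is the value of the step function at \<open>x\<close>. One refinement identity then serves
  both.\<close>

definition step_increments :: "(real \<times> real \<times> real) list \<Rightarrow> (real \<Rightarrow> real) \<Rightarrow> real" where
  "step_increments S F = (\<Sum>(c, p, q)\<leftarrow>S. c * (F q - F p))"

lemma step_integral_eq_increments: "step_integral w S \<omega> = step_increments S (\<lambda>t. w t \<omega>)"
  by (simp add: step_integral_def step_increments_def)

lemma step_function_eq_increments:
  assumes "valid_step S"
  shows "step_function S x = step_increments S (\<lambda>t. of_bool (x \<le> t))"
  using assms unfolding step_function_def step_increments_def valid_step_def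
  by (intro arg_cong[of _ _ sum_list] map_cong) (auto simp: indicator_def)

lemma telescope_refinement:
  fixes F :: "real \<Rightarrow> real" and t :: "nat \<Rightarrow> real"
  assumes t: "strict_mono_on {..m} t" and ab: "a \<le> b" "b \<le> m"
  shows "F (t b) - F (t a) = (\<Sum>i<m. indicator {t a<..t b} (t (Suc i)) * (F (t (Suc i)) - F (t i)))"
proof -
  have less: "t i < t j \<longleftrightarrow> i < j" if "i \<le> m" "j \<le> m" for i j
    using t that by (auto simp: strict_mono_on_less)
  have le: "t i \<le> t j \<longleftrightarrow> i \<le> j" if "i \<le> m" "j \<le> m" for i j
    using t that by (auto simp: strict_mono_on_less_eq)
  have "(\<Sum>i<m. indicator {t a<..t b} (t (Suc i)) * (F (t (Suc i)) - F (t i)))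
      = (\<Sum>i<m. if i \<in> {a..<b} then F (t (Suc i)) - F (t i) else 0)"
    using ab by (intro sum.cong refl) (auto simp: indicator_def less le)
  also have "\<dots> = (\<Sum>i\<in>{a..<b}. F (t (Suc i)) - F (t i))"
    using ab by (subst sum.inter_restrict[symmetric]) (auto intro!: sum.cong)
  also have "\<dots> = F (t b) - F (t a)" using sum_Suc_diff'[OF ab(1), of "\<lambda>i. F (t i)"] .
  finally show ?thesis ..
qed

text \<open>All end points are sorted into one grid. On each cell the step function is constant, and
  its value is read off at the right end point because the intervals are closed on the
  right.\<close>

lemma step_refinement:
  assumes "valid_step S"
  obtains t :: "nat \<Rightarrow> real" and m where "strict_mono_on {..m} t" "t ` {..m} \<subseteq> {0..1}"
    "\<And>F. step_increments S F = (\<Sum>i<m. step_function S (t (Suc i)) * (F (t (Suc i)) - F (t i)))"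
proof -
  \<comment> \<open>The point 0 keeps \<open>P\<close> nonempty for the empty list, so that the grid
    always has \<open>m + 1\<close> points.\<close>
  define P where "P = insert 0 ((\<lambda>(c, p, q). p) ` set S \<union> (\<lambda>(c, p, q). q) ` set S)"
  have P: "finite P" "P \<noteq> {}" "P \<subseteq> {0..1}"
    using assms by (fastforce simp: P_def valid_step_def)+
  define t where "t i = sorted_list_of_set P ! i" for i
  obtain m where m: "card P = Suc m" using P by (cases "card P") auto
  have t': "strict_mono_on {..m} t"
    unfolding t_def using P m
    by (intro strict_mono_onI) (auto intro!: sorted_wrt_nth_less[OF strict_sorted_list_of_set])
  have im: "t ` {..m} = P"
  proof -
    have "P = set (sorted_list_of_set P)" using P by simp
    also have "\<dots> = t ` {..m}"
      using m P by (auto simp: set_conv_nth t_def image_def less_Suc_eq_le Bex_def simp del: set_sorted_list_of_set)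
    finally show ?thesis ..
  qed
  \<comment> \<open>The grid of \<open>S\<close> stays fixed while the induction runs over lists
    \<open>S'\<close> with entries from \<open>S\<close>.\<close>
  have "step_increments S' F = (\<Sum>i<m. step_function S' (t (Suc i)) * (F (t (Suc i)) - F (t i)))"
    if "set S' \<subseteq> set S" for F S'
    using that
  proof (induction S')
    case Nil
    then show ?case by (simp add: step_increments_def step_function_def)
  next
    case (Cons s S')
    obtain c p q where s: "s = (c, p, q)" by (cases s) auto
    have "s \<in> set S" using Cons.prems by auto
    then have "p \<in> P" "q \<in> P" "p \<le> q"
      using assms unfolding s P_def valid_step_def by force+
    then obtain a b where ab: "p = t a" "q = t b" "a \<le> m" "b \<le> m" unfolding im[symmetric] by auto
    have "a \<le> b" using \<open>p \<le> q\<close> ab t' by (auto simp: strict_mono_on_less_eq)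
    then have "c * (F q - F p) = (\<Sum>i<m. c * indicator {p<..q} (t (Suc i)) * (F (t (Suc i)) - F (t i)))"
      using telescope_refinement[OF t' _ ab(4), of a F] by (simp only: ab sum_distrib_left mult.assoc)
    moreover have "step_increments (s # S') F = c * (F q - F p) + step_increments S' F"
      by (simp add: s step_increments_def)
    moreover have "step_function (s # S') x = c * indicator {p<..q} x + step_function S' x" for x
      by (simp add: s step_function_def)
    ultimately show ?case using Cons by (simp add: sum.distrib distrib_right)
  qed
  from that[OF t' _ this[OF order_refl]] show thesis using im P by blast
qed

text \<open>The refinement identity with \<open>\<lambda>t. of_bool (x \<le> t)\<close> for
  \<open>F\<close> writes the step function over disjoint cells, so that squaring acts on each
  coefficient separately.\<close>

lemma integral_square_step_function:
  fixes t :: "nat \<Rightarrow> real"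
  assumes S: "valid_step S" and t: "strict_mono_on {..m} t" "t ` {..m} \<subseteq> {0..1}"
    and ref: "\<And>F. step_increments S F = (\<Sum>i<m. step_function S (t (Suc i)) * (F (t (Suc i)) - F (t i)))"
  shows "(\<integral>x. (step_function S x)\<^sup>2 \<partial>unit_lborel) = (\<Sum>i<m. (step_function S (t (Suc i)))\<^sup>2 * (t (Suc i) - t i))"
proof -
  let ?I = "\<lambda>i x. indicator {t i<..t (Suc i)} x :: real"
  have lt: "t i < t j" if "i < j" "j \<le> m" for i j using t(1) that by (auto simp: strict_mono_on_def)
  have le: "t i \<le> t j" if "i \<le> j" "j \<le> m" for i j using lt[of i j] that by (cases "i = j") auto
  have sf: "step_function S x = (\<Sum>i<m. step_function S (t (Suc i)) * ?I i x)" for x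
  proof -
    have "step_function S x = (\<Sum>i<m. step_function S (t (Suc i)) * (of_bool (x \<le> t (Suc i)) - of_bool (x \<le> t i)))"
      unfolding step_function_eq_increments[OF S, of x] by (rule ref)
    also have "\<dots> = (\<Sum>i<m. step_function S (t (Suc i)) * ?I i x)"
    proof (intro sum.cong refl)
      fix i assume "i \<in> {..<m}"
      then show "step_function S (t (Suc i)) * (of_bool (x \<le> t (Suc i)) - of_bool (x \<le> t i))
          = step_function S (t (Suc i)) * ?I i x"
        using lt[of i "Suc i"] by (auto simp: indicator_def)
    qed
    finally show ?thesis .
  qed
  have sq: "(step_function S x)\<^sup>2 = (\<Sum>i<m. (step_function S (t (Suc i)))\<^sup>2 * ?I i x)" for x
  proof (cases "\<exists>i<m. x \<in> {t i<..t (Suc i)}")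
    case True
    then obtain k where k: "k < m" "x \<in> {t k<..t (Suc k)}" by auto
    have uniq: "?I i x = (if i = k then 1 else 0)" if "i < m" for i
    proof -
      have "x \<notin> {t i<..t (Suc i)}" if "i \<noteq> k"
        using that k le[of "Suc i" k] le[of "Suc k" i] \<open>i < m\<close> by (cases "i < k") auto
      then show ?thesis using k by (auto simp: indicator_def)
    qed
    have sum: "(\<Sum>i<m. a i * ?I i x) = a k" for a :: "nat \<Rightarrow> real"
    proof -
      have "(\<Sum>i<m. a i * ?I i x) = (\<Sum>i<m. if i = k then a k else 0)"
        by (intro sum.cong refl) (use uniq in auto)
      then show ?thesis using k by simp
    qed
    show ?thesis by (subst sf) (simp only: sum)
  next
    case False
    then have "?I i x = 0" if "i < m" for i using that by (auto simp: indicator_def)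
    then show ?thesis by (subst sf) simp
  qed
  have "(\<integral>x. (step_function S x)\<^sup>2 \<partial>unit_lborel) = (\<integral>x. (\<Sum>i<m. (step_function S (t (Suc i)))\<^sup>2 * ?I i x) \<partial>unit_lborel)"
    by (intro Bochner_Integration.integral_cong refl sq)
  also have "\<dots> = (\<Sum>i<m. (step_function S (t (Suc i)))\<^sup>2 * (\<integral>x. ?I i x \<partial>unit_lborel))"
    by (subst Bochner_Integration.integral_sum)
      (auto intro!: integrable_mult_right unit_lborel.integrable_const_bound[where B=1])
  also have "\<dots> = (\<Sum>i<m. (step_function S (t (Suc i)))\<^sup>2 * (t (Suc i) - t i))"
  proof (intro sum.cong refl)
    fix i assume i: "i \<in> {..<m}"
    have "t i \<in> {0..1}" "t (Suc i) \<in> {0..1}" using t(2) i by (auto simp: image_subset_iff)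
    then show "(step_function S (t (Suc i)))\<^sup>2 * (\<integral>x. ?I i x \<partial>unit_lborel)
        = (step_function S (t (Suc i)))\<^sup>2 * (t (Suc i) - t i)"
      using lt[of i "Suc i"] i by (subst integral_unit_lborel_indicator) auto
  qed
  finally show ?thesis .
qed

section \<open>Gaussian law, linearity and isometry of the Wiener integral\<close>

locale wiener =
  fixes M :: "'a measure" and w :: "real \<Rightarrow> 'a \<Rightarrow> real"
  assumes wiener: "wiener_process M {0..1} w"
begin

sublocale prob_space M using wiener by (simp add: wiener_process_def)

lemma w_measurable: "t \<in> {0..1} \<Longrightarrow> w t \<in> borel_measurable M"
  using wiener by (simp add: wiener_process_def)

lemma step_integral_measurable [measurable]:
  "valid_step S \<Longrightarrow> step_integral w S \<in> borel_measurable M"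
proof (induction S)
  case Nil
  then show ?case by (simp add: step_integral_def[abs_def])
next
  case (Cons s S)
  obtain c p q where s: "s = (c, p, q)" by (cases s) auto
  have "p \<in> {0..1}" "q \<in> {0..1}" "valid_step S" using Cons.prems by (auto simp: s valid_step_def)
  then have [measurable]: "w p \<in> borel_measurable M" "w q \<in> borel_measurable M" "step_integral w S \<in> borel_measurable M"
    using w_measurable Cons.IH by auto
  have "step_integral w (s # S) = (\<lambda>\<omega>. c * (w q \<omega> - w p \<omega>) + step_integral w S \<omega>)"
    by (auto simp: s step_integral_def)
  then show ?case by simp
qed

text \<open>On the common grid the step integral is a linear combination of independent centred
  normal increments, whose variances add up to the squared norm of the step function.\<close>

lemma char_step_integral:
  assumes S: "valid_step S"
  shows "(\<integral>\<omega>. iexp (u * step_integral w S \<omega>) \<partial>M) = of_real (exp (- (u\<^sup>2 * (\<integral>x. (step_function S x)\<^sup>2 \<partial>unit_lborel)) / 2))"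
proof -
  obtain t m where t: "strict_mono_on {..m} t" "t ` {..m} \<subseteq> {0..1}"
    and ref: "\<And>F. step_increments S F = (\<Sum>i<m. step_function S (t (Suc i)) * (F (t (Suc i)) - F (t i)))"
    by (rule step_refinement[OF S]) blast
  let ?a = "\<lambda>i. step_function S (t (Suc i))"
  let ?D = "\<lambda>i \<omega>. w (t (Suc i)) \<omega> - w (t i) \<omega>"
  have ind: "indep_vars (\<lambda>_. borel) ?D {..<m}"
    using wiener t by (auto simp: wiener_process_def)
  have dist: "distributed M lborel (?D i) (normal_density 0 (sqrt (t (Suc i) - t i)))"
    and lt: "t i < t (Suc i)" if "i < m" for i
  proof -
    show "t i < t (Suc i)" using t(1) that by (auto simp: strict_mono_on_def)
    moreover have "t i \<in> {0..1}" "t (Suc i) \<in> {0..1}" using t(2) that by (auto simp: image_subset_iff)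
    ultimately show "distributed M lborel (?D i) (normal_density 0 (sqrt (t (Suc i) - t i)))"
      using wiener unfolding wiener_process_def by blast
  qed
  have "(\<integral>\<omega>. iexp (u * step_integral w S \<omega>) \<partial>M) = (\<integral>\<omega>. (\<Prod>i<m. iexp (u * ?a i * ?D i \<omega>)) \<partial>M)"
    unfolding step_integral_eq_increments ref
    by (simp add: sum_distrib_left mult.assoc flip: exp_sum)
  also have "\<dots> = (\<Prod>i<m. \<integral>\<omega>. iexp (u * ?a i * ?D i \<omega>) \<partial>M)"
  proof (rule indep_vars_lebesgue_integral)
    show "indep_vars (\<lambda>_. borel) (\<lambda>i \<omega>. iexp (u * ?a i * ?D i \<omega>)) {..<m}"
      by (rule indep_vars_compose2[OF ind]) simp
    fix i assume "i \<in> {..<m}"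
    then have "t i \<in> {0..1}" "t (Suc i) \<in> {0..1}" using t(2) by (auto simp: image_subset_iff)
    then have [measurable]: "w (t i) \<in> borel_measurable M" "w (t (Suc i)) \<in> borel_measurable M"
      using w_measurable by auto
    then show "integrable M (\<lambda>\<omega>. iexp (u * ?a i * ?D i \<omega>))"
      by (intro integrable_const_bound[where B=1]) auto
  qed simp
  also have "\<dots> = (\<Prod>i<m. of_real (exp (- (u\<^sup>2 * ((?a i)\<^sup>2 * (t (Suc i) - t i))) / 2)))"
  proof (intro prod.cong refl)
    fix i assume "i \<in> {..<m}"
    then show "(\<integral>\<omega>. iexp (u * ?a i * ?D i \<omega>) \<partial>M) = of_real (exp (- (u\<^sup>2 * ((?a i)\<^sup>2 * (t (Suc i) - t i))) / 2))"
      using lt[of i] char_normal[OF dist[of i], of "u * ?a i"] by (simp add: power_mult_distrib mult.assoc)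
  qed
  also have "\<dots> = of_real (exp (\<Sum>i<m. - (u\<^sup>2 * ((?a i)\<^sup>2 * (t (Suc i) - t i))) / 2))"
    by (simp add: exp_sum)
  also have "(\<Sum>i<m. - (u\<^sup>2 * ((?a i)\<^sup>2 * (t (Suc i) - t i))) / 2) = - (u\<^sup>2 * (\<integral>x. (step_function S x)\<^sup>2 \<partial>unit_lborel)) / 2"
    unfolding integral_square_step_function[OF S t ref]
    by (simp add: sum_distrib_left sum_negf sum_divide_distrib)
  finally show ?thesis .
qed

text \<open>Integrals over subintervals are treated as integrals over \<open>(0, 1)\<close> of
  integrands cut off by an indicator, so that all integrands live in one L2 space.\<close>

definition WI :: "(real \<Rightarrow> real) \<Rightarrow> ('a \<Rightarrow> real) \<Rightarrow> bool" where
  "WI f X \<longleftrightarrow> has_wiener_integral M w 0 1 f X"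

lemma WI_iff:
  "WI f X \<longleftrightarrow> f \<in> borel_measurable unit_lborel \<and> X \<in> borel_measurable M \<and>
    (\<exists>S. (\<forall>n. valid_step (S n)) \<and> L2_tendsto unit_lborel (\<lambda>n. step_function (S n)) f \<and>
      L2_tendsto M (\<lambda>n. step_integral w (S n)) X)"
proof -
  have "f \<in> borel_measurable unit_lborel \<longleftrightarrow> set_borel_measurable borel {0<..<1} f"
    unfolding unit_lborel_def set_borel_measurable_def
    by (subst borel_measurable_restrict_space_iff) auto
  then show ?thesis
    unfolding WI_def has_wiener_integral_def L2_tendsto_def nn_integral_unit_lborel valid_step_def
    by simp
qed

lemma WI_measurable: "WI f X \<Longrightarrow> f \<in> borel_measurable unit_lborel" "WI f X \<Longrightarrow> X \<in> borel_measurable M"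
  by (auto simp: WI_iff)

lemma WI_sq_integrable: "WI f X \<Longrightarrow> sq_integrable unit_lborel f"
  unfolding WI_iff by (elim conjE exE) (rule L2_tendsto_sq_integrable[OF _ sq_integrable_step_function])

text \<open>The norms and the characteristic functions of the step approximations both converge.
  Second moments, and with them the isometry, follow from this law.\<close>

lemma WI_char:
  assumes "WI f X"
  shows "(\<integral>\<omega>. iexp (u * X \<omega>) \<partial>M) = of_real (exp (- (u\<^sup>2 * (\<integral>x. (f x)\<^sup>2 \<partial>unit_lborel)) / 2))"
proof -
  from assms obtain S where m: "f \<in> borel_measurable unit_lborel" "X \<in> borel_measurable M"
    and S: "\<And>n. valid_step (S n)" and
    lim: "L2_tendsto unit_lborel (\<lambda>n. step_function (S n)) f" "L2_tendsto M (\<lambda>n. step_integral w (S n)) X"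
    unfolding WI_iff by blast
  have "(\<lambda>n. of_real (exp (- (u\<^sup>2 * (\<integral>x. (step_function (S n) x)\<^sup>2 \<partial>unit_lborel)) / 2)))
      \<longlonglongrightarrow> complex_of_real (exp (- (u\<^sup>2 * (\<integral>x. (f x)\<^sup>2 \<partial>unit_lborel)) / 2))"
    by (intro tendsto_intros L2_tendsto_integral_square[OF m(1) _ lim(1)] sq_integrable_step_function) simp
  moreover have "(\<lambda>n. \<integral>\<omega>. iexp (u * step_integral w (S n) \<omega>) \<partial>M) \<longlonglongrightarrow> (\<integral>\<omega>. iexp (u * X \<omega>) \<partial>M)"
    using S by (intro L2_tendsto_char m lim) auto
  ultimately show ?thesis unfolding char_step_integral[OF S] by (blast intro: LIMSEQ_unique)
qed

lemma WI_sq_integrable': "WI f X \<Longrightarrow> sq_integrable M X"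
  by (rule gaussian_sq_integrable[OF WI_measurable(2) _ WI_char]) auto

lemma WI_second_moment: "WI f X \<Longrightarrow> (\<integral>\<omega>. (X \<omega>)\<^sup>2 \<partial>M) = (\<integral>x. (f x)\<^sup>2 \<partial>unit_lborel)"
  by (rule gaussian_second_moment[OF WI_measurable(2) _ WI_char]) auto

lemma WI_step: 
  assumes "valid_step S" shows "WI (step_function S) (step_integral w S)"
  unfolding WI_iff using assms by (auto simp: L2_tendsto_def intro!: exI[of _ "\<lambda>_. S"])

text \<open>Concatenating the lists adds the step functions, as overlapping intervals are
  allowed.\<close>

lemma WI_add:
  assumes "WI f X" "WI g Y"
  shows "WI (\<lambda>x. f x + g x) (\<lambda>\<omega>. X \<omega> + Y \<omega>)"
proof -
  note [measurable] = WI_measurable[OF assms(1)] WI_measurable[OF assms(2)]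
  from assms obtain S T where S: "\<And>n. valid_step (S n)" and T: "\<And>n. valid_step (T n)"
    and lS: "L2_tendsto unit_lborel (\<lambda>n. step_function (S n)) f" "L2_tendsto M (\<lambda>n. step_integral w (S n)) X"
    and lT: "L2_tendsto unit_lborel (\<lambda>n. step_function (T n)) g" "L2_tendsto M (\<lambda>n. step_integral w (T n)) Y"
    unfolding WI_iff by blast
  have "L2_tendsto unit_lborel (\<lambda>n x. step_function (S n) x + step_function (T n) x) (\<lambda>x. f x + g x)"
    by (intro L2_tendsto_add lS lT) measurable
  moreover have "L2_tendsto M (\<lambda>n \<omega>. step_integral w (S n) \<omega> + step_integral w (T n) \<omega>) (\<lambda>\<omega>. X \<omega> + Y \<omega>)"
    using S T by (intro L2_tendsto_add lS lT) measurable
  moreover have "step_function (S n @ T n) = (\<lambda>x. step_function (S n) x + step_function (T n) x)"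
    "step_integral w (S n @ T n) = (\<lambda>\<omega>. step_integral w (S n) \<omega> + step_integral w (T n) \<omega>)" for n
    by (auto simp: step_function_def step_integral_def)
  moreover have "valid_step (S n @ T n)" for n
    using S[of n] T[of n] unfolding valid_step_def set_append by blast
  ultimately show ?thesis
    unfolding WI_iff by (intro conjI exI[of _ "\<lambda>n. S n @ T n"]) auto
qed

lemma WI_cmult:
  assumes "WI f X"
  shows "WI (\<lambda>x. a * f x) (\<lambda>\<omega>. a * X \<omega>)"
proof -
  note [measurable] = WI_measurable[OF assms(1)]
  from assms obtain S where S: "\<And>n. valid_step (S n)"
    and lS: "L2_tendsto unit_lborel (\<lambda>n. step_function (S n)) f" "L2_tendsto M (\<lambda>n. step_integral w (S n)) X"
    unfolding WI_iff by blast
  define T where "T n = map (\<lambda>(c, p, q). (a * c, p, q)) (S n)" for n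
  have T: "valid_step (T n)" for n using S[of n] by (auto simp: T_def valid_step_def)
  have sf: "step_function (T n) = (\<lambda>x. a * step_function (S n) x)" for n
    by (auto simp: T_def step_function_def sum_list_const_mult[symmetric] case_prod_beta comp_def mult.assoc)
  have si: "step_integral w (T n) = (\<lambda>x. a * step_integral w (S n) x)" for n
    by (auto simp: T_def step_integral_def sum_list_const_mult[symmetric] case_prod_beta comp_def mult.assoc)
  have "L2_tendsto unit_lborel (\<lambda>n x. a * step_function (S n) x) (\<lambda>x. a * f x)"
    by (intro L2_tendsto_cmult lS) measurable
  moreover have "L2_tendsto M (\<lambda>n \<omega>. a * step_integral w (S n) \<omega>) (\<lambda>\<omega>. a * X \<omega>)"
    using S by (intro L2_tendsto_cmult lS) measurable
  ultimately show ?thesis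
    unfolding WI_iff using T by (intro conjI exI[of _ T]) (auto simp: sf si)
qed

lemma WI_cong_AE:
  assumes X: "WI f X" and [measurable]: "g \<in> borel_measurable unit_lborel" "Y \<in> borel_measurable M"
    and fg: "AE x in unit_lborel. f x = g x" and XY: "AE \<omega> in M. X \<omega> = Y \<omega>"
  shows "WI g Y"
proof -
  have "L2_tendsto unit_lborel F f \<longleftrightarrow> L2_tendsto unit_lborel F g" for F
    unfolding L2_tendsto_def using fg
    by (intro arg_cong[of _ _ "\<lambda>s. s \<longlonglongrightarrow> 0"] ext nn_integral_cong_AE) (auto elim: eventually_mono)
  moreover have "L2_tendsto M F X \<longleftrightarrow> L2_tendsto M F Y" for F
    unfolding L2_tendsto_def using XY
    by (intro arg_cong[of _ _ "\<lambda>s. s \<longlonglongrightarrow> 0"] ext nn_integral_cong_AE) (auto elim: eventually_mono)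
  ultimately show ?thesis using X assms(2,3) unfolding WI_iff by simp
qed

lemma WI_zero: "WI (\<lambda>x. 0) (\<lambda>\<omega>. 0)"
  using WI_step[of "[]"] by (simp add: valid_step_def step_function_def[abs_def] step_integral_def[abs_def])

lemma WI_sum: "(\<And>i. i \<in> I \<Longrightarrow> WI (f i) (X i)) \<Longrightarrow> WI (\<lambda>x. \<Sum>i\<in>I. f i x) (\<lambda>\<omega>. \<Sum>i\<in>I. X i \<omega>)"
  by (induction I rule: infinite_finite_induct) (auto simp: WI_zero intro: WI_add)

lemma WI_diff: "WI f X \<Longrightarrow> WI g Y \<Longrightarrow> WI (\<lambda>x. f x - g x) (\<lambda>\<omega>. X \<omega> - Y \<omega>)"
  using WI_add[of f X "\<lambda>x. (-1) * g x" "\<lambda>\<omega>. (-1) * Y \<omega>"] WI_cmult[of g Y "-1"] by simp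

text \<open>Polarisation of the equality of second moments.\<close>

lemma WI_isometry:
  assumes X: "WI f X" and Y: "WI g Y"
  shows "(\<integral>\<omega>. X \<omega> * Y \<omega> \<partial>M) = (\<integral>x. f x * g x \<partial>unit_lborel)"
proof -
  have polar: "(\<integral>z. a z * b z \<partial>N) = ((\<integral>z. (a z + b z)\<^sup>2 \<partial>N) - (\<integral>z. (a z)\<^sup>2 \<partial>N) - (\<integral>z. (b z)\<^sup>2 \<partial>N)) / 2"
    if "sq_integrable N a" "sq_integrable N b" for N :: "'c measure" and a b
  proof -
    have "(\<integral>z. (a z + b z)\<^sup>2 \<partial>N) = (\<integral>z. (a z)\<^sup>2 + (b z)\<^sup>2 + 2 * (a z * b z) \<partial>N)"
      by (intro Bochner_Integration.integral_cong refl) (simp add: power2_sum)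
    also have "\<dots> = (\<integral>z. (a z)\<^sup>2 \<partial>N) + (\<integral>z. (b z)\<^sup>2 \<partial>N) + 2 * (\<integral>z. a z * b z \<partial>N)"
      using that integrable_sq_mult[OF that] by (simp add: sq_integrable_def)
    finally show ?thesis by simp
  qed
  show ?thesis
    using polar[OF WI_sq_integrable'[OF X] WI_sq_integrable'[OF Y]] polar[OF WI_sq_integrable[OF X] WI_sq_integrable[OF Y]]
      WI_second_moment[OF X] WI_second_moment[OF Y] WI_second_moment[OF WI_add[OF X Y]] by simp
qed

end

section \<open>Construction of the Wiener integral\<close>

text \<open>A fast Cauchy sequence in mean square converges almost surely, and Fatou's lemma bounds
  the distance to its limit. The limit is the explicit pointwise \<open>lim\<close> rather than an
  abstract L2 limit, so that measurability in an additional parameter is inherited.\<close>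

lemma (in prob_space) L2_tendsto_lim:
  fixes X :: "nat \<Rightarrow> 'a \<Rightarrow> real"
  assumes [measurable]: "\<And>n. X n \<in> borel_measurable M"
    and C: "0 \<le> C"
    and cauchy: "\<And>n m. n \<le> m \<Longrightarrow> (\<integral>\<^sup>+\<omega>. ennreal ((X m \<omega> - X n \<omega>)\<^sup>2) \<partial>M) \<le> ennreal (C * (1/4)^n)"
  shows "L2_tendsto M X (\<lambda>\<omega>. lim (\<lambda>n. X n \<omega>))"
proof -
  \<comment> \<open>The weight \<open>2^n\<close> turns the bound \<open>(1/4)^n\<close> on the
    squares into a summable bound \<open>(1/2)^n\<close> on the first moments.\<close>
  have young: "\<bar>d\<bar> \<le> (1/2)^n + 2^n * d\<^sup>2" for d :: real and n
  proof -
    have "0 \<le> 2^n * (\<bar>d\<bar> - (1/2)^n)\<^sup>2" by simp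
    also have "\<dots> = 2^n * d\<^sup>2 - 2 * \<bar>d\<bar> + (1/2)^n"
      by (simp add: power2_diff power2_eq_square algebra_simps power_one_over)
    finally have "2 * \<bar>d\<bar> \<le> 2^n * d\<^sup>2 + (1/2)^n" by simp
    moreover have "0 \<le> \<bar>d\<bar>" by simp
    ultimately show ?thesis by linarith
  qed
  have step: "(\<integral>\<^sup>+\<omega>. ennreal \<bar>X (Suc n) \<omega> - X n \<omega>\<bar> \<partial>M) \<le> ennreal ((1 + C) * (1/2)^n)" for n
  proof -
    have "(\<integral>\<^sup>+\<omega>. ennreal \<bar>X (Suc n) \<omega> - X n \<omega>\<bar> \<partial>M)
        \<le> (\<integral>\<^sup>+\<omega>. ennreal ((1/2)^n) + ennreal (2^n) * ennreal ((X (Suc n) \<omega> - X n \<omega>)\<^sup>2) \<partial>M)"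
    proof (intro nn_integral_mono)
      fix \<omega>
      have "ennreal \<bar>X (Suc n) \<omega> - X n \<omega>\<bar> \<le> ennreal ((1/2)^n + 2^n * (X (Suc n) \<omega> - X n \<omega>)\<^sup>2)"
        by (intro ennreal_leI young)
      then show "ennreal \<bar>X (Suc n) \<omega> - X n \<omega>\<bar> \<le> ennreal ((1/2)^n) + ennreal (2^n) * ennreal ((X (Suc n) \<omega> - X n \<omega>)\<^sup>2)"
        by (simp add: ennreal_mult)
    qed
    also have "\<dots> = ennreal ((1/2)^n) + ennreal (2^n) * (\<integral>\<^sup>+\<omega>. ennreal ((X (Suc n) \<omega> - X n \<omega>)\<^sup>2) \<partial>M)"
      by (simp add: nn_integral_add nn_integral_cmult emeasure_space_1)
    also have "\<dots> \<le> ennreal ((1/2)^n) + ennreal (2^n) * ennreal (C * (1/4)^n)"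
      by (intro add_mono mult_left_mono cauchy) auto
    also have "\<dots> = ennreal ((1/2)^n + 2^n * (C * (1/4)^n))"
      using C by (simp add: ennreal_mult)
    also have "(1/2)^n + 2^n * (C * (1/4)^n) = (1 + C) * (1/2)^n"
    proof -
      have "(2::real)^n * (1/4)^n = (1/2)^n" by (simp flip: power_mult_distrib)
      then show ?thesis by (metis distrib_right mult.left_commute mult_1)
    qed
    finally show ?thesis .
  qed
  have "(\<integral>\<^sup>+\<omega>. (\<Sum>n. ennreal \<bar>X (Suc n) \<omega> - X n \<omega>\<bar>) \<partial>M) = (\<Sum>n. \<integral>\<^sup>+\<omega>. ennreal \<bar>X (Suc n) \<omega> - X n \<omega>\<bar> \<partial>M)"
    by (intro nn_integral_suminf) measurable
  also have "\<dots> \<le> (\<Sum>n. ennreal ((1 + C) * (1/2)^n))"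
    by (intro suminf_le step) auto
  also have "\<dots> = ennreal (\<Sum>n. (1 + C) * (1/2)^n)"
    using C by (intro suminf_ennreal2) (auto intro!: summable_mult summable_geometric)
  also have "\<dots> < \<infinity>" by simp
  finally have "AE \<omega> in M. (\<Sum>n. ennreal \<bar>X (Suc n) \<omega> - X n \<omega>\<bar>) \<noteq> \<infinity>"
    by (intro nn_integral_PInf_AE) auto
  then have conv: "AE \<omega> in M. (\<lambda>n. X n \<omega>) \<longlonglongrightarrow> lim (\<lambda>n. X n \<omega>)"
  proof eventually_elim
    case (elim \<omega>)
    have "summable (\<lambda>n. \<bar>X (Suc n) \<omega> - X n \<omega>\<bar>)"
      by (rule summable_suminf_not_top) (use elim in auto)
    then have "summable (\<lambda>n. X (Suc n) \<omega> - X n \<omega>)" by (rule summable_rabs_cancel)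
    then have "convergent (\<lambda>n. (\<Sum>k<n. X (Suc k) \<omega> - X k \<omega>) + X 0 \<omega>)"
      by (intro convergent_add convergent_const) (simp add: summable_iff_convergent)
    then have "convergent (\<lambda>n. X n \<omega>)" by (simp add: sum_lessThan_telescope[of "\<lambda>n. X n \<omega>"])
    then show ?case by (simp add: convergent_LIMSEQ_iff)
  qed
  have bound: "(\<integral>\<^sup>+\<omega>. ennreal ((lim (\<lambda>n. X n \<omega>) - X n \<omega>)\<^sup>2) \<partial>M) \<le> ennreal (C * (1/4)^n)" for n
  proof -
    have "(\<integral>\<^sup>+\<omega>. ennreal ((lim (\<lambda>n. X n \<omega>) - X n \<omega>)\<^sup>2) \<partial>M)
        = (\<integral>\<^sup>+\<omega>. liminf (\<lambda>m. ennreal ((X m \<omega> - X n \<omega>)\<^sup>2)) \<partial>M)"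
    proof (intro nn_integral_cong_AE)
      show "AE \<omega> in M. ennreal ((lim (\<lambda>n. X n \<omega>) - X n \<omega>)\<^sup>2) = liminf (\<lambda>m. ennreal ((X m \<omega> - X n \<omega>)\<^sup>2))"
        using conv
      proof eventually_elim
        case (elim \<omega>)
        have "(\<lambda>m. ennreal ((X m \<omega> - X n \<omega>)\<^sup>2)) \<longlonglongrightarrow> ennreal ((lim (\<lambda>n. X n \<omega>) - X n \<omega>)\<^sup>2)"
          by (intro tendsto_intros elim)
        then show ?case by (intro lim_imp_Liminf[symmetric]) auto
      qed
    qed
    also have "\<dots> \<le> liminf (\<lambda>m. \<integral>\<^sup>+\<omega>. ennreal ((X m \<omega> - X n \<omega>)\<^sup>2) \<partial>M)"
      by (intro nn_integral_liminf) measurable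
    also have "\<dots> \<le> ennreal (C * (1/4)^n)"
      by (rule Liminf_le) (auto simp: eventually_sequentially intro!: exI[of _ n] cauchy)
    finally show ?thesis .
  qed
  show ?thesis
    unfolding L2_tendsto_def
  proof (rule tendsto_0_ennreal_le[OF _ bound])
    have "(\<lambda>n. C * (1/4)^n) \<longlonglongrightarrow> C * 0"
      by (intro tendsto_intros LIMSEQ_power_zero) auto
    then have "(\<lambda>n. ennreal (C * (1/4)^n)) \<longlonglongrightarrow> ennreal (C * 0)" by (rule tendsto_ennrealI)
    then show "(\<lambda>n. ennreal (C * (1/4)^n)) \<longlonglongrightarrow> 0" by simp
  qed
qed

text \<open>Serves the choice of truncation grids, the continuity of \<open>N_mat h\<close> and of
  \<open>F t\<close>, and the continuity of the paths.\<close>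

lemma continuous_on_indefinite_integral:
  fixes f :: "real \<Rightarrow> 'b :: {banach, second_countable_topology}"
  assumes f: "integrable unit_lborel f"
  shows "continuous_on UNIV (\<lambda>t. \<integral>x. indicator {0<..<t} x *\<^sub>R f x \<partial>unit_lborel)"
  unfolding continuous_on_sequentially
proof (intro allI ballI impI, elim conjE)
  fix x :: "nat \<Rightarrow> real" and a assume lim: "x \<longlonglongrightarrow> a"
  have [measurable]: "f \<in> borel_measurable unit_lborel" using f by auto
  show "((\<lambda>t. \<integral>x. indicator {0<..<t} x *\<^sub>R f x \<partial>unit_lborel) \<circ> x) \<longlonglongrightarrow> (\<integral>x. indicator {0<..<a} x *\<^sub>R f x \<partial>unit_lborel)"
    unfolding comp_def
  proof (rule integral_dominated_convergence[where w="\<lambda>x. norm (f x)"])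
    show "AE y in unit_lborel. (\<lambda>n. indicator {0<..<x n} y *\<^sub>R f y) \<longlonglongrightarrow> indicator {0<..<a} y *\<^sub>R f y"
      using AE_unit_lborel_neq[of a]
    proof eventually_elim
      case (elim y)
      have "eventually (\<lambda>n. indicator {0<..<x n} y = (indicator {0<..<a} y :: real)) sequentially"
      proof (cases "y < a")
        case True
        then have "eventually (\<lambda>n. y < x n) sequentially" using lim by (rule order_tendstoD(1)[rotated])
        then show ?thesis by eventually_elim (use True in \<open>auto simp: indicator_def\<close>)
      next
        case False
        then have "a < y" using elim by simp
        then have "eventually (\<lambda>n. x n < y) sequentially" using lim by (rule order_tendstoD(2)[rotated])
        then show ?thesis by eventually_elim (use \<open>a < y\<close> in \<open>auto simp: indicator_def\<close>)
      qed
      then have "eventually (\<lambda>n. indicator {0<..<x n} y *\<^sub>R f y = indicator {0<..<a} y *\<^sub>R f y) sequentially"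
        by eventually_elim simp
      then show ?case by (rule tendsto_eventually)
    qed
    show "integrable unit_lborel (\<lambda>x. norm (f x))" using f by simp
    show "AE y in unit_lborel. norm (indicator {0<..<x n} y *\<^sub>R f y) \<le> norm (f y)" for n
      by (auto simp: indicator_def)
  qed measurable
qed

section \<open>Approximation of continuous functions by step functions\<close>

lemma step_function_append: "step_function (S @ T) x = step_function S x + step_function T x"
  by (simp add: step_function_def)

lemma uniform_step_approximation:
  fixes f :: "real \<Rightarrow> real"
  assumes cont: "continuous_on {a..b} f" and ab: "a < b" and \<eta>: "0 < \<eta>"
  obtains S where "\<And>c p q. (c, p, q) \<in> set S \<Longrightarrow> a \<le> p \<and> p \<le> q \<and> q \<le> b"
    "\<And>x. x \<in> {a<..b} \<Longrightarrow> \<bar>f x - step_function S x\<bar> \<le> \<eta>"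
    "\<And>x. x \<notin> {a<..b} \<Longrightarrow> step_function S x = 0"
proof -
  have "uniformly_continuous_on {a..b} f" using cont by (rule compact_uniformly_continuous) simp
  then obtain \<delta> where \<delta>: "\<delta> > 0" "\<And>x y. x \<in> {a..b} \<Longrightarrow> y \<in> {a..b} \<Longrightarrow> dist x y < \<delta> \<Longrightarrow> dist (f x) (f y) < \<eta>"
    unfolding uniformly_continuous_on_def using \<eta> by metis
  obtain m :: nat where m: "(b - a) / \<delta> < m" using reals_Archimedean2 by blast
  have m0: "0 < real m" using m ab \<delta>(1) by (smt (verit) divide_pos_pos)
  define t where "t k = a + real k * ((b - a) / m)" for k :: nat
  have inc: "t k \<le> t (Suc k)" for k using ab by (simp add: t_def divide_simps)
  have diff: "t (Suc k) - t k < \<delta>" for k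
  proof -
    have "t (Suc k) - t k = (b - a) / m" unfolding t_def of_nat_Suc distrib_right by simp
    also have "\<dots> < \<delta>" using m m0 \<delta>(1) by (simp add: divide_less_eq mult.commute)
    finally show ?thesis .
  qed
  have t0: "t 0 = a" and tm: "t m = b" using m0 by (auto simp: t_def)
  have mono: "t i \<le> t j" if "i \<le> j" for i j using lift_Suc_mono_le[of t, OF inc that] .
  define S where "S k = map (\<lambda>i. (f (t i), t i, t (Suc i))) [0..<k]" for k
  have SS: "S (Suc k) = S k @ [(f (t k), t k, t (Suc k))]" for k by (simp add: S_def)
  have "k \<le> m \<Longrightarrow> (\<forall>x\<in>{a<..t k}. \<bar>f x - step_function (S k) x\<bar> \<le> \<eta>) \<and> (\<forall>x. x \<notin> {a<..t k} \<longrightarrow> step_function (S k) x = 0)" for k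
  proof (induction k)
    case 0
    then show ?case by (simp add: t0 S_def step_function_def)
  next
    case (Suc k)
    have sf: "step_function (S (Suc k)) x = step_function (S k) x + f (t k) * indicator {t k<..t (Suc k)} x" for x
      unfolding SS step_function_append by (simp add: step_function_def)
    have ak: "a \<le> t k" "t (Suc k) \<le> b" using mono[of 0 k] mono[of "Suc k" m] Suc.prems by (auto simp: t0 tm)
    show ?case
    proof (intro conjI ballI allI impI)
      fix x assume x: "x \<in> {a<..t (Suc k)}"
      show "\<bar>f x - step_function (S (Suc k)) x\<bar> \<le> \<eta>"
      proof (cases "x \<le> t k")
        case True
        then show ?thesis using Suc x by (auto simp: sf)
      next
        case False
        then have "step_function (S (Suc k)) x = f (t k)" using Suc x by (auto simp: sf)
        moreover have "dist (f x) (f (t k)) < \<eta>"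
          using x False ak diff[of k] by (intro \<delta>(2)) (auto simp: dist_real_def)
        ultimately show ?thesis by (simp add: dist_real_def)
      qed
    next
      fix x assume "x \<notin> {a<..t (Suc k)}"
      then show "step_function (S (Suc k)) x = 0"
        using Suc ak inc[of k] by (auto simp: sf indicator_def)
    qed
  qed
  from this[of m] have 1: "\<And>x. x \<in> {a<..b} \<Longrightarrow> \<bar>f x - step_function (S m) x\<bar> \<le> \<eta>"
    and 2: "\<And>x. x \<notin> {a<..b} \<Longrightarrow> step_function (S m) x = 0" by (auto simp: tm)
  have "a \<le> p \<and> p \<le> q \<and> q \<le> b" if mem: "(c, p, q) \<in> set (S m)" for c p q
  proof -
    obtain i where "i < m" "p = t i" "q = t (Suc i)" using mem by (auto simp: S_def)
    then show ?thesis using mono[of 0 i] inc[of i] mono[of "Suc i" m] by (auto simp: t0 tm)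
  qed
  then show thesis using 1 2 by (rule that)
qed

text \<open>As \<open>f\<close> may be unbounded near 0 and 1, it is approximated uniformly on
  \<open>{\<delta> n<..1 - \<delta> n}\<close> only; the rest has small norm by dominated
  convergence. Each part contributes \<open>\<epsilon> / 2\<close>.\<close>

lemma L2_step_approximation:
  fixes f :: "real \<Rightarrow> real"
  assumes cont: "continuous_on {0<..<1} f" and f: "sq_integrable unit_lborel f" and \<epsilon>: "0 < \<epsilon>"
  obtains S where "valid_step S"
    "(\<integral>\<^sup>+x. ennreal ((f x - step_function S x)\<^sup>2) \<partial>unit_lborel) \<le> ennreal \<epsilon>"
proof -
  have [measurable]: "f \<in> borel_measurable unit_lborel" using f by (rule sq_integrable_measurable)
  \<comment> \<open>The shift by 3 keeps \<open>\<delta> n\<close> at most 1/3, so the inner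
    interval is nondegenerate for every \<open>n\<close>.\<close>
  define \<delta> where "\<delta> n = 1 / (real n + 3)" for n
  have \<delta>: "0 < \<delta> n" "\<delta> n < 1 - \<delta> n" for n by (auto simp: \<delta>_def field_simps)
  have "(\<lambda>n. 1 / real n) \<longlonglongrightarrow> 0" by (rule lim_1_over_n)
  then have \<delta>lim: "\<delta> \<longlonglongrightarrow> 0"
    unfolding \<delta>_def using LIMSEQ_ignore_initial_segment[of "\<lambda>n. 1 / real n" 0 3] by simp
  have "(\<lambda>n. \<integral>x. indicator (- {\<delta> n<..1 - \<delta> n}) x * (f x)\<^sup>2 \<partial>unit_lborel) \<longlonglongrightarrow> (\<integral>x. 0 \<partial>unit_lborel)"
  proof (rule integral_dominated_convergence[where w="\<lambda>x. (f x)\<^sup>2"])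
    show "integrable unit_lborel (\<lambda>x. (f x)\<^sup>2)" using f by (rule sq_integrable_integrable_square)
    show "AE x in unit_lborel. (\<lambda>n. indicator (- {\<delta> n<..1 - \<delta> n}) x * (f x)\<^sup>2) \<longlonglongrightarrow> 0"
      using AE_space
    proof eventually_elim
      case (elim x)
      then have "eventually (\<lambda>n. \<delta> n < min x (1 - x)) sequentially"
        by (intro order_tendstoD(2)[OF \<delta>lim]) simp
      then have "eventually (\<lambda>n. indicator (- {\<delta> n<..1 - \<delta> n}) x * (f x)\<^sup>2 = 0) sequentially"
        by eventually_elim (auto simp: indicator_def)
      then show ?case by (rule tendsto_eventually)
    qed
    show "AE x in unit_lborel. norm (indicator (- {\<delta> n<..1 - \<delta> n}) x * (f x)\<^sup>2) \<le> (f x)\<^sup>2" for n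
      by (auto simp: indicator_def)
  qed auto
  then have "eventually (\<lambda>n. (\<integral>x. indicator (- {\<delta> n<..1 - \<delta> n}) x * (f x)\<^sup>2 \<partial>unit_lborel) < \<epsilon> / 2) sequentially"
    using \<epsilon> by (intro order_tendstoD(2)) auto
  then obtain n where n: "(\<integral>x. indicator (- {\<delta> n<..1 - \<delta> n}) x * (f x)\<^sup>2 \<partial>unit_lborel) < \<epsilon> / 2"
    by (auto simp: eventually_sequentially)
  have "continuous_on {\<delta> n..1 - \<delta> n} f"
    using cont by (rule continuous_on_subset) (use \<delta>[of n] in auto)
  moreover have "0 < sqrt (\<epsilon> / 2)" using \<epsilon> by simp
  ultimately obtain S where S: "\<And>c p q. (c, p, q) \<in> set S \<Longrightarrow> \<delta> n \<le> p \<and> p \<le> q \<and> q \<le> 1 - \<delta> n"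
    and S1: "\<And>x. x \<in> {\<delta> n<..1 - \<delta> n} \<Longrightarrow> \<bar>f x - step_function S x\<bar> \<le> sqrt (\<epsilon> / 2)"
    and S0: "\<And>x. x \<notin> {\<delta> n<..1 - \<delta> n} \<Longrightarrow> step_function S x = 0"
    using uniform_step_approximation[OF _ \<delta>(2)] by metis
  have i: "integrable unit_lborel (\<lambda>x. indicator (- {\<delta> n<..1 - \<delta> n}) x * (f x)\<^sup>2)"
    by (rule Bochner_Integration.integrable_bound[OF sq_integrable_integrable_square[OF f]]) (auto simp: indicator_def)
  have pt: "(f x - step_function S x)\<^sup>2 \<le> \<epsilon> / 2 + indicator (- {\<delta> n<..1 - \<delta> n}) x * (f x)\<^sup>2" for x
  proof (cases "x \<in> {\<delta> n<..1 - \<delta> n}")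
    case True
    have "(f x - step_function S x)\<^sup>2 \<le> (sqrt (\<epsilon> / 2))\<^sup>2"
      using S1[OF True] by (metis abs_ge_zero power2_abs power_mono)
    then show ?thesis using True \<epsilon> by simp
  next
    case False
    then show ?thesis using S0[OF False] \<epsilon> by simp
  qed
  have "(\<integral>\<^sup>+x. ennreal ((f x - step_function S x)\<^sup>2) \<partial>unit_lborel)
      \<le> (\<integral>\<^sup>+x. ennreal (\<epsilon> / 2 + indicator (- {\<delta> n<..1 - \<delta> n}) x * (f x)\<^sup>2) \<partial>unit_lborel)"
    by (intro nn_integral_mono ennreal_leI pt)
  also have "\<dots> = ennreal (\<integral>x. \<epsilon> / 2 + indicator (- {\<delta> n<..1 - \<delta> n}) x * (f x)\<^sup>2 \<partial>unit_lborel)"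
    using i \<epsilon> by (intro nn_integral_eq_integral) auto
  also have "\<dots> \<le> ennreal \<epsilon>"
    using i n by (intro ennreal_leI) (simp add: unit_lborel.prob_space[simplified])
  finally have "(\<integral>\<^sup>+x. ennreal ((f x - step_function S x)\<^sup>2) \<partial>unit_lborel) \<le> ennreal \<epsilon>" .
  moreover have "valid_step S"
    unfolding valid_step_def using S \<delta>[of n] by fastforce
  ultimately show thesis by (rule that[rotated])
qed

text \<open>An interval beyond \<open>s\<close> collapses to the empty \<open>{s<..s}\<close>, so no
  entry has to be deleted.\<close>

definition truncate_step :: "real \<Rightarrow> (real \<times> real \<times> real) list \<Rightarrow> (real \<times> real \<times> real) list" where
  "truncate_step s S = map (\<lambda>(c, p, q). (c, min p s, min q s)) S"

lemma step_function_truncate: "step_function (truncate_step s S) x = indicator {..s} x * step_function S x"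
  by (induction S) (auto simp: truncate_step_def step_function_def indicator_def)

lemma valid_truncate_step: "valid_step S \<Longrightarrow> 0 \<le> s \<Longrightarrow> valid_step (truncate_step s S)"
  by (fastforce simp: valid_step_def truncate_step_def)

lemma ennreal_mult_add_mult:
  "0 \<le> a \<Longrightarrow> 0 \<le> b \<Longrightarrow> 0 \<le> c \<Longrightarrow> 0 \<le> d \<Longrightarrow>
    ennreal a * ennreal b + ennreal c * ennreal d = ennreal (a * b + c * d)"
  by (simp add: ennreal_mult)

section \<open>Integrals over subintervals, jointly measurable versions, stochastic Fubini
  theorem\<close>

context wiener
begin

text \<open>The approximating step functions vanish outside \<open>{a<..b}\<close>, so their error
  over \<open>(0, 1)\<close> is the error over \<open>(a, b)\<close>, up to the null set
  \<open>{b}\<close>.\<close>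

lemma has_wiener_integral_imp_WI:
  assumes "has_wiener_integral M w a b f X" and ab: "0 \<le> a" "b \<le> 1"
  shows "WI (\<lambda>x. indicator {a<..<b} x * f x) X"
proof -
  from assms(1) obtain S where f: "set_borel_measurable borel {a<..<b} f" and X: "X \<in> borel_measurable M"
    and S: "\<And>n. \<forall>(c, p, q)\<in>set (S n). a \<le> p \<and> p \<le> q \<and> q \<le> b"
    and l1: "(\<lambda>n. \<integral>\<^sup>+x\<in>{a<..<b}. ennreal ((f x - step_function (S n) x)\<^sup>2) \<partial>lborel) \<longlonglongrightarrow> 0"
    and l2: "(\<lambda>n. \<integral>\<^sup>+\<omega>. ennreal ((X \<omega> - step_integral w (S n) \<omega>)\<^sup>2) \<partial>M) \<longlonglongrightarrow> 0"
    unfolding has_wiener_integral_def by blast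
  have "(\<lambda>x. indicator {a<..<b} x * f x) \<in> borel_measurable borel"
    using f by (simp add: set_borel_measurable_def)
  then have m: "(\<lambda>x. indicator {a<..<b} x * f x) \<in> borel_measurable unit_lborel" by measurable
  have outside: "step_function (S n) x = 0" if "x \<notin> {a<..b}" for n x
  proof -
    have "(case e of (c, p, q) \<Rightarrow> c * indicator {p<..q} x) = 0" if "e \<in> set (S n)" for e
      using S[of n] that \<open>x \<notin> {a<..b}\<close> by (fastforce simp: indicator_def)
    then have "map (\<lambda>(c, p, q). c * indicator {p<..q} x) (S n) = map (\<lambda>_. 0) (S n)"
      by (intro map_cong) auto
    then show ?thesis by (simp only: step_function_def sum_list_0)
  qed
  have "(\<integral>\<^sup>+x. ennreal ((indicator {a<..<b} x * f x - step_function (S n) x)\<^sup>2) \<partial>unit_lborel)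
      = (\<integral>\<^sup>+x\<in>{a<..<b}. ennreal ((f x - step_function (S n) x)\<^sup>2) \<partial>lborel)" for n
    unfolding nn_integral_unit_lborel
  proof (intro nn_integral_cong_AE)
    show "AE x in lborel. ennreal ((indicator {a<..<b} x * f x - step_function (S n) x)\<^sup>2) * indicator {0<..<1} x
        = ennreal ((f x - step_function (S n) x)\<^sup>2) * indicator {a<..<b} x"
      using AE_lborel_singleton[of b]
    proof eventually_elim
      case (elim x)
      then show ?case
        using outside[of x n] ab by (cases "x \<in> {a<..<b}") (auto simp: indicator_def)
    qed
  qed
  then have "L2_tendsto unit_lborel (\<lambda>n. step_function (S n)) (\<lambda>x. indicator {a<..<b} x * f x)"
    using l1 by (simp add: L2_tendsto_def)
  moreover have "valid_step (S n)" for n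
    using S[of n] ab unfolding valid_step_def by fastforce
  ultimately show ?thesis
    unfolding WI_iff using m X l2 by (auto simp: L2_tendsto_def)
qed

lemma nn_integral_WI: 
  assumes "WI f X" shows "(\<integral>\<^sup>+\<omega>. ennreal ((X \<omega>)\<^sup>2) \<partial>M) = (\<integral>\<^sup>+x. ennreal ((f x)\<^sup>2) \<partial>unit_lborel)"
  using WI_second_moment[OF assms] WI_sq_integrable[OF assms] WI_sq_integrable'[OF assms]
  by (simp add: nn_integral_eq_integral sq_integrable_def)

text \<open>The approximating steps have to be cut at \<open>s\<close>, which changes their
  integrals. Cutting does not increase the error of the step functions, and the isometry turns this
  into mean-square convergence to the same \<open>X\<close>.\<close>

lemma WI_imp_has_wiener_integral:
  assumes X: "WI (\<lambda>x. indicator {0<..<s} x * f x) X" and s: "s \<in> {0..1}"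
  shows "has_wiener_integral M w 0 s f X"
proof -
  let ?f = "\<lambda>x. indicator {0<..<s} x * f x"
  note [measurable] = WI_measurable[OF X]
  from X obtain S where S: "\<And>n. valid_step (S n)" and lim: "L2_tendsto unit_lborel (\<lambda>n. step_function (S n)) ?f"
    unfolding WI_iff by blast
  define T where "T n = truncate_step s (S n)" for n
  have T: "WI (step_function (T n)) (step_integral w (T n))" for n
    unfolding T_def using S s by (intro WI_step valid_truncate_step) auto
  have le: "(\<integral>\<^sup>+x. ennreal ((?f x - step_function (T n) x)\<^sup>2) \<partial>unit_lborel)
      \<le> (\<integral>\<^sup>+x. ennreal ((?f x - step_function (S n) x)\<^sup>2) \<partial>unit_lborel)" for n
    by (intro nn_integral_mono) (auto simp: T_def step_function_truncate indicator_def)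
  have lim': "(\<lambda>n. \<integral>\<^sup>+x. ennreal ((?f x - step_function (T n) x)\<^sup>2) \<partial>unit_lborel) \<longlonglongrightarrow> 0"
    by (rule tendsto_0_ennreal_le[OF lim[unfolded L2_tendsto_def] le])
  show ?thesis
    unfolding has_wiener_integral_def
  proof (intro conjI exI[of _ T] allI)
    have "(\<lambda>x. indicator {0<..<1} x *\<^sub>R ?f x) \<in> borel_measurable borel"
      using WI_measurable(1)[OF X] unfolding unit_lborel_def
      by (subst (asm) borel_measurable_restrict_space_iff) auto
    also have "(\<lambda>x. indicator {0<..<1} x *\<^sub>R ?f x) = (\<lambda>x. indicator {0<..<s} x *\<^sub>R f x)"
      using s by (auto simp: indicator_def)
    finally show "set_borel_measurable borel {0<..<s} f" by (simp add: set_borel_measurable_def)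
    show "X \<in> borel_measurable M" by simp
    show "\<forall>(c, p, q)\<in>set (T n). 0 \<le> p \<and> p \<le> q \<and> q \<le> s" for n
      using S[of n] s by (fastforce simp: T_def truncate_step_def valid_step_def)
    show "(\<lambda>n. \<integral>\<^sup>+\<omega>. ennreal ((X \<omega> - step_integral w (T n) \<omega>)\<^sup>2) \<partial>M) \<longlonglongrightarrow> 0"
      using lim' unfolding nn_integral_WI[OF WI_diff[OF X T]] .
    show "(\<lambda>n. \<integral>\<^sup>+x\<in>{0<..<s}. ennreal ((f x - step_function (T n) x)\<^sup>2) \<partial>lborel) \<longlonglongrightarrow> 0"
    proof (rule tendsto_0_ennreal_le[OF lim'])
      show "(\<integral>\<^sup>+x\<in>{0<..<s}. ennreal ((f x - step_function (T n) x)\<^sup>2) \<partial>lborel)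
          \<le> (\<integral>\<^sup>+x. ennreal ((?f x - step_function (T n) x)\<^sup>2) \<partial>unit_lborel)" for n
        unfolding nn_integral_unit_lborel using s by (intro nn_integral_mono) (auto simp: indicator_def)
    qed
  qed
qed

text \<open>
  Truncating the \<open>n\<close>-th approximating step function at a grid point below \<open>s\<close>, instead of at \<open>s\<close>
  itself, makes its integral jointly measurable in \<open>(s, \<omega>)\<close> without any path regularity.
\<close>

lemma wiener_integral_exists:
  fixes f :: "real \<Rightarrow> real"
  assumes cont: "continuous_on {0<..<1} f" and f: "sq_integrable unit_lborel f"
  obtains X where "(\<lambda>(s, \<omega>). X s \<omega>) \<in> borel_measurable (borel \<Otimes>\<^sub>M M)"
    "\<And>s. s \<in> {0..1} \<Longrightarrow> WI (\<lambda>x. indicator {0<..<s} x * f x) (X s)"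
proof -
  have [measurable]: "f \<in> borel_measurable unit_lborel" using f by (rule sq_integrable_measurable)
  have if2: "integrable unit_lborel (\<lambda>x. (f x)\<^sup>2)" by (rule sq_integrable_integrable_square[OF f])
  have "\<exists>S. valid_step S \<and> (\<integral>\<^sup>+x. ennreal ((f x - step_function S x)\<^sup>2) \<partial>unit_lborel) \<le> ennreal ((1/4)^n)" for n :: nat
    by (rule L2_step_approximation[OF cont f, of "(1/4)^n"]) auto
  then obtain S where S: "\<And>n. valid_step (S n)"
    and Sf: "\<And>n. (\<integral>\<^sup>+x. ennreal ((f x - step_function (S n) x)\<^sup>2) \<partial>unit_lborel) \<le> ennreal ((1/4)^n)"
    by metis
  \<comment> \<open>The mass of the squared integrand up to \<open>t\<close>. Its uniform continuity
    provides a mesh \<open>1 / K n\<close> for which moving the truncation point to the grid costs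
    less than \<open>(1/4)^n\<close>.\<close>
  define \<Phi> where "\<Phi> t = (\<integral>x. indicator {0<..<t} x *\<^sub>R (f x)\<^sup>2 \<partial>unit_lborel)" for t
  have "uniformly_continuous_on {0..1} \<Phi>"
    unfolding \<Phi>_def
    by (rule compact_uniformly_continuous[OF continuous_on_subset[OF continuous_on_indefinite_integral[OF if2]]]) auto
  have "\<exists>K::nat. K > 0 \<and> (\<forall>x\<in>{0..1}. \<forall>y\<in>{0..1}. dist x y < 1 / K \<longrightarrow> dist (\<Phi> x) (\<Phi> y) < (1/4)^n)" (is "\<exists>K. ?P n K") for n :: nat
  proof -
    obtain d where d: "d > 0" "\<forall>x\<in>{0..1}. \<forall>y\<in>{0..1}. dist x y < d \<longrightarrow> dist (\<Phi> x) (\<Phi> y) < (1/4)^n"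
      using \<open>uniformly_continuous_on {0..1} \<Phi>\<close> unfolding uniformly_continuous_on_def
      by (metis zero_less_divide_1_iff zero_less_numeral zero_less_power)
    obtain k :: nat where "inverse (Suc k) < d" using reals_Archimedean[OF d(1)] by blast
    then show ?thesis using d(2) by (intro exI[of _ "Suc k"]) (auto simp: inverse_eq_divide)
  qed
  then have "\<exists>K. \<forall>n. ?P n (K n)" by (intro choice allI)
  then obtain K :: "nat \<Rightarrow> nat" where K0: "\<forall>n. ?P n (K n)" by (elim exE)
  have K: "K n > 0" for n using K0 by simp
  have K\<Phi>: "dist (\<Phi> x) (\<Phi> y) < (1/4)^n" if "x \<in> {0..1}" "y \<in> {0..1}" "dist x y < 1 / K n" for n x y
    using K0[rule_format, of n] that by simp
  \<comment> \<open>With grid points indexed by integers, \<open>\<sigma> n s\<close> takes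
    countably many values, and for each of them a single step integral has to be measurable. The
    \<open>max 0\<close> covers negative \<open>s\<close>, as joint measurability is claimed on the
    whole line.\<close>
  define g where "g n i = max 0 (real_of_int i / K n)" for n and i :: int
  define \<sigma> where "\<sigma> n s = g n \<lfloor>s * real (K n)\<rfloor>" for n and s :: real
  define T where "T n s = truncate_step (\<sigma> n s) (S n)" for n s
  define Xn where "Xn n s = step_integral w (T n s)" for n s
  define X where "X s \<omega> = lim (\<lambda>n. Xn n s \<omega>)" for s \<omega>
  have g0: "0 \<le> g n i" for n i by (simp add: g_def)
  have \<sigma>0: "0 \<le> \<sigma> n s" for n s by (simp add: \<sigma>_def g0)
  have \<sigma>s: "\<sigma> n s \<le> s" "s - \<sigma> n s < 1 / K n" if "s \<in> {0..1}" for n s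
  proof -
    let ?i = "real_of_int \<lfloor>s * real (K n)\<rfloor>"
    have i: "?i \<le> s * real (K n)" "s * real (K n) - ?i < 1" by linarith+
    have k: "0 < real (K n)" using K by simp
    have eq: "\<sigma> n s = ?i / real (K n)" using that by (simp add: \<sigma>_def g_def)
    show "\<sigma> n s \<le> s" unfolding eq using i(1) k by (simp add: divide_le_eq)
    have "s - \<sigma> n s = (s * real (K n) - ?i) / real (K n)" unfolding eq using k by (simp add: diff_divide_distrib)
    also have "\<dots> < 1 / real (K n)" by (intro divide_strict_right_mono i k)
    finally show "s - \<sigma> n s < 1 / K n" .
  qed
  have vT: "valid_step (T n s)" for n s unfolding T_def by (intro valid_truncate_step S \<sigma>0)
  have Xn_meas: "(\<lambda>(s, \<omega>). Xn n s \<omega>) \<in> borel_measurable (borel \<Otimes>\<^sub>M M)" for n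
  proof -
    have "(\<lambda>p. step_integral w (truncate_step (g n i) (S n)) (snd p)) \<in> borel_measurable (borel \<Otimes>\<^sub>M M)" for i
      using step_integral_measurable[OF valid_truncate_step[OF S g0]] by measurable
    moreover have "(\<lambda>p. fst p * real (K n)) \<in> borel_measurable (borel \<Otimes>\<^sub>M M)" by simp
    then have "(\<lambda>p. \<lfloor>fst p * real (K n)\<rfloor>) \<in> measurable (borel \<Otimes>\<^sub>M M) (count_space UNIV)"
      by (rule measurable_compose[OF _ measurable_real_floor])
    ultimately have "(\<lambda>p. step_integral w (truncate_step (g n \<lfloor>fst p * real (K n)\<rfloor>) (S n)) (snd p)) \<in> borel_measurable (borel \<Otimes>\<^sub>M M)"
      by (rule measurable_compose_countable)
    then show ?thesis by (simp add: Xn_def T_def \<sigma>_def case_prod_unfold)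
  qed
  have X_meas: "(\<lambda>(s, \<omega>). X s \<omega>) \<in> borel_measurable (borel \<Otimes>\<^sub>M M)"
    using borel_measurable_lim_metric[of "\<lambda>n (s, \<omega>). Xn n s \<omega>", OF Xn_meas]
    by (simp add: X_def case_prod_unfold)
  have "WI (\<lambda>x. indicator {0<..<s} x * f x) (X s)" if s: "s \<in> {0..1}" for s
  proof -
    let ?f = "\<lambda>x. indicator {0<..<s} x * f x"
    have [measurable]: "Xn n s \<in> borel_measurable M" for n
      unfolding Xn_def using vT by measurable
    \<comment> \<open>Two errors, each at most \<open>(1/4)^n\<close> in squared norm:
      \<open>?a\<close> from approximating \<open>f\<close>, \<open>?b\<close> from truncating at
      the grid point instead of at \<open>s\<close>. The bound for the square of a sum doubles each,
      hence the factor 4.\<close>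
    have dist: "(\<integral>\<^sup>+x. ennreal ((?f x - step_function (T n s) x)\<^sup>2) \<partial>unit_lborel) \<le> ennreal (4 * (1/4)^n)" for n
    proof -
      let ?a = "\<lambda>x. indicator {..\<sigma> n s} x * (f x - step_function (S n) x)"
      let ?b = "\<lambda>x. (indicator {0<..<s} x - indicator {0<..<\<sigma> n s} x) * f x"
      have "(\<integral>\<^sup>+x. ennreal ((?f x - step_function (T n s) x)\<^sup>2) \<partial>unit_lborel) = (\<integral>\<^sup>+x. ennreal ((?a x + ?b x)\<^sup>2) \<partial>unit_lborel)"
      proof (rule nn_integral_cong_AE)
        show "AE x in unit_lborel. ennreal ((?f x - step_function (T n s) x)\<^sup>2) = ennreal ((?a x + ?b x)\<^sup>2)"
          using AE_unit_lborel_neq[of "\<sigma> n s"] AE_space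
          by eventually_elim
            (auto simp: T_def step_function_truncate indicator_def algebra_simps)
      qed
      also have "\<dots> \<le> ennreal 2 * (\<integral>\<^sup>+x. ennreal ((?a x)\<^sup>2) \<partial>unit_lborel) + ennreal 2 * (\<integral>\<^sup>+x. ennreal ((?b x)\<^sup>2) \<partial>unit_lborel)"
        by (intro nn_integral_square_add_le) measurable
      also have "\<dots> \<le> ennreal 2 * ennreal ((1/4)^n) + ennreal 2 * ennreal ((1/4)^n)"
      proof (intro add_mono mult_left_mono)
        show "(\<integral>\<^sup>+x. ennreal ((?a x)\<^sup>2) \<partial>unit_lborel) \<le> ennreal ((1/4)^n)"
          by (rule order_trans[OF nn_integral_mono Sf[of n]]) (auto simp: indicator_def)
        have ii: "integrable unit_lborel (\<lambda>x. indicator {0<..<t} x *\<^sub>R (f x)\<^sup>2)" for t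
          by (rule Bochner_Integration.integrable_bound[OF if2]) (auto simp: indicator_def)
        have "(\<integral>\<^sup>+x. ennreal ((?b x)\<^sup>2) \<partial>unit_lborel)
            = (\<integral>\<^sup>+x. ennreal (indicator {0<..<s} x *\<^sub>R (f x)\<^sup>2 - indicator {0<..<\<sigma> n s} x *\<^sub>R (f x)\<^sup>2) \<partial>unit_lborel)"
          using \<sigma>s(1)[OF s, of n] by (intro nn_integral_cong) (auto simp: indicator_def)
        also have "\<dots> = ennreal (\<Phi> s - \<Phi> (\<sigma> n s))"
          unfolding \<Phi>_def using ii \<sigma>s(1)[OF s, of n]
          by (subst nn_integral_eq_integral) (auto simp: indicator_def)
        also have "\<dots> \<le> ennreal ((1/4)^n)"
          using K\<Phi>[of s "\<sigma> n s" n] s \<sigma>s[OF s, of n] \<sigma>0[of n s]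
          by (intro ennreal_leI) (auto simp: dist_real_def)
        finally show "(\<integral>\<^sup>+x. ennreal ((?b x)\<^sup>2) \<partial>unit_lborel) \<le> ennreal ((1/4)^n)" .
      qed auto
      also have "\<dots> = ennreal (4 * (1/4)^n)"
        by (subst ennreal_mult_add_mult) auto
      finally show ?thesis .
    qed
    have lim1: "L2_tendsto unit_lborel (\<lambda>n. step_function (T n s)) ?f"
      unfolding L2_tendsto_def
    proof (rule tendsto_0_ennreal_le[OF _ dist])
      have "(\<lambda>n. 4 * (1/4::real)^n) \<longlonglongrightarrow> 4 * 0"
        by (intro tendsto_intros LIMSEQ_power_zero) auto
      then have "(\<lambda>n. ennreal (4 * (1/4)^n)) \<longlonglongrightarrow> ennreal (4 * 0)" by (rule tendsto_ennrealI)
      then show "(\<lambda>n. ennreal (4 * (1/4)^n)) \<longlonglongrightarrow> 0" by simp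
    qed
    have "L2_tendsto M (\<lambda>n. Xn n s) (\<lambda>\<omega>. lim (\<lambda>n. Xn n s \<omega>))"
    proof (rule L2_tendsto_lim)
      fix n m :: nat assume nm: "n \<le> m"
      have "(\<integral>\<^sup>+\<omega>. ennreal ((Xn m s \<omega> - Xn n s \<omega>)\<^sup>2) \<partial>M)
          = (\<integral>\<^sup>+x. ennreal ((step_function (T m s) x - step_function (T n s) x)\<^sup>2) \<partial>unit_lborel)"
        unfolding Xn_def by (intro nn_integral_WI WI_diff WI_step vT)
      also have "\<dots> = (\<integral>\<^sup>+x. ennreal (((?f x - step_function (T n s) x) + (- 1) * (?f x - step_function (T m s) x))\<^sup>2) \<partial>unit_lborel)"
        by simp
      also have "\<dots> \<le> ennreal 2 * (\<integral>\<^sup>+x. ennreal ((?f x - step_function (T n s) x)\<^sup>2) \<partial>unit_lborel)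
          + ennreal 2 * (\<integral>\<^sup>+x. ennreal (((- 1) * (?f x - step_function (T m s) x))\<^sup>2) \<partial>unit_lborel)"
        by (intro nn_integral_square_add_le) measurable
      also have "\<dots> \<le> ennreal 2 * ennreal (4 * (1/4)^n) + ennreal 2 * ennreal (4 * (1/4)^m)"
        using dist by (intro add_mono mult_left_mono) (auto simp: power2_commute[of "step_function (T m s) x" for x])
      also have "\<dots> = ennreal (8 * (1/4)^n + 8 * (1/4)^m)"
        by (subst ennreal_mult_add_mult) auto
      also have "\<dots> \<le> ennreal (16 * (1/4)^n)"
        using power_decreasing[OF nm, of "1/4::real"] by (intro ennreal_leI) simp
      finally show "(\<integral>\<^sup>+\<omega>. ennreal ((Xn m s \<omega> - Xn n s \<omega>)\<^sup>2) \<partial>M) \<le> ennreal (16 * (1/4)^n)" .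
    qed auto
    then have "L2_tendsto M (\<lambda>n. Xn n s) (X s)" by (simp add: X_def[abs_def])
    moreover have "(\<lambda>\<omega>. lim (\<lambda>n. Xn n s \<omega>)) \<in> borel_measurable M"
      by (rule borel_measurable_lim_metric) simp
    then have "X s \<in> borel_measurable M" by (simp add: X_def[abs_def])
    ultimately show ?thesis
      unfolding WI_iff using vT lim1 by (intro conjI exI[of _ "\<lambda>n. T n s"] allI) (auto simp: Xn_def)
  qed
  with X_meas show thesis by (rule that)
qed

text \<open>
  Stochastic Fubini theorem: with \<open>V = \<integral> J s ds\<close> and \<open>F = \<integral> f s ds\<close>, the isometry and the ordinary
  Fubini theorem give \<open>E V\<^sup>2 = E V Z = E Z\<^sup>2 = \<parallel>F\<parallel>\<^sup>2\<close>.
\<close>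

lemma
  assumes f: "sq_integrable (unit_lborel \<Otimes>\<^sub>M unit_lborel) (\<lambda>(s, v). f s v)"
    and J[measurable]: "(\<lambda>(s, \<omega>). J s \<omega>) \<in> borel_measurable (unit_lborel \<Otimes>\<^sub>M M)"
    and fJ: "\<And>s. s \<in> {0<..<1} \<Longrightarrow> WI (f s) (J s)"
  shows sq_integrable_WI_kernel: "sq_integrable (unit_lborel \<Otimes>\<^sub>M M) (\<lambda>(s, \<omega>). J s \<omega>)"
    and stochastic_Fubini: "WI (\<lambda>v. \<integral>s. f s v \<partial>unit_lborel) Z \<Longrightarrow> AE \<omega> in M. (\<integral>s. J s \<omega> \<partial>unit_lborel) = Z \<omega>"
proof -
  interpret Q: pair_prob_space unit_lborel M ..
  interpret R: pair_prob_space unit_lborel unit_lborel ..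
  have [measurable]: "(\<lambda>(s, v). f s v) \<in> borel_measurable (unit_lborel \<Otimes>\<^sub>M unit_lborel)"
    using f by (rule sq_integrable_measurable)
  have "(\<integral>\<^sup>+p. ennreal ((case p of (s, \<omega>) \<Rightarrow> J s \<omega>)\<^sup>2) \<partial>(unit_lborel \<Otimes>\<^sub>M M)) = (\<integral>\<^sup>+s. \<integral>\<^sup>+\<omega>. ennreal ((J s \<omega>)\<^sup>2) \<partial>M \<partial>unit_lborel)"
    by (subst nn_integral_fst[symmetric]) auto
  also have "\<dots> = (\<integral>\<^sup>+s. \<integral>\<^sup>+v. ennreal ((f s v)\<^sup>2) \<partial>unit_lborel \<partial>unit_lborel)"
    by (intro nn_integral_cong nn_integral_WI fJ) simp
  also have "\<dots> = (\<integral>\<^sup>+p. ennreal ((case p of (s, v) \<Rightarrow> f s v)\<^sup>2) \<partial>(unit_lborel \<Otimes>\<^sub>M unit_lborel))"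
    by (subst unit_lborel.nn_integral_fst[symmetric]) auto
  also have "\<dots> < \<infinity>" using f by (simp add: sq_integrable_iff_nn_integral)
  finally show sJ: "sq_integrable (unit_lborel \<Otimes>\<^sub>M M) (\<lambda>(s, \<omega>). J s \<omega>)"
    by (auto simp: sq_integrable_iff_nn_integral)
  let ?F = "\<lambda>v. \<integral>s. f s v \<partial>unit_lborel" and ?V = "\<lambda>\<omega>. \<integral>s. J s \<omega> \<partial>unit_lborel"
  assume Z: "WI ?F Z"
  have sF: "sq_integrable unit_lborel ?F" and sV: "sq_integrable M ?V"
    by (rule R.sq_integrable_integral_kernel[OF f], rule Q.sq_integrable_integral_kernel[OF sJ])
  have sZ: "sq_integrable M Z" using Z by (rule WI_sq_integrable')
  \<comment> \<open>Pairing with a Wiener integral \<open>B\<close> moves the computation from the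
    sample space to the integrands.\<close>
  have VB: "(\<integral>\<omega>. ?V \<omega> * B \<omega> \<partial>M) = (\<integral>v. ?F v * b v \<partial>unit_lborel)" if B: "WI b B" for b B
  proof -
    have "(\<integral>\<omega>. ?V \<omega> * B \<omega> \<partial>M) = (\<integral>s. (\<integral>\<omega>. J s \<omega> * B \<omega> \<partial>M) \<partial>unit_lborel)"
      by (rule Q.integral_kernel_mult[OF sJ WI_sq_integrable'[OF B]])
    also have "\<dots> = (\<integral>s. (\<integral>v. f s v * b v \<partial>unit_lborel) \<partial>unit_lborel)"
      by (intro Bochner_Integration.integral_cong refl WI_isometry fJ B) simp
    also have "\<dots> = (\<integral>v. ?F v * b v \<partial>unit_lborel)"
      by (rule R.integral_kernel_mult[OF f WI_sq_integrable[OF B], symmetric])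
    finally show ?thesis .
  qed
  \<comment> \<open>\<open>VB\<close> cannot be applied to \<open>?V\<close>, which is not yet known
    to be a Wiener integral. One factor is therefore opened by Fubini, and \<open>VB\<close> is used
    with \<open>B = J s\<close> for each \<open>s\<close>.\<close>
  have "(\<integral>\<omega>. ?V \<omega> * ?V \<omega> \<partial>M) = (\<integral>s. (\<integral>\<omega>. J s \<omega> * ?V \<omega> \<partial>M) \<partial>unit_lborel)"
    by (rule Q.integral_kernel_mult[OF sJ sV])
  also have "\<dots> = (\<integral>s. (\<integral>v. f s v * ?F v \<partial>unit_lborel) \<partial>unit_lborel)"
    using VB[OF fJ] by (intro Bochner_Integration.integral_cong refl) (simp add: mult.commute)
  also have "\<dots> = (\<integral>v. ?F v * ?F v \<partial>unit_lborel)"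
    by (rule R.integral_kernel_mult[OF f sF, symmetric])
  finally have VV: "(\<integral>\<omega>. (?V \<omega>)\<^sup>2 \<partial>M) = (\<integral>v. (?F v)\<^sup>2 \<partial>unit_lborel)" by (simp add: power2_eq_square)
  have VZ: "(\<integral>\<omega>. ?V \<omega> * Z \<omega> \<partial>M) = (\<integral>v. (?F v)\<^sup>2 \<partial>unit_lborel)"
    using VB[OF Z] by (simp add: power2_eq_square)
  have "(\<integral>\<omega>. (?V \<omega> - Z \<omega>)\<^sup>2 \<partial>M) = (\<integral>\<omega>. (?V \<omega>)\<^sup>2 - 2 * (?V \<omega> * Z \<omega>) + (Z \<omega>)\<^sup>2 \<partial>M)"
    by (intro Bochner_Integration.integral_cong refl) (simp add: power2_diff)
  also have "\<dots> = (\<integral>\<omega>. (?V \<omega>)\<^sup>2 \<partial>M) - 2 * (\<integral>\<omega>. ?V \<omega> * Z \<omega> \<partial>M) + (\<integral>\<omega>. (Z \<omega>)\<^sup>2 \<partial>M)"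
    using sV sZ integrable_sq_mult[OF sV sZ] by (simp add: sq_integrable_def)
  also have "\<dots> = 0" using VV VZ WI_second_moment[OF Z] by simp
  finally have "AE \<omega> in M. (?V \<omega> - Z \<omega>)\<^sup>2 = 0"
    using sq_integrable_diff[OF sV sZ] by (subst (asm) integral_nonneg_eq_0_iff_AE) (auto simp: sq_integrable_def)
  then show "AE \<omega> in M. ?V \<omega> = Z \<omega>" by eventually_elim simp
qed

end

section \<open>Inverses of continuous families of matrices\<close>

lemma matrix_inv_mult:
  fixes A :: "'a::semiring_1 ^ 'n ^ 'm"
  assumes "invertible A"
  shows "A ** matrix_inv A = mat 1" "matrix_inv A ** A = mat 1"
  using assms someI_ex[of "\<lambda>A'. A ** A' = mat 1 \<and> A' ** A = mat 1"]
  unfolding invertible_def matrix_inv_def by auto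

lemma continuous_on_det:
  fixes A :: "'b::topological_space \<Rightarrow> real ^ 'n ^ 'n"
  assumes "\<And>i j. continuous_on S (\<lambda>x. A x $ i $ j)"
  shows "continuous_on S (\<lambda>x. det (A x))"
  unfolding det_def by (intro continuous_intros assms)

text \<open>Cramer's rule writes each entry of the inverse as a quotient of determinants, and these
  are polynomials in the entries.\<close>

lemma continuous_on_matrix_inv_entry:
  fixes A :: "'b::topological_space \<Rightarrow> real ^ 'n ^ 'n"
  assumes A: "continuous_on S A" and inv: "\<And>x. x \<in> S \<Longrightarrow> invertible (A x)"
  shows "continuous_on S (\<lambda>x. matrix_inv (A x) $ k $ l)"
proof -
  let ?C = "\<lambda>x. (\<chi> i j. if j = k then axis l 1 $ i else A x $ i $ j) :: real ^ 'n ^ 'n"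
  have eq: "matrix_inv (A x) $ k $ l = det (?C x) / det (A x)" if "x \<in> S" for x
  proof -
    have "A x *v (matrix_inv (A x) *v axis l 1) = axis l 1"
      using matrix_inv_mult(1)[OF inv[OF that]] by (simp add: matrix_vector_mul_assoc)
    then have *: "matrix_inv (A x) *v axis l 1 = (\<chi> k. det (\<chi> i j. if j = k then axis l 1 $ i else A x $ i $ j) / det (A x))"
      using inv[OF that] by (simp add: cramer invertible_det_nz)
    have "matrix_inv (A x) $ k $ l = (matrix_inv (A x) *v axis l 1) $ k"
      by (simp add: matrix_vector_mult_basis column_def)
    then show ?thesis unfolding * by simp
  qed
  have "continuous_on S (\<lambda>x. det (?C x) / det (A x))"
  proof (intro continuous_on_divide continuous_on_det)
    show "continuous_on S (\<lambda>x. ?C x $ i $ j)" for i j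
      by (cases "j = k") (auto intro!: continuous_intros A)
    show "\<forall>x\<in>S. det (A x) \<noteq> 0" using inv by (auto simp: invertible_det_nz)
  qed (intro continuous_intros A)
  then show ?thesis by (rule continuous_on_eq) (simp add: eq)
qed

lemma outer_mult_vector: "outer v *v b = (v \<bullet> b) *\<^sub>R v"
  by (simp add: vec_eq_iff outer_def matrix_vector_mult_def inner_vec_def sum_distrib_left sum_distrib_right mult_ac)

lemma inner_outer: "a \<bullet> (outer v *v b) = (v \<bullet> a) * (v \<bullet> b)"
  by (simp add: outer_mult_vector inner_commute)

text \<open>Allows a bilinear form to be pulled through a matrix-valued integral.\<close>

lemma bounded_linear_quadratic_form: "bounded_linear (\<lambda>A :: real ^ 'd ^ 'd. a \<bullet> (A *v b))"
proof -
  have "linear (\<lambda>A :: real ^ 'd ^ 'd. a \<bullet> (A *v b))"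
    by (rule linearI) (simp_all add: matrix_vector_mult_add_rdistrib inner_add_right scaleR_matrix_vector_assoc[symmetric])
  then show ?thesis by (simp add: linear_conv_bounded_linear)
qed

section \<open>Integrals over subintervals and square integrable products\<close>

lemma set_lebesgue_integral_subinterval:
  fixes f :: "real \<Rightarrow> 'b :: {banach, second_countable_topology}"
  assumes "0 \<le> a" "b \<le> 1"
  shows "(LINT x:{a<..<b}|lborel. f x) = (\<integral>x. indicator {a<..<b} x *\<^sub>R f x \<partial>unit_lborel)"
  unfolding integral_unit_lborel set_lebesgue_integral_def
  by (intro Bochner_Integration.integral_cong refl) (use assms in \<open>auto simp: indicator_def\<close>)

lemma set_integrable_subinterval:
  fixes f :: "real \<Rightarrow> 'b :: {banach, second_countable_topology}"
  assumes "0 \<le> a" "b \<le> 1"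
  shows "set_integrable lborel {a<..<b} f \<longleftrightarrow> integrable unit_lborel (\<lambda>x. indicator {a<..<b} x *\<^sub>R f x)"
  unfolding integrable_unit_lborel set_integrable_def
  by (intro Bochner_Integration.integrable_cong refl) (use assms in \<open>auto simp: indicator_def\<close>)

lemma (in pair_prob_space) sq_integrable_tensor:
  assumes a: "sq_integrable M1 a" and b: "sq_integrable M2 b"
  shows "sq_integrable (M1 \<Otimes>\<^sub>M M2) (\<lambda>(s, x). a s * b x)"
proof -
  have [measurable]: "a \<in> borel_measurable M1" "b \<in> borel_measurable M2"
    using a b by (auto intro: sq_integrable_measurable)
  have "(\<integral>\<^sup>+p. ennreal ((case p of (s, x) \<Rightarrow> a s * b x)\<^sup>2) \<partial>(M1 \<Otimes>\<^sub>M M2))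
      = (\<integral>\<^sup>+s. \<integral>\<^sup>+x. ennreal ((a s)\<^sup>2) * ennreal ((b x)\<^sup>2) \<partial>M2 \<partial>M1)"
    by (subst M2.nn_integral_fst[symmetric]) (auto simp: power_mult_distrib ennreal_mult)
  also have "\<dots> = (\<integral>\<^sup>+s. ennreal ((a s)\<^sup>2) \<partial>M1) * (\<integral>\<^sup>+x. ennreal ((b x)\<^sup>2) \<partial>M2)"
    by (simp add: nn_integral_cmult nn_integral_multc)
  also have "\<dots> < \<infinity>"
    using a b by (auto simp: sq_integrable_iff_nn_integral ennreal_mult_less_top)
  finally show ?thesis by (auto simp: sq_integrable_iff_nn_integral)
qed

lemma sq_integrable_mult_bounded:
  assumes f: "sq_integrable M f" and [measurable]: "c \<in> borel_measurable M"
    and c: "\<And>x. x \<in> space M \<Longrightarrow> \<bar>c x\<bar> \<le> C"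
  shows "sq_integrable M (\<lambda>x. c x * f x)"
proof (rule sq_integrable_bound)
  have [measurable]: "f \<in> borel_measurable M" using f by (rule sq_integrable_measurable)
  show "integrable M (\<lambda>x. C\<^sup>2 * (f x)\<^sup>2)" using sq_integrable_integrable_square[OF f] by simp
  show "AE x in M. (c x * f x)\<^sup>2 \<le> C\<^sup>2 * (f x)\<^sup>2"
  proof (rule AE_I2)
    fix x assume "x \<in> space M"
    then have "(c x)\<^sup>2 \<le> C\<^sup>2" using c by (metis abs_ge_zero power2_abs power_mono)
    then show "(c x * f x)\<^sup>2 \<le> C\<^sup>2 * (f x)\<^sup>2" by (simp add: power_mult_distrib mult_right_mono)
  qed
  show "(\<lambda>x. c x * f x) \<in> borel_measurable M" by measurable
qed

interpretation unit_square: pair_prob_space unit_lborel unit_lborel ..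

section \<open>The covariance kernel of the transformed process\<close>

locale bridge_function =
  fixes h :: "real \<Rightarrow> real ^ 'd"
  assumes h_cont: "continuous_on {0<..<1} h"
    and h_int: "set_integrable lborel {0<..<1} (\<lambda>s. outer (h s))"
    and h_orth: "(LINT s:{0<..<1}|lborel. outer (h s)) = mat 1"
    and N_nondeg: "\<And>t. t \<in> {0..<1} \<Longrightarrow> invertible (N_mat h t)"
begin

lemma h_measurable [measurable]: "h \<in> borel_measurable unit_lborel"
  using borel_measurable_continuous_on_restrict[OF h_cont] measurable_cong_sets[OF sets_unit_lborel refl] by blast

lemma outer_integrable: "integrable unit_lborel (\<lambda>s. outer (h s))"
  using h_int by (simp add: integrable_unit_lborel)

lemma outer_measurable [measurable]: "(\<lambda>s. outer (h s)) \<in> borel_measurable unit_lborel"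
  using outer_integrable by (rule borel_measurable_integrable)

text \<open>The quadratic form of \<open>outer (h v)\<close> at \<open>a\<close> is the square of
  \<open>h v \<bullet> a\<close>, so integrability of the matrices amounts to square integrability
  here.\<close>

lemma sq_integrable_inner_h: "sq_integrable unit_lborel (\<lambda>v. h v \<bullet> a)"
proof -
  have "integrable unit_lborel (\<lambda>v. a \<bullet> (outer (h v) *v a))"
    by (rule integrable_bounded_linear[OF bounded_linear_quadratic_form outer_integrable])
  then show ?thesis by (simp add: sq_integrable_def inner_outer power2_eq_square)
qed

lemma sq_integrable_h_component: "sq_integrable unit_lborel (\<lambda>v. h v $ i)"
  using sq_integrable_inner_h[of "axis i 1"] by (simp add: inner_axis)

lemma h_integrable: "integrable unit_lborel h"
proof (rule Bochner_Integration.integrable_bound)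
  show "integrable unit_lborel (\<lambda>v. \<Sum>i\<in>UNIV. \<bar>h v $ i\<bar>)"
    using unit_lborel.sq_integrable_imp_integrable[OF sq_integrable_h_component] by (intro Bochner_Integration.integrable_sum) auto
  show "AE v in unit_lborel. norm (h v) \<le> norm (\<Sum>i\<in>UNIV. \<bar>h v $ i\<bar>)"
    using norm_le_l1_cart[of "h _"] by (intro AE_I2) (smt (verit) real_norm_def sum_nonneg abs_ge_zero)
qed measurable

lemma N_mat_quadratic_form:
  assumes "t \<in> {0..1}"
  shows "a \<bullet> (N_mat h t *v b) = (\<integral>v. indicator {t<..<1} v * ((h v \<bullet> a) * (h v \<bullet> b)) \<partial>unit_lborel)"
proof -
  have i: "integrable unit_lborel (\<lambda>v. indicator {t<..<1} v *\<^sub>R outer (h v))"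
    by (rule Bochner_Integration.integrable_bound[OF outer_integrable]) (auto simp: indicator_def)
  have "N_mat h t = (\<integral>v. indicator {t<..<1} v *\<^sub>R outer (h v) \<partial>unit_lborel)"
    unfolding N_mat_def using assms by (intro set_lebesgue_integral_subinterval) auto
  then have "a \<bullet> (N_mat h t *v b) = (\<integral>v. a \<bullet> ((indicator {t<..<1} v *\<^sub>R outer (h v)) *v b) \<partial>unit_lborel)"
    using integral_bounded_linear[OF bounded_linear_quadratic_form i, of a b] by simp
  also have "\<dots> = (\<integral>v. indicator {t<..<1} v * ((h v \<bullet> a) * (h v \<bullet> b)) \<partial>unit_lborel)"
    by (intro Bochner_Integration.integral_cong refl) (simp add: scaleR_matrix_vector_assoc[symmetric] inner_outer)
  finally show ?thesis .
qed

text \<open>Passes to the integral that starts at 0: its continuity in \<open>t\<close> is that of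
  an indefinite integral, and it is the matrix that occurs in the drift.\<close>

lemma N_mat_eq:
  assumes "t \<in> {0..1}"
  shows "N_mat h t = mat 1 - (\<integral>v. indicator {0<..<t} v *\<^sub>R outer (h v) \<partial>unit_lborel)"
proof -
  have i: "integrable unit_lborel (\<lambda>v. indicator A v *\<^sub>R outer (h v))" if "A \<in> sets borel" for A
    by (rule Bochner_Integration.integrable_bound[OF outer_integrable])
      (use that in \<open>auto simp: indicator_def intro!: borel_measurable_scaleR\<close>)
  have "(\<integral>v. indicator {0<..<t} v *\<^sub>R outer (h v) \<partial>unit_lborel) + N_mat h t
      = (\<integral>v. indicator {0<..<t} v *\<^sub>R outer (h v) + indicator {t<..<1} v *\<^sub>R outer (h v) \<partial>unit_lborel)"
    unfolding N_mat_def using assms i by (subst set_lebesgue_integral_subinterval) auto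
  also have "\<dots> = (\<integral>v. outer (h v) \<partial>unit_lborel)"
  proof (rule integral_cong_AE)
    show "AE v in unit_lborel. indicator {0<..<t} v *\<^sub>R outer (h v) + indicator {t<..<1} v *\<^sub>R outer (h v) = outer (h v)"
      using AE_unit_lborel_neq[of t] AE_space by eventually_elim (use assms in \<open>auto simp: indicator_def\<close>)
  qed (use outer_integrable i in auto)
  also have "\<dots> = mat 1" using h_orth by (simp add: integral_unit_lborel)
  finally show ?thesis by (simp add: eq_diff_eq add.commute)
qed

lemma N_mat_quadratic_form_complement:
  assumes "t \<in> {0..1}"
  shows "(\<integral>v. indicator {0<..<t} v * ((h v \<bullet> a) * (h v \<bullet> b)) \<partial>unit_lborel) = a \<bullet> b - a \<bullet> (N_mat h t *v b)"
proof -
  have i: "integrable unit_lborel (\<lambda>v. indicator {0<..<t} v *\<^sub>R outer (h v))"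
    by (rule Bochner_Integration.integrable_bound[OF outer_integrable]) (auto simp: indicator_def)
  have "(\<integral>v. indicator {0<..<t} v * ((h v \<bullet> a) * (h v \<bullet> b)) \<partial>unit_lborel)
      = (\<integral>v. a \<bullet> ((indicator {0<..<t} v *\<^sub>R outer (h v)) *v b) \<partial>unit_lborel)"
    by (intro Bochner_Integration.integral_cong refl) (simp add: scaleR_matrix_vector_assoc[symmetric] inner_outer)
  also have "\<dots> = a \<bullet> ((\<integral>v. indicator {0<..<t} v *\<^sub>R outer (h v) \<partial>unit_lborel) *v b)"
    by (rule integral_bounded_linear[OF bounded_linear_quadratic_form i])
  also have "(\<integral>v. indicator {0<..<t} v *\<^sub>R outer (h v) \<partial>unit_lborel) = mat 1 - N_mat h t"
    using N_mat_eq[OF assms] by simp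
  finally show ?thesis by (simp add: matrix_vector_mult_diff_rdistrib inner_diff_right)
qed

lemma continuous_on_N_mat: "continuous_on {0..<1} (N_mat h)"
proof -
  have "continuous_on {0..<1} (\<lambda>t. mat 1 - (\<integral>v. indicator {0<..<t} v *\<^sub>R outer (h v) \<partial>unit_lborel))"
    by (intro continuous_intros continuous_on_subset[OF continuous_on_indefinite_integral[OF outer_integrable]]) auto
  then show ?thesis by (rule continuous_on_eq) (simp add: N_mat_eq)
qed

definition g :: "real \<Rightarrow> real ^ 'd" where
  "g s = matrix_inv (N_mat h s) *v h s"

lemma N_mat_g: "s \<in> {0..<1} \<Longrightarrow> N_mat h s *v g s = h s"
  using matrix_inv_mult(1)[OF N_nondeg] by (simp add: g_def matrix_vector_mul_assoc)

lemma continuous_on_N_inv: "continuous_on {0..<1} (\<lambda>s. matrix_inv (N_mat h s) $ k $ l)"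
  by (intro continuous_on_matrix_inv_entry continuous_on_N_mat N_nondeg)

lemma g_measurable [measurable]: "g \<in> borel_measurable unit_lborel"
proof -
  have "continuous_on {0<..<1} (\<lambda>s. (\<chi> k. \<Sum>l\<in>UNIV. matrix_inv (N_mat h s) $ k $ l * h s $ l))"
    by (intro continuous_intros h_cont continuous_on_subset[OF continuous_on_N_inv]) auto
  also have "(\<lambda>s. (\<chi> k. \<Sum>l\<in>UNIV. matrix_inv (N_mat h s) $ k $ l * h s $ l)) = g"
    by (simp add: g_def[abs_def] matrix_vector_mult_def)
  finally show ?thesis
    using borel_measurable_continuous_on_restrict measurable_cong_sets[OF sets_unit_lborel refl] by blast
qed

text \<open>On \<open>{0..t}\<close> the entries of the inverse matrix are continuous, hence
  bounded, and \<open>h\<close> is square integrable. Since \<open>N_mat h 1\<close> is the zero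
  matrix, no such bound extends up to 1.\<close>

lemma sq_integrable_g_component:
  assumes t: "t < 1"
  shows "sq_integrable unit_lborel (\<lambda>s. indicator {0<..<t} s * g s $ k)"
proof -
  have "sq_integrable unit_lborel (\<lambda>s. (indicator {0<..<t} s * matrix_inv (N_mat h s) $ k $ l) * h s $ l)" for l
  proof -
    have "continuous_on {0..t} (\<lambda>s. matrix_inv (N_mat h s) $ k $ l)"
      by (rule continuous_on_subset[OF continuous_on_N_inv]) (use t in auto)
    then have "bounded ((\<lambda>s. matrix_inv (N_mat h s) $ k $ l) ` {0..t})"
      by (intro compact_imp_bounded compact_continuous_image) auto
    then obtain C where "\<forall>x\<in>(\<lambda>s. matrix_inv (N_mat h s) $ k $ l) ` {0..t}. norm x \<le> C"
      unfolding bounded_iff by blast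
    then have C: "\<bar>matrix_inv (N_mat h s) $ k $ l\<bar> \<le> C" if "s \<in> {0..t}" for s
      using that by auto
    have "(\<lambda>s. matrix_inv (N_mat h s) $ k $ l) \<in> borel_measurable unit_lborel"
      using borel_measurable_continuous_on_restrict[OF continuous_on_subset[OF continuous_on_N_inv]]
        measurable_cong_sets[OF sets_unit_lborel refl] by (metis greaterThanLessThan_subseteq_atLeastLessThan_iff order_refl)
    then have [measurable]: "(\<lambda>s. indicator {0<..<t} s * matrix_inv (N_mat h s) $ k $ l) \<in> borel_measurable unit_lborel"
      by measurable
    show ?thesis
    proof (rule sq_integrable_mult_bounded[OF sq_integrable_h_component])
      fix s show "\<bar>indicator {0<..<t} s * matrix_inv (N_mat h s) $ k $ l\<bar> \<le> max C 0"
        using C[of s] by (auto simp: indicator_def abs_mult)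
    qed measurable
  qed
  then have "sq_integrable unit_lborel (\<lambda>s. \<Sum>l\<in>UNIV. (indicator {0<..<t} s * matrix_inv (N_mat h s) $ k $ l) * h s $ l)"
    by (intro sq_integrable_sum)
  then show ?thesis by (simp add: g_def matrix_vector_mult_def sum_distrib_left mult.assoc)
qed

lemma g_integrable:
  assumes t: "t < 1"
  shows "integrable unit_lborel (\<lambda>s. indicator {0<..<t} s *\<^sub>R g s)"
proof (rule Bochner_Integration.integrable_bound)
  show "integrable unit_lborel (\<lambda>s. \<Sum>i\<in>UNIV. \<bar>indicator {0<..<t} s * g s $ i\<bar>)"
    using unit_lborel.sq_integrable_imp_integrable[OF sq_integrable_g_component[OF t]]
    by (intro Bochner_Integration.integrable_sum integrable_abs)
  show "AE s in unit_lborel. norm (indicator {0<..<t} s *\<^sub>R g s) \<le> norm (\<Sum>i\<in>UNIV. \<bar>indicator {0<..<t} s * g s $ i\<bar>)"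
  proof (rule AE_I2)
    fix s
    have "norm (indicator {0<..<t} s *\<^sub>R g s) \<le> (\<Sum>i\<in>UNIV. \<bar>(indicator {0<..<t} s *\<^sub>R g s) $ i\<bar>)"
      by (rule norm_le_l1_cart)
    then show "norm (indicator {0<..<t} s *\<^sub>R g s) \<le> norm (\<Sum>i\<in>UNIV. \<bar>indicator {0<..<t} s * g s $ i\<bar>)"
      by (simp add: sum_nonneg)
  qed
qed measurable

text \<open>
  For \<open>s < t\<close> the random variable \<open>J s - \<langle>\<zeta>, h s\<rangle>\<close> will turn out to be the Wiener integral
  of \<open>\<phi> t s\<close>, so that \<open>L t\<close> is the Wiener integral of \<open>k t\<close>.
\<close>

definition \<phi> :: "real \<Rightarrow> real \<Rightarrow> real \<Rightarrow> real" where
  "\<phi> t s v = (if s < t \<and> s < v then - (h v \<bullet> g s) else 0)"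

definition F :: "real \<Rightarrow> real \<Rightarrow> real" where
  "F t v = (\<integral>s. \<phi> t s v \<partial>unit_lborel)"

definition k :: "real \<Rightarrow> real \<Rightarrow> real" where
  "k t v = indicator {0<..t} v + F t v"

text \<open>The kernel is a finite sum of products of a function of \<open>s\<close> and a function
  of \<open>v\<close>, times the bounded indicator of the triangle \<open>s < v\<close>. The cut-off
  \<open>t < 1\<close> enters through \<open>g\<close>.\<close>

lemma sq_integrable_\<phi>:
  assumes t: "t < 1"
  shows "sq_integrable (unit_lborel \<Otimes>\<^sub>M unit_lborel) (\<lambda>(s, v). \<phi> t s v)"
proof -
  let ?c = "\<lambda>p::real \<times> real. if fst p < snd p then - 1 else 0 :: real"
  have "sq_integrable (unit_lborel \<Otimes>\<^sub>M unit_lborel) (\<lambda>p. ?c p * (\<Sum>i\<in>UNIV. (case p of (s, v) \<Rightarrow> (indicator {0<..<t} s * g s $ i) * h v $ i)))"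
  proof (rule sq_integrable_mult_bounded[where C=1])
    show "sq_integrable (unit_lborel \<Otimes>\<^sub>M unit_lborel) (\<lambda>p. \<Sum>i\<in>UNIV. (case p of (s, v) \<Rightarrow> (indicator {0<..<t} s * g s $ i) * h v $ i))"
      by (intro sq_integrable_sum unit_square.sq_integrable_tensor sq_integrable_g_component sq_integrable_h_component t)
    have [measurable]: "(\<lambda>x. x) \<in> borel_measurable unit_lborel" by measurable
    show "?c \<in> borel_measurable (unit_lborel \<Otimes>\<^sub>M unit_lborel)" by measurable
  qed auto
  moreover have "sq_integrable (unit_lborel \<Otimes>\<^sub>M unit_lborel) (\<lambda>p. ?c p * (\<Sum>i\<in>UNIV. (case p of (s, v) \<Rightarrow> (indicator {0<..<t} s * g s $ i) * h v $ i)))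
     \<longleftrightarrow> sq_integrable (unit_lborel \<Otimes>\<^sub>M unit_lborel) (\<lambda>(s, v). \<phi> t s v)"
  proof -
    have eq: "?c p * (\<Sum>i\<in>UNIV. (case p of (s, v) \<Rightarrow> (indicator {0<..<t} s * g s $ i) * h v $ i)) = (case p of (s, v) \<Rightarrow> \<phi> t s v)"
      if "p \<in> space (unit_lborel \<Otimes>\<^sub>M unit_lborel)" for p
      using that by (auto simp: space_pair_measure \<phi>_def inner_vec_def indicator_def mult.commute split: prod.splits)
    show ?thesis unfolding sq_integrable_def
      by (intro conj_cong measurable_cong Bochner_Integration.integrable_cong refl) (simp_all add: eq)
  qed
  ultimately show ?thesis by simp
qed

lemma sq_integrable_F: "t < 1 \<Longrightarrow> sq_integrable unit_lborel (F t)"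
  unfolding F_def[abs_def] by (rule unit_square.sq_integrable_integral_kernel[OF sq_integrable_\<phi>])

lemma sq_integrable_\<phi>_snd: "sq_integrable unit_lborel (\<phi> t s)"
proof -
  have "sq_integrable unit_lborel (\<lambda>v. (if s < t \<and> s < v then - 1 else 0) * (h v \<bullet> g s))"
    by (rule sq_integrable_mult_bounded[OF sq_integrable_inner_h, where C=1]) auto
  also have "(\<lambda>v. (if s < t \<and> s < v then - 1 else 0) * (h v \<bullet> g s)) = \<phi> t s"
    by (auto simp: \<phi>_def)
  finally show ?thesis .
qed

text \<open>The vector \<open>h v\<close> leaves the integral, and what remains is an indefinite
  integral of \<open>g\<close> in \<open>v\<close>; this is the source of continuity of
  \<open>F t\<close>.\<close>

lemma F_eq:
  assumes v: "v \<in> {0<..<1}"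
  shows "F t v = - (h v \<bullet> (\<integral>s. indicator {0<..<v} s *\<^sub>R (indicator {0<..<t} s *\<^sub>R g s) \<partial>unit_lborel))"
    and "t < 1 \<Longrightarrow> integrable unit_lborel (\<lambda>s. \<phi> t s v)"
proof -
  let ?i = "\<lambda>s. indicator {0<..<v} s *\<^sub>R (indicator {0<..<t} s *\<^sub>R g s)"
  have eq: "\<phi> t s v = - (h v \<bullet> ?i s)" if "s \<in> space unit_lborel" for s
    using that by (auto simp: \<phi>_def indicator_def)
  have i: "integrable unit_lborel ?i"
  proof (cases "t < 1")
    case True
    show ?thesis
      by (rule Bochner_Integration.integrable_bound[OF g_integrable[OF True]]) (auto simp: indicator_def)
  next
    case False
    \<comment> \<open>For \<open>t \<ge> 1\<close> the bound \<open>v < 1\<close> takes over the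
      role of the cut-off.\<close>
    have "integrable unit_lborel (\<lambda>s. indicator {0<..<v} s *\<^sub>R g s)" using g_integrable[of v] v by simp
    then show ?thesis
      by (rule Bochner_Integration.integrable_bound) (auto simp: indicator_def)
  qed
  show "F t v = - (h v \<bullet> (\<integral>s. ?i s \<partial>unit_lborel))"
  proof -
    have "F t v = (\<integral>s. - (h v \<bullet> ?i s) \<partial>unit_lborel)"
      unfolding F_def by (rule Bochner_Integration.integral_cong[OF refl eq])
    also have "\<dots> = - (\<integral>s. h v \<bullet> ?i s \<partial>unit_lborel)"
      by (rule Bochner_Integration.integral_minus)
    also have "(\<integral>s. h v \<bullet> ?i s \<partial>unit_lborel) = h v \<bullet> (\<integral>s. ?i s \<partial>unit_lborel)"
      by (rule integral_inner_right) (rule i)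
    finally show ?thesis .
  qed
  show "integrable unit_lborel (\<lambda>s. \<phi> t s v)"
  proof (subst Bochner_Integration.integrable_cong[OF refl eq])
    have "integrable unit_lborel (\<lambda>s. h v \<bullet> ?i s)" by (rule integrable_inner_right) (rule i)
    then show "integrable unit_lborel (\<lambda>s. - (h v \<bullet> ?i s))" by (rule Bochner_Integration.integrable_minus)
  qed
qed

text \<open>\<open>wiener_integral_exists\<close> asks for a continuous integrand; with this it
  produces the Wiener integral of \<open>F t\<close>.\<close>

lemma continuous_on_F:
  assumes t: "t < 1"
  shows "continuous_on {0<..<1} (F t)"
proof -
  have "continuous_on {0<..<1} (\<lambda>v. - (h v \<bullet> (\<integral>s. indicator {0<..<v} s *\<^sub>R (indicator {0<..<t} s *\<^sub>R g s) \<partial>unit_lborel)))"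
    by (intro continuous_intros h_cont continuous_on_subset[OF continuous_on_indefinite_integral[OF g_integrable[OF t]]]) auto
  then show ?thesis by (rule continuous_on_eq) (simp add: F_eq)
qed

text \<open>For \<open>u < s\<close> the product lives on \<open>(s, 1)\<close>, and up to the
  cut-offs its integral is the inner product of \<open>g u\<close> with
  \<open>N_mat h s *v g s = h s\<close>, that is \<open>- \<phi> t u s\<close>. The other term on
  the right is then zero; for \<open>s < u\<close> the roles are exchanged. On the diagonal both
  terms are zero while the left side need not be, hence \<open>u \<noteq> s\<close>.\<close>

lemma integral_\<phi>_\<phi>:
  assumes "s \<in> {0<..<1}" "u \<in> {0<..<1}" "u \<noteq> s"
  shows "(\<integral>v. \<phi> t u v * \<phi> r s v \<partial>unit_lborel) = - (of_bool (s < r) * \<phi> t u s + of_bool (u < t) * \<phi> r s u)"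
proof -
  have "(\<integral>v. \<phi> t u v * \<phi> r s v \<partial>unit_lborel)
      = (\<integral>v. (of_bool (u < t) * of_bool (s < r)) * (indicator {max u s<..<1} v * ((h v \<bullet> g u) * (h v \<bullet> g s))) \<partial>unit_lborel)"
    by (intro Bochner_Integration.integral_cong refl) (auto simp: \<phi>_def indicator_def)
  also have "\<dots> = of_bool (u < t) * of_bool (s < r) * (\<integral>v. indicator {max u s<..<1} v * ((h v \<bullet> g u) * (h v \<bullet> g s)) \<partial>unit_lborel)"
    by simp
  also have "\<dots> = - (of_bool (s < r) * \<phi> t u s + of_bool (u < t) * \<phi> r s u)"
  proof (cases "u < s")
    case True
    have "(\<integral>v. indicator {s<..<1} v * ((h v \<bullet> g u) * (h v \<bullet> g s)) \<partial>unit_lborel) = g u \<bullet> h s"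
      using N_mat_quadratic_form[of s "g u" "g s"] N_mat_g[of s] assms by simp
    then show ?thesis using True by (auto simp: \<phi>_def max_def inner_commute)
  next
    case False
    have "(\<integral>v. indicator {u<..<1} v * ((h v \<bullet> g u) * (h v \<bullet> g s)) \<partial>unit_lborel) = g s \<bullet> h u"
      using N_mat_quadratic_form[of u "g s" "g u"] N_mat_g[of u] assms by (simp add: mult.commute)
    then show ?thesis using False assms(3) by (auto simp: \<phi>_def max_def inner_commute)
  qed
  finally show ?thesis .
qed

text \<open>Applying Fubini twice integrates \<open>integral_\<phi>_\<phi>\<close> over both times.
  The result is the negative of the mixed terms that arise from expanding
  \<open>k r v * k t v\<close>.\<close>

lemma integral_F_F:
  assumes r: "r < 1" and t: "t < 1"
  shows "(\<integral>v. F r v * F t v \<partial>unit_lborel)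
    = - (\<integral>v. indicator {0<..r} v * F t v \<partial>unit_lborel) - (\<integral>v. indicator {0<..t} v * F r v \<partial>unit_lborel)"
proof -
  have sb: "sq_integrable unit_lborel (\<lambda>s. of_bool (s < r) :: real)" for r
    by (rule unit_lborel.sq_integrable_bounded[where C=1]) auto
  \<comment> \<open>The kernels produce the strict condition \<open>v < r\<close>, the definition of
    \<open>k\<close> the interval \<open>{0<..r}\<close>; they differ at one point.\<close>
  have ob: "(\<integral>v. of_bool (v < r) * f v \<partial>unit_lborel) = (\<integral>v. indicator {0<..r} v * f v \<partial>unit_lborel)"
    if [measurable]: "f \<in> borel_measurable unit_lborel" for r and f :: "real \<Rightarrow> real"
  proof (rule integral_cong_AE)
    show "AE v in unit_lborel. of_bool (v < r) * f v = indicator {0<..r} v * f v"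
      using AE_unit_lborel_neq[of r] AE_space by eventually_elim (auto simp: indicator_def)
  qed measurable
  have [measurable]: "F t \<in> borel_measurable unit_lborel" "F r \<in> borel_measurable unit_lborel"
    using sq_integrable_F r t by (auto intro: sq_integrable_measurable)
  \<comment> \<open>For fixed \<open>s\<close> the kernel identity is integrated in \<open>u\<close>
    alone; the excluded point \<open>u = s\<close> is a null set.\<close>
  have inner: "(\<integral>v. \<phi> r s v * F t v \<partial>unit_lborel) = - (of_bool (s < r) * F t s + (\<integral>u. \<phi> r s u * of_bool (u < t) \<partial>unit_lborel))"
    if s: "s \<in> {0<..<1}" for s
  proof -
    have m: "integrable unit_lborel (\<lambda>u. \<phi> r s u * of_bool (u < t))"
      by (rule integrable_sq_mult[OF sq_integrable_\<phi>_snd sb])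
    have "(\<integral>v. \<phi> r s v * F t v \<partial>unit_lborel) = (\<integral>u. (\<integral>v. \<phi> t u v * \<phi> r s v \<partial>unit_lborel) \<partial>unit_lborel)"
      using unit_square.integral_kernel_mult[OF sq_integrable_\<phi>[OF t] sq_integrable_\<phi>_snd[of r s]]
      by (simp add: F_def mult.commute)
    also have "\<dots> = (\<integral>u. - (of_bool (s < r) * \<phi> t u s + \<phi> r s u * of_bool (u < t)) \<partial>unit_lborel)"
    proof (rule integral_cong_AE)
      show "AE u in unit_lborel. (\<integral>v. \<phi> t u v * \<phi> r s v \<partial>unit_lborel) = - (of_bool (s < r) * \<phi> t u s + \<phi> r s u * of_bool (u < t))"
        using AE_unit_lborel_neq[of s] AE_space
        by eventually_elim (simp add: integral_\<phi>_\<phi>[OF s] mult.commute[of "\<phi> r s _"])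
      show "(\<lambda>u. \<integral>v. \<phi> t u v * \<phi> r s v \<partial>unit_lborel) \<in> borel_measurable unit_lborel"
        by (rule borel_measurable_integrable[OF unit_square.integrable_integral_kernel_mult[OF sq_integrable_\<phi>[OF t] sq_integrable_\<phi>_snd]])
      show "(\<lambda>u. - (of_bool (s < r) * \<phi> t u s + \<phi> r s u * of_bool (u < t))) \<in> borel_measurable unit_lborel"
        using F_eq(2)[OF s t] m by (intro borel_measurable_integrable) auto
    qed
    also have "\<dots> = - (of_bool (s < r) * F t s + (\<integral>u. \<phi> r s u * of_bool (u < t) \<partial>unit_lborel))"
      using F_eq(2)[OF s t] m by (simp add: F_def)
    finally show ?thesis .
  qed
  have i1: "integrable unit_lborel (\<lambda>s. of_bool (s < r) * F t s)"
    by (rule integrable_sq_mult[OF sb sq_integrable_F[OF t]])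
  have i2: "integrable unit_lborel (\<lambda>s. \<integral>u. \<phi> r s u * of_bool (u < t) \<partial>unit_lborel)"
    by (rule unit_square.integrable_integral_kernel_mult[OF sq_integrable_\<phi>[OF r] sb])
  have "(\<integral>v. F r v * F t v \<partial>unit_lborel) = (\<integral>s. (\<integral>v. \<phi> r s v * F t v \<partial>unit_lborel) \<partial>unit_lborel)"
    unfolding F_def[of r] by (rule unit_square.integral_kernel_mult[OF sq_integrable_\<phi>[OF r] sq_integrable_F[OF t]])
  also have "\<dots> = (\<integral>s. - (of_bool (s < r) * F t s + (\<integral>u. \<phi> r s u * of_bool (u < t) \<partial>unit_lborel)) \<partial>unit_lborel)"
    by (intro Bochner_Integration.integral_cong refl inner) simp
  also have "\<dots> = - (\<integral>s. of_bool (s < r) * F t s \<partial>unit_lborel) - (\<integral>s. (\<integral>u. \<phi> r s u * of_bool (u < t) \<partial>unit_lborel) \<partial>unit_lborel)"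
    using i1 i2 by simp
  also have "(\<integral>s. (\<integral>u. \<phi> r s u * of_bool (u < t) \<partial>unit_lborel) \<partial>unit_lborel) = (\<integral>v. F r v * of_bool (v < t) \<partial>unit_lborel)"
    unfolding F_def by (rule unit_square.integral_kernel_mult[OF sq_integrable_\<phi>[OF r] sb, symmetric])
  also have "(\<integral>v. F r v * of_bool (v < t) \<partial>unit_lborel) = (\<integral>v. of_bool (v < t) * F r v \<partial>unit_lborel)"
    by (simp add: mult.commute)
  finally show ?thesis by (simp add: ob)
qed

lemma integral_k_k:
  assumes r: "r \<in> {0..<1}" and t: "t \<in> {0..<1}"
  shows "(\<integral>v. k r v * k t v \<partial>unit_lborel) = min r t"
proof -
  have si: "sq_integrable unit_lborel (\<lambda>v. indicator {0<..r} v)" for r :: real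
    by (rule unit_lborel.sq_integrable_bounded[where C=1]) (auto simp: indicator_def)
  have sF: "sq_integrable unit_lborel (F r)" "sq_integrable unit_lborel (F t)"
    using sq_integrable_F r t by auto
  have "(\<integral>v. k r v * k t v \<partial>unit_lborel) = (\<integral>v. indicator {0<..r} v * indicator {0<..t} v + indicator {0<..r} v * F t v
      + indicator {0<..t} v * F r v + F r v * F t v \<partial>unit_lborel)"
    by (intro Bochner_Integration.integral_cong refl) (simp add: k_def algebra_simps)
  also have "\<dots> = (\<integral>v. indicator {0<..r} v * indicator {0<..t} v \<partial>unit_lborel) + (\<integral>v. indicator {0<..r} v * F t v \<partial>unit_lborel)
      + (\<integral>v. indicator {0<..t} v * F r v \<partial>unit_lborel) + (\<integral>v. F r v * F t v \<partial>unit_lborel)"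
    using integrable_sq_mult[OF si si] integrable_sq_mult[OF si sF(1)] integrable_sq_mult[OF si sF(2)] integrable_sq_mult[OF sF]
    by simp
  also have "\<dots> = (\<integral>v. indicator {0<..r} v * indicator {0<..t} v \<partial>unit_lborel)"
    using integral_F_F[of r t] r t by simp
  also have "(\<integral>v. indicator {0<..r} v * indicator {0<..t} v \<partial>unit_lborel) = (\<integral>v. indicator {0<..min r t} v \<partial>unit_lborel :: real)"
    by (intro Bochner_Integration.integral_cong refl) (auto simp: indicator_def)
  also have "\<dots> = min r t" using r t by (subst integral_unit_lborel_indicator) auto
  finally show ?thesis .
qed

end

section \<open>The transformed process\<close>

locale bridge = wiener M w + bridge_function h
  for M :: "'a measure" and w :: "real \<Rightarrow> 'a \<Rightarrow> real" and h :: "real \<Rightarrow> real ^ 'd"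
begin

lemma vec_wiener_integral_exists: "\<exists>\<zeta>. has_vec_wiener_integral M w 0 1 h \<zeta>"
proof -
  have "\<exists>X. has_wiener_integral M w 0 1 (\<lambda>s. h s $ i) X" for i
  proof -
    have "continuous_on {0<..<1} (\<lambda>s. h s $ i)" by (intro continuous_intros h_cont)
    then obtain X where X: "\<And>s. s \<in> {0..1} \<Longrightarrow> WI (\<lambda>x. indicator {0<..<s} x * h x $ i) (X s)"
      by (rule wiener_integral_exists[OF _ sq_integrable_h_component]) blast
    then show ?thesis using WI_imp_has_wiener_integral[OF X[of 1]] by auto
  qed
  then obtain X where "\<And>i. has_wiener_integral M w 0 1 (\<lambda>s. h s $ i) (X i)" by metis
  then show ?thesis
    by (intro exI[of _ "\<lambda>\<omega>. \<chi> i. X i \<omega>"]) (simp add: has_vec_wiener_integral_def)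
qed

end

locale bridge_coefficient = bridge M w h
  for M :: "'a measure" and w :: "real \<Rightarrow> 'a \<Rightarrow> real" and h :: "real \<Rightarrow> real ^ 'd" +
  fixes \<zeta> :: "'a \<Rightarrow> real ^ 'd"
  assumes \<zeta>: "has_vec_wiener_integral M w 0 1 h \<zeta>"
begin

sublocale time_space: pair_prob_space unit_lborel M ..

lemma WI_inner_\<zeta>: "WI (\<lambda>v. h v \<bullet> a) (\<lambda>\<omega>. \<zeta> \<omega> \<bullet> a)"
proof -
  have "WI (\<lambda>v. h v $ i) (\<lambda>\<omega>. \<zeta> \<omega> $ i)" for i
    using \<zeta> by (simp add: WI_def has_vec_wiener_integral_def)
  then have "WI (\<lambda>v. \<Sum>i\<in>UNIV. a $ i * h v $ i) (\<lambda>\<omega>. \<Sum>i\<in>UNIV. a $ i * \<zeta> \<omega> $ i)"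
    by (intro WI_sum WI_cmult)
  then show ?thesis by (simp add: inner_vec_def mult.commute)
qed

lemma \<zeta>_measurable [measurable]: "\<zeta> \<in> borel_measurable M"
proof (subst borel_measurable_euclidean_space, intro ballI)
  fix b :: "real ^ 'd" assume "b \<in> Basis"
  then show "(\<lambda>\<omega>. \<zeta> \<omega> \<bullet> b) \<in> borel_measurable M" using WI_measurable(2)[OF WI_inner_\<zeta>] by blast
qed

text \<open>The complement formula combined with \<open>N_mat h s *v g s = h s\<close>; this is what
  makes \<zeta> removable.\<close>

lemma drift_integral:
  assumes s: "s \<in> {0<..<1}"
  shows "(LINT v:{0<..<s}|lborel. (h v \<bullet> g s) * (z \<bullet> h v)) = z \<bullet> g s - z \<bullet> h s"
proof -
  have "(LINT v:{0<..<s}|lborel. (h v \<bullet> g s) * (z \<bullet> h v)) = (\<integral>v. indicator {0<..<s} v * ((h v \<bullet> z) * (h v \<bullet> g s)) \<partial>unit_lborel)"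
    using s by (subst set_lebesgue_integral_subinterval) (auto intro!: Bochner_Integration.integral_cong simp: inner_commute)
  then show ?thesis using s by (simp add: N_mat_quadratic_form_complement N_mat_g)
qed

text \<open>Subtracting \<open>\<zeta> \<omega> \<bullet> h s\<close> moves the drift of
  \<open>U\<close> under the time integral, and the cut-off at \<open>t\<close> makes this an
  integral over \<open>unit_lborel\<close>. The transform at time \<open>t\<close> becomes
  \<open>w t\<close> plus that integral.\<close>

definition J' :: "(real \<Rightarrow> 'a \<Rightarrow> real) \<Rightarrow> real \<Rightarrow> real \<Rightarrow> 'a \<Rightarrow> real" where
  "J' J t s \<omega> = (if s < t then J s \<omega> - \<zeta> \<omega> \<bullet> h s else 0)"

text \<open>After the drift \<open>\<zeta> \<bullet> h s\<close> is removed, what is subtracted is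
  \<open>\<zeta> \<bullet> g s\<close>, the Wiener integral of \<open>h v \<bullet> g s\<close> over
  all of \<open>(0, 1)\<close>. The integral over \<open>(0, s)\<close> minus this one is minus the
  integral over \<open>(s, 1)\<close>.\<close>

lemma WI_J':
  assumes J: "has_U_integral M h w \<zeta> 0 s (\<lambda>v. h v \<bullet> (matrix_inv (N_mat h s) *v h s)) (J s)"
    and s: "s \<in> {0<..<1}"
  shows "WI (\<phi> t s) (J' J t s)"
proof (cases "s < t")
  case False
  then have "\<phi> t s = (\<lambda>v. 0)" "J' J t s = (\<lambda>\<omega>. 0)" by (auto simp: \<phi>_def J'_def)
  then show ?thesis using WI_zero by simp
next
  case True
  obtain Y where Y: "has_wiener_integral M w 0 s (\<lambda>v. h v \<bullet> g s) Y"
    and JY: "\<And>\<omega>. \<omega> \<in> space M \<Longrightarrow> J s \<omega> = Y \<omega> - (\<zeta> \<omega> \<bullet> g s - \<zeta> \<omega> \<bullet> h s)"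
    using J unfolding has_U_integral_def g_def[symmetric] drift_integral[OF s] by blast
  have "WI (\<lambda>x. indicator {0<..<s} x * (h x \<bullet> g s)) Y"
    using has_wiener_integral_imp_WI[OF Y] s by simp
  from WI_diff[OF this WI_inner_\<zeta>[of "g s"]]
  have W: "WI (\<lambda>x. indicator {0<..<s} x * (h x \<bullet> g s) - h x \<bullet> g s) (\<lambda>\<omega>. Y \<omega> - \<zeta> \<omega> \<bullet> g s)" .
  have eq: "J' J t s \<omega> = Y \<omega> - \<zeta> \<omega> \<bullet> g s" if "\<omega> \<in> space M" for \<omega>
    using True JY[OF that] by (simp add: J'_def)
  show ?thesis
  proof (rule WI_cong_AE[OF W])
    show "AE x in unit_lborel. indicator {0<..<s} x * (h x \<bullet> g s) - h x \<bullet> g s = \<phi> t s x"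
      using AE_unit_lborel_neq[of s] AE_space by eventually_elim (use True in \<open>auto simp: \<phi>_def indicator_def\<close>)
    show "J' J t s \<in> borel_measurable M"
      using WI_measurable(2)[OF W] by (subst measurable_cong[OF eq])
    show "AE \<omega> in M. Y \<omega> - \<zeta> \<omega> \<bullet> g s = J' J t s \<omega>" using eq by (intro AE_I2) simp
  qed (rule sq_integrable_measurable[OF sq_integrable_\<phi>_snd])
qed

lemma J'_measurable:
  assumes [measurable]: "(\<lambda>(s, \<omega>). J s \<omega>) \<in> borel_measurable (unit_lborel \<Otimes>\<^sub>M M)"
  shows "(\<lambda>(s, \<omega>). J' J t s \<omega>) \<in> borel_measurable (unit_lborel \<Otimes>\<^sub>M M)"
proof -
  have [measurable]: "(\<lambda>x. x) \<in> borel_measurable unit_lborel" by measurable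
  have "(\<lambda>p. J (fst p) (snd p)) \<in> borel_measurable (unit_lborel \<Otimes>\<^sub>M M)"
    using assms by (simp add: case_prod_unfold)
  then show ?thesis unfolding J'_def case_prod_unfold by measurable
qed

lemma joint_measurable_iff:
  "f \<in> borel_measurable (restrict_space borel {0<..<1} \<Otimes>\<^sub>M M) \<longleftrightarrow> f \<in> borel_measurable (unit_lborel \<Otimes>\<^sub>M M)"
  by (intro arg_cong[of _ _ "\<lambda>A. f \<in> A"] measurable_cong_sets sets_pair_measure_cong sets_unit_lborel[symmetric] refl)

text \<open>The integrand \<open>h v \<bullet> g s\<close> depends on \<open>s\<close>, but by
  linearity it suffices to have jointly measurable indefinite Wiener integrals of the components of
  \<open>h\<close>, which are then contracted with \<open>g s\<close>.\<close>

lemma L2_transform_exists: "\<exists>L. is_L2_transform M h w \<zeta> L"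
proof -
  have "\<exists>X. (\<lambda>(s, \<omega>). X s \<omega>) \<in> borel_measurable (borel \<Otimes>\<^sub>M M) \<and>
      (\<forall>s\<in>{0..1}. WI (\<lambda>x. indicator {0<..<s} x * h x $ i) (X s))" for i
  proof -
    have "continuous_on {0<..<1} (\<lambda>s. h s $ i)" by (intro continuous_intros h_cont)
    then show ?thesis by (rule wiener_integral_exists[OF _ sq_integrable_h_component]) blast
  qed
  then obtain X where Xm: "\<And>i. (\<lambda>(s, \<omega>). X i s \<omega>) \<in> borel_measurable (borel \<Otimes>\<^sub>M M)"
    and X: "\<And>i s. s \<in> {0..1} \<Longrightarrow> WI (\<lambda>x. indicator {0<..<s} x * h x $ i) (X i s)"
    by metis
  define J where "J s \<omega> = (\<Sum>i\<in>UNIV. g s $ i * X i s \<omega>) - (\<zeta> \<omega> \<bullet> g s - \<zeta> \<omega> \<bullet> h s)" for s \<omega>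
  have [measurable]: "(\<lambda>p. X i (fst p) (snd p)) \<in> borel_measurable (unit_lborel \<Otimes>\<^sub>M M)" for i
  proof -
    have [measurable]: "(\<lambda>x. x) \<in> borel_measurable unit_lborel" by measurable
    have "(\<lambda>p. (fst p, snd p)) \<in> measurable (unit_lborel \<Otimes>\<^sub>M M) (borel \<Otimes>\<^sub>M M)" by measurable
    from measurable_compose[OF this Xm[of i]] show ?thesis by simp
  qed
  have Jm: "(\<lambda>(s, \<omega>). J s \<omega>) \<in> borel_measurable (unit_lborel \<Otimes>\<^sub>M M)"
  proof -
    have "(\<lambda>p. g (fst p) $ i) \<in> borel_measurable (unit_lborel \<Otimes>\<^sub>M M)" for i
      by (rule measurable_compose[OF _ borel_measurable_continuous_onI[OF continuous_on_component[OF continuous_on_id]]]) measurable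
    then show ?thesis unfolding J_def case_prod_unfold by measurable
  qed
  have JU: "has_U_integral M h w \<zeta> 0 s (\<lambda>v. h v \<bullet> (matrix_inv (N_mat h s) *v h s)) (J s)" if s: "s \<in> {0<..<1}" for s
  proof -
    have "WI (\<lambda>x. \<Sum>i\<in>UNIV. g s $ i * (indicator {0<..<s} x * h x $ i)) (\<lambda>\<omega>. \<Sum>i\<in>UNIV. g s $ i * X i s \<omega>)"
      using s by (intro WI_sum WI_cmult X) auto
    also have "(\<lambda>x. \<Sum>i\<in>UNIV. g s $ i * (indicator {0<..<s} x * h x $ i)) = (\<lambda>x. indicator {0<..<s} x * (h x \<bullet> g s))"
      by (simp add: inner_vec_def sum_distrib_left mult_ac)
    finally have "has_wiener_integral M w 0 s (\<lambda>x. h x \<bullet> g s) (\<lambda>\<omega>. \<Sum>i\<in>UNIV. g s $ i * X i s \<omega>)"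
      using s by (intro WI_imp_has_wiener_integral) auto
    then show ?thesis
      unfolding has_U_integral_def g_def[symmetric] drift_integral[OF s] J_def by blast
  qed
  \<comment> \<open>Countably many cut-offs increasing to 1 give one null set for all
    \<open>t\<close>, since every \<open>t < 1\<close> lies below one of them.\<close>
  have "AE \<omega> in M. \<forall>n. integrable unit_lborel (\<lambda>s. J' J (1 - 1 / (real n + 2)) s \<omega>)"
    unfolding AE_all_countable
  proof
    fix n
    have "sq_integrable (unit_lborel \<Otimes>\<^sub>M M) (\<lambda>(s, \<omega>). J' J (1 - 1 / (real n + 2)) s \<omega>)"
      by (rule sq_integrable_WI_kernel[OF sq_integrable_\<phi> J'_measurable[OF Jm] WI_J'[OF JU]]) auto
    from time_space.AE_sq_integrable_kernel[OF this]
    show "AE \<omega> in M. integrable unit_lborel (\<lambda>s. J' J (1 - 1 / (real n + 2)) s \<omega>)"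
      by eventually_elim (rule unit_lborel.sq_integrable_imp_integrable)
  qed
  then have int: "AE \<omega> in M. \<forall>t\<in>{0..<1}. set_integrable lborel {0<..<t} (\<lambda>s. J s \<omega>)"
  proof eventually_elim
    case (elim \<omega>)
    show ?case
    proof
      fix t :: real assume t: "t \<in> {0..<1}"
      obtain n where n: "inverse (Suc n) < 1 - t" using reals_Archimedean[of "1 - t"] t by auto
      define b where "b = 1 - 1 / (real n + 2)"
      have "1 / (real n + 2) \<le> inverse (real (Suc n))" by (simp add: field_simps)
      then have b: "t < b" using n by (simp add: b_def)
      have i: "integrable unit_lborel (\<lambda>s. J' J b s \<omega> + \<zeta> \<omega> \<bullet> h s)"
        using elim integrable_inner_right[of "\<zeta> \<omega>" unit_lborel h] h_integrable unfolding b_def by (intro Bochner_Integration.integrable_add) auto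
      have "integrable unit_lborel (\<lambda>s. indicator {0<..<t} s *\<^sub>R (J' J b s \<omega> + \<zeta> \<omega> \<bullet> h s))"
      proof (rule Bochner_Integration.integrable_bound[OF i])
        show "(\<lambda>s. indicator {0<..<t} s *\<^sub>R (J' J b s \<omega> + \<zeta> \<omega> \<bullet> h s)) \<in> borel_measurable unit_lborel"
          using borel_measurable_integrable[OF i] by measurable
      qed (auto simp: indicator_def)
      also have "(\<lambda>s. indicator {0<..<t} s *\<^sub>R (J' J b s \<omega> + \<zeta> \<omega> \<bullet> h s)) = (\<lambda>s. indicator {0<..<t} s *\<^sub>R J s \<omega>)"
        using b by (auto simp: J'_def indicator_def)
      finally show "set_integrable lborel {0<..<t} (\<lambda>s. J s \<omega>)"
        using t by (subst set_integrable_subinterval) auto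
    qed
  qed
  show ?thesis
    unfolding is_L2_transform_def joint_measurable_iff
    by (intro exI[of _ "\<lambda>t \<omega>. U_process h w \<zeta> t \<omega> + (LINT s:{0<..<t}|lborel. J s \<omega>)"] exI[of _ J])
      (use Jm JU int in simp)
qed

lemma AE_w_zero: "AE \<omega> in M. w 0 \<omega> = 0"
  using wiener by (simp add: wiener_process_def)

section \<open>Law and paths of one fixed version of the transform\<close>

context
  fixes L J
  assumes Jm: "(\<lambda>(s, \<omega>). J s \<omega>) \<in> borel_measurable (unit_lborel \<Otimes>\<^sub>M M)"
    and JU: "\<And>s. s \<in> {0<..<1} \<Longrightarrow> has_U_integral M h w \<zeta> 0 s (\<lambda>v. h v \<bullet> (matrix_inv (N_mat h s) *v h s)) (J s)"
    and int: "AE \<omega> in M. \<forall>t\<in>{0..<1}. set_integrable lborel {0<..<t} (\<lambda>s. J s \<omega>)"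
    and L: "\<And>t \<omega>. t \<in> {0..<1} \<Longrightarrow> \<omega> \<in> space M \<Longrightarrow>
      L t \<omega> = U_process h w \<zeta> t \<omega> + (LINT s:{0<..<t}|lborel. J s \<omega>)"
begin

lemma L_eq:
  assumes "t \<in> {0..<1}" "\<omega> \<in> space M"
  shows "L t \<omega> = w t \<omega> - \<zeta> \<omega> \<bullet> (\<integral>s. indicator {0<..<t} s *\<^sub>R h s \<partial>unit_lborel)
    + (\<integral>s. indicator {0<..<t} s *\<^sub>R J s \<omega> \<partial>unit_lborel)"
  using assms L[OF assms] by (simp add: U_process_def set_lebesgue_integral_subinterval)

lemma L_measurable:
  assumes t: "t \<in> {0..<1}"
  shows "L t \<in> borel_measurable M"
proof -
  have [measurable]: "(\<lambda>x. x) \<in> borel_measurable unit_lborel" by measurable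
  have [measurable]: "w t \<in> borel_measurable M" using w_measurable t by simp
  have [measurable]: "(\<lambda>p. J (snd p) (fst p)) \<in> borel_measurable (M \<Otimes>\<^sub>M unit_lborel)"
    using measurable_pair_swap[OF Jm] by (simp add: case_prod_unfold)
  have "(\<lambda>(\<omega>, s). indicator {0<..<t} s *\<^sub>R J s \<omega>) \<in> borel_measurable (M \<Otimes>\<^sub>M unit_lborel)"
    unfolding case_prod_unfold by measurable
  then have [measurable]: "(\<lambda>\<omega>. \<integral>s. indicator {0<..<t} s *\<^sub>R J s \<omega> \<partial>unit_lborel) \<in> borel_measurable M"
    by (rule unit_lborel.borel_measurable_lebesgue_integral)
  have "(\<lambda>\<omega>. w t \<omega> - \<zeta> \<omega> \<bullet> (\<integral>s. indicator {0<..<t} s *\<^sub>R h s \<partial>unit_lborel)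
      + (\<integral>s. indicator {0<..<t} s *\<^sub>R J s \<omega> \<partial>unit_lborel)) \<in> borel_measurable M"
    by measurable
  then show ?thesis by (subst measurable_cong[OF L_eq[OF t]])
qed

text \<open>The increment of \<open>w\<close> from 0 to \<open>t\<close> is the Wiener integral of
  \<open>indicator {0<..t}\<close>, and the stochastic Fubini theorem turns the time integral of
  \<open>J' J t\<close> into that of \<open>F t\<close>.\<close>

lemma WI_L:
  assumes t: "t \<in> {0..<1}"
  shows "WI (k t) (L t)"
proof -
  have t1: "t < 1" using t by simp
  \<comment> \<open>The stochastic Fubini theorem compares with a given Wiener integral of
    \<open>F t\<close>. This provides one: \<open>X 1\<close> belongs to the whole interval.\<close>
  obtain X where X: "\<And>s. s \<in> {0..1} \<Longrightarrow> WI (\<lambda>x. indicator {0<..<s} x * F t x) (X s)"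
    by (rule wiener_integral_exists[OF continuous_on_F[OF t1] sq_integrable_F[OF t1]]) blast
  have Fm: "F t \<in> borel_measurable unit_lborel" using sq_integrable_F[OF t1] by (rule sq_integrable_measurable)
  have Z: "WI (F t) (X 1)"
  proof (rule WI_cong_AE[OF X[of 1] Fm])
    show "X 1 \<in> borel_measurable M" using WI_measurable(2)[OF X[of 1]] by simp
    show "AE x in unit_lborel. indicator {0<..<1} x * F t x = F t x"
      using AE_space by eventually_elim simp
  qed auto
  have V: "AE \<omega> in M. (\<integral>s. J' J t s \<omega> \<partial>unit_lborel) = X 1 \<omega>"
  proof (rule stochastic_Fubini[OF sq_integrable_\<phi>[OF t1] J'_measurable[OF Jm] WI_J'[OF JU]])
    show "WI (\<lambda>v. \<integral>s. \<phi> t s v \<partial>unit_lborel) (X 1)" using Z by (simp add: F_def[abs_def])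
  qed
  have W: "WI (indicator {0<..t}) (\<lambda>\<omega>. w t \<omega> - w 0 \<omega>)"
    using WI_step[of "[(1, 0, t)]"] t by (simp add: valid_step_def step_function_def[abs_def] step_integral_def[abs_def])
  have kt: "(\<lambda>v. indicator {0<..t} v + F t v) = k t" by (simp add: k_def[abs_def])
  show ?thesis
  proof (rule WI_cong_AE[OF WI_add[OF W Z]])
    show "k t \<in> borel_measurable unit_lborel" using Fm unfolding kt[symmetric] by measurable
    show "L t \<in> borel_measurable M" by (rule L_measurable[OF t])
    show "AE v in unit_lborel. indicator {0<..t} v + F t v = k t v" by (simp add: k_def)
    show "AE \<omega> in M. w t \<omega> - w 0 \<omega> + X 1 \<omega> = L t \<omega>"
      using V int AE_w_zero AE_space
    proof eventually_elim
      case (elim \<omega>)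
      let ?i = "\<lambda>s. indicator {0<..<t} s :: real"
      have iJ: "integrable unit_lborel (\<lambda>s. ?i s *\<^sub>R J s \<omega>)"
        using elim(2) t set_integrable_subinterval[of 0 t "\<lambda>s. J s \<omega>"] by simp
      have ih: "integrable unit_lborel (\<lambda>s. ?i s *\<^sub>R h s)"
        by (rule Bochner_Integration.integrable_bound[OF h_integrable]) (auto simp: indicator_def)
      have "(\<integral>s. J' J t s \<omega> \<partial>unit_lborel) = (\<integral>s. ?i s *\<^sub>R J s \<omega> - \<zeta> \<omega> \<bullet> (?i s *\<^sub>R h s) \<partial>unit_lborel)"
        by (intro Bochner_Integration.integral_cong refl) (auto simp: J'_def indicator_def)
      also have "\<dots> = (\<integral>s. ?i s *\<^sub>R J s \<omega> \<partial>unit_lborel) - (\<integral>s. \<zeta> \<omega> \<bullet> (?i s *\<^sub>R h s) \<partial>unit_lborel)"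
        by (rule Bochner_Integration.integral_diff[OF iJ integrable_inner_right[OF ih]])
      also have "(\<integral>s. \<zeta> \<omega> \<bullet> (?i s *\<^sub>R h s) \<partial>unit_lborel) = \<zeta> \<omega> \<bullet> (\<integral>s. ?i s *\<^sub>R h s \<partial>unit_lborel)"
        by (rule integral_inner_right) (rule ih)
      finally show ?case using L_eq[OF t] elim by simp
    qed
  qed
qed

lemma L_increments:
  assumes "s \<in> {0..<1}" "t \<in> {0..<1}"
  shows "WI (\<lambda>v. k t v - k s v) (\<lambda>\<omega>. L t \<omega> - L s \<omega>)"
  by (intro WI_diff WI_L assms)

lemma integral_k_increments:
  assumes "s \<in> {0..<1}" "t \<in> {0..<1}" "s' \<in> {0..<1}" "t' \<in> {0..<1}"
  shows "(\<integral>v. (k t v - k s v) * (k t' v - k s' v) \<partial>unit_lborel) = min t t' - min t s' - min s t' + min s s'"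
proof -
  have i: "integrable unit_lborel (\<lambda>v. k a v * k b v)" if "a \<in> {0..<1}" "b \<in> {0..<1}" for a b
    by (rule integrable_sq_mult[OF WI_sq_integrable[OF WI_L] WI_sq_integrable[OF WI_L]]) (fact that)+
  have "(\<integral>v. (k t v - k s v) * (k t' v - k s' v) \<partial>unit_lborel)
      = (\<integral>v. k t v * k t' v - k t v * k s' v - k s v * k t' v + k s v * k s' v \<partial>unit_lborel)"
    by (intro Bochner_Integration.integral_cong refl) (simp add: algebra_simps)
  then show ?thesis using assms by (simp add: i integral_k_k)
qed

lemma distributed_L:
  assumes st: "s \<in> {0..<1}" "t \<in> {0..<1}" "s < t"
  shows "distributed M lborel (\<lambda>\<omega>. L t \<omega> - L s \<omega>) (normal_density 0 (sqrt (t - s)))"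
proof -
  note W = L_increments[OF st(1,2)]
  have v: "(\<integral>v. (k t v - k s v)\<^sup>2 \<partial>unit_lborel) = t - s"
    using integral_k_increments[OF st(1,2) st(1,2)] st(3) by (simp add: power2_eq_square)
  show ?thesis
    using WI_char[OF W] st(3) unfolding v by (intro gaussian_distributed WI_measurable(2)[OF W]) auto
qed

text \<open>Linear combinations of increments are again Wiener integrals, hence Gaussian with the
  squared norm of the integrand in the exponent. Disjoint increments have orthogonal integrands, so
  the exponent is a sum and the characteristic function a product.\<close>

lemma indep_L:
  fixes t :: "nat \<Rightarrow> real"
  assumes mono: "strict_mono_on {..n} t" and t: "t ` {..n} \<subseteq> {0..<1}"
  shows "indep_vars (\<lambda>_. borel) (\<lambda>i \<omega>. L (t (Suc i)) \<omega> - L (t i) \<omega>) {..<n}"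
proof (rule indep_vars_if_char_eq_prod)
  let ?D = "\<lambda>i \<omega>. L (t (Suc i)) \<omega> - L (t i) \<omega>"
  define \<kappa> where "\<kappa> i v = k (t (Suc i)) v - k (t i) v" for i v
  have t01: "t i \<in> {0..<1}" if "i \<le> n" for i using t that by auto
  have W: "WI (\<kappa> i) (?D i)" if "i < n" for i
    unfolding \<kappa>_def[abs_def] using that by (intro L_increments t01) auto
  have le: "t i \<le> t j" if "i \<le> j" "j \<le> n" for i j
    using mono that by (auto simp: strict_mono_on_less_eq)
  have orth: "(\<integral>v. \<kappa> i v * \<kappa> j v \<partial>unit_lborel) = (if i = j then t (Suc i) - t i else 0)" if ij: "i < n" "j < n" for i j
  proof -
    have "(\<integral>v. \<kappa> i v * \<kappa> j v \<partial>unit_lborel) = min (t (Suc i)) (t (Suc j)) - min (t (Suc i)) (t j) - min (t i) (t (Suc j)) + min (t i) (t j)"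
      unfolding \<kappa>_def using ij by (intro integral_k_increments t01) auto
    moreover have "t i \<le> t (Suc i)" "t j \<le> t (Suc j)" using le ij by auto
    moreover have "t (Suc i) \<le> t j" if "i < j" using le[of "Suc i" j] that ij by auto
    moreover have "t (Suc j) \<le> t i" if "j < i" using le[of "Suc j" i] that ij by auto
    ultimately show ?thesis by (cases i j rule: linorder_cases) (auto simp: min_def)
  qed
  show "?D i \<in> borel_measurable M" if "i < n" for i using WI_measurable(2)[OF W[OF that]] .
  fix c :: "nat \<Rightarrow> real"
  have WS: "WI (\<lambda>v. \<Sum>i<n. c i * \<kappa> i v) (\<lambda>\<omega>. \<Sum>i<n. c i * ?D i \<omega>)"
    by (intro WI_sum WI_cmult W) auto
  have ii: "integrable unit_lborel (\<lambda>v. \<kappa> i v * \<kappa> j v)" if "i < n" "j < n" for i j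
    by (intro integrable_sq_mult WI_sq_integrable[OF W] that)
  have "(\<integral>v. (\<Sum>i<n. c i * \<kappa> i v)\<^sup>2 \<partial>unit_lborel) = (\<integral>v. (\<Sum>i<n. \<Sum>j<n. c i * c j * (\<kappa> i v * \<kappa> j v)) \<partial>unit_lborel)"
    by (intro Bochner_Integration.integral_cong refl) (simp add: power2_eq_square sum_product mult_ac)
  also have "\<dots> = (\<Sum>i<n. \<Sum>j<n. c i * c j * (\<integral>v. \<kappa> i v * \<kappa> j v \<partial>unit_lborel))"
    using ii by (subst Bochner_Integration.integral_sum) (auto intro!: Bochner_Integration.integrable_sum)
  also have "\<dots> = (\<Sum>i<n. \<Sum>j<n. if i = j then (c i)\<^sup>2 * (t (Suc i) - t i) else 0)"
    by (intro sum.cong refl) (auto simp: orth power2_eq_square)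
  also have "\<dots> = (\<Sum>i<n. (c i)\<^sup>2 * (t (Suc i) - t i))" by simp
  finally have norm: "(\<integral>v. (\<Sum>i<n. c i * \<kappa> i v)\<^sup>2 \<partial>unit_lborel) = (\<Sum>i<n. (c i)\<^sup>2 * (t (Suc i) - t i))" .
  have "(\<integral>\<omega>. iexp (\<Sum>i<n. c i * ?D i \<omega>) \<partial>M) = of_real (exp (- (\<Sum>i<n. (c i)\<^sup>2 * (t (Suc i) - t i)) / 2))"
    using WI_char[OF WS, of 1] unfolding norm by simp
  also have "- (\<Sum>i<n. (c i)\<^sup>2 * (t (Suc i) - t i)) / 2 = (\<Sum>i<n. - ((c i)\<^sup>2 * (t (Suc i) - t i)) / 2)"
    by (simp add: sum_negf sum_divide_distrib)
  also have "of_real (exp \<dots>) = (\<Prod>i<n. of_real (exp (- ((c i)\<^sup>2 * (t (Suc i) - t i)) / 2)) :: complex)"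
    by (simp add: exp_sum)
  also have "\<dots> = (\<Prod>i<n. \<integral>\<omega>. iexp (c i * ?D i \<omega>) \<partial>M)"
  proof (intro prod.cong refl)
    fix i assume "i \<in> {..<n}"
    then show "of_real (exp (- ((c i)\<^sup>2 * (t (Suc i) - t i)) / 2)) = (\<integral>\<omega>. iexp (c i * ?D i \<omega>) \<partial>M)"
      using WI_char[OF W[of i], of "c i"] orth[of i i] by (simp add: power2_eq_square)
  qed
  finally show "(\<integral>\<omega>. iexp (\<Sum>i<n. c i * ?D i \<omega>) \<partial>M) = (\<Prod>i<n. \<integral>\<omega>. iexp (c i * ?D i \<omega>) \<partial>M)" .
qed

text \<open>Along paths, \<open>J\<close> is known to be integrable only over \<open>(0, b)\<close>
  with \<open>b < 1\<close>. Continuity is proved on each \<open>{0..<b}\<close> and, being local,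
  carries over to \<open>{0..<1}\<close>.\<close>

lemma AE_continuous_L: "AE \<omega> in M. continuous_on {0..<1} (\<lambda>t. L t \<omega>)"
proof -
  have "AE \<omega> in M. continuous_on {0..1} (\<lambda>t. w t \<omega>)" using wiener by (simp add: wiener_process_def)
  then show ?thesis using int AE_space
  proof eventually_elim
    case (elim \<omega>)
    have loc: "continuous_on {0..<b} (\<lambda>t. L t \<omega>)" if b: "b \<in> {0..<1}" for b
    proof -
      have iJ: "integrable unit_lborel (\<lambda>s. indicator {0<..<b} s *\<^sub>R J s \<omega>)"
        using elim(2) b set_integrable_subinterval[of 0 b "\<lambda>s. J s \<omega>"] by simp
      have "continuous_on {0..<b} (\<lambda>t. w t \<omega> - \<zeta> \<omega> \<bullet> (\<integral>s. indicator {0<..<t} s *\<^sub>R h s \<partial>unit_lborel)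
          + (\<integral>s. indicator {0<..<t} s *\<^sub>R (indicator {0<..<b} s *\<^sub>R J s \<omega>) \<partial>unit_lborel))"
        using b
        by (intro continuous_intros continuous_on_subset[OF elim(1)]
            continuous_on_subset[OF continuous_on_indefinite_integral[OF h_integrable]]
            continuous_on_subset[OF continuous_on_indefinite_integral[OF iJ]]) auto
      then show ?thesis
      proof (rule continuous_on_eq)
        fix t assume t: "t \<in> {0..<b}"
        have "(\<integral>s. indicator {0<..<t} s *\<^sub>R (indicator {0<..<b} s *\<^sub>R J s \<omega>) \<partial>unit_lborel) = (\<integral>s. indicator {0<..<t} s *\<^sub>R J s \<omega> \<partial>unit_lborel)"
          using t by (intro Bochner_Integration.integral_cong refl) (auto simp: indicator_def)
        then show "w t \<omega> - \<zeta> \<omega> \<bullet> (\<integral>s. indicator {0<..<t} s *\<^sub>R h s \<partial>unit_lborel)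
            + (\<integral>s. indicator {0<..<t} s *\<^sub>R (indicator {0<..<b} s *\<^sub>R J s \<omega>) \<partial>unit_lborel) = L t \<omega>"
          using L_eq[of t \<omega>] t b elim(3) by simp
      qed
    qed
    show ?case
      unfolding continuous_on_def
    proof
      fix x :: real assume x: "x \<in> {0..<1}"
      define b where "b = (x + 1) / 2"
      have b: "x < b" "b \<in> {0..<1}" using x by (auto simp: b_def)
      have "at x within {0..<1} = at x within {0..<b}"
        by (rule at_within_nhd[of x "{..<b}"]) (use b in auto)
      moreover have "((\<lambda>t. L t \<omega>) \<longlongrightarrow> L x \<omega>) (at x within {0..<b})"
        using loc[OF b(2)] x b unfolding continuous_on_def by auto
      ultimately show "((\<lambda>t. L t \<omega>) \<longlongrightarrow> L x \<omega>) (at x within {0..<1})" by simp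
    qed
  qed
qed

lemma wiener_process_L: "wiener_process M {0..<1} L"
  unfolding wiener_process_def
proof (intro conjI ballI allI impI)
  show "prob_space M" by unfold_locales
  show "AE \<omega> in M. L 0 \<omega> = 0"
    using AE_w_zero AE_space by eventually_elim (simp add: L_eq)
qed (use L_measurable distributed_L indep_L AE_continuous_L in auto)

end

lemma wiener_process_L2_transform:
  assumes "is_L2_transform M h w \<zeta> L"
  shows "wiener_process M {0..<1} L"
  using assms unfolding is_L2_transform_def joint_measurable_iff
  by (elim exE conjE) (rule wiener_process_L; simp)

end

text \<open>The Wiener integral of \<open>h\<close> and the transform are given only as versions, so
  the claim is made for every choice of them; the two existence statements keep it from being
  vacuous.\<close>

theorem theorem2:
  fixes h :: "real \<Rightarrow> real ^ 'd"
    and w :: "real \<Rightarrow> 'a \<Rightarrow> real"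
    and M :: "'a measure"
  assumes h_cont: "continuous_on {0<..<1} h"
    and h_int: "set_integrable lborel {0<..<1} (\<lambda>s. outer (h s))"
    and h_orth: "(LINT s:{0<..<1}|lborel. outer (h s)) = mat 1"
    and N_nondeg: "\<And>t. t \<in> {0..<1} \<Longrightarrow> invertible (N_mat h t)"
    and w_wiener: "wiener_process M {0..1} w"
  shows "(\<exists>\<zeta>. has_vec_wiener_integral M w 0 1 h \<zeta>) \<and>
         (\<forall>\<zeta>. has_vec_wiener_integral M w 0 1 h \<zeta> \<longrightarrow>
            (\<exists>L. is_L2_transform M h w \<zeta> L) \<and>
            (\<forall>L. is_L2_transform M h w \<zeta> L \<longrightarrow> wiener_process M {0..<1} L))"
proof (intro conjI allI impI)
  interpret bridge M w h by unfold_locales (fact assms)+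
  show "\<exists>\<zeta>. has_vec_wiener_integral M w 0 1 h \<zeta>" by (rule vec_wiener_integral_exists)
  fix \<zeta> assume "has_vec_wiener_integral M w 0 1 h \<zeta>"
  then interpret bridge_coefficient M w h \<zeta> by unfold_locales
  show "\<exists>L. is_L2_transform M h w \<zeta> L" by (rule L2_transform_exists)
  show "wiener_process M {0..<1} L" if "is_L2_transform M h w \<zeta> L" for L
    using that by (rule wiener_process_L2_transform)
qed

end
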